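(* Let $\Bbbk$ be a commutative ring, let $t\in\Bbbk$, and let $k,l$ be nonnegative integers. The $\Bbbk$-module $\mathrm{Hom}_{\mathcal{M}(t)}(k,l)$ in the Motzkin category $\mathcal{M}(t)$ has a linear basis given by all Motzkin diagrams of type $\binom{l}{k}$. (That is: each Motzkin diagram $D$ of type $\binom{l}{k}$ is represented by a morphism of $\mathcal{M}(t)$, this morphism is independent of the choice of representative, and the family of these morphisms, indexed by the Motzkin diagrams of type $\binom{l}{k}$, is a $\Bbbk$-basis of $\mathrm{Hom}_{\mathcal{M}(t)}(k,l)$.)
   Context: Partition diagrams. A partition of type $\binom{l}{k}$, written $D\colon k\to l$, is a set partition of $\{1,\dots,k,1',\dots,l'\}$; its elements are called blocks. It is drawn as a partition diagram with $k$ vertices $1,\dots,k$ (left to right) in the bottom row and $l$ vertices $1',\dots,l'$ (left to right) in the top row, with edges chosen so that the connected components are the blocks; diagrams giving the same set partition are identified. $D$ is planar if it can be drawn without edge crossings inside the rectangle formed by its vertices. $D$ is a Motzkin diagram if it is planar and all blocks have size at most 2. Partition category. $\mathcal{P}ar(t)$ is the strict $\Bbbk$-linear monoidal category with objects the nonnegative integers, $\mathrm{Hom}(k,l)$ the free $\Bbbk$-module on partitions of type $\binom{l}{k}$, composition $D\circ D'=t^{\alpha(D,D')}D\star D'$ extended bilinearly, where, stacking $D\colon k\to l$ on top of $D'\colon m\to k$, $\alpha(D,D')$ is the number of connected components all of whose vertices are in the middle row, and $D\star D'\colon m\to l$ is the partition in which vertices lie in the same block iff the corresponding top/bottom vertices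 are connected in the stacked diagram; tensor product is $k\otimes l=k+l$ on objects (unit object $0$) and horizontal juxtaposition ($D$ on the left, $D'$ on the right) for $D\otimes D'$. Motzkin category. $\mathcal{M}(t)$ is the strict $\Bbbk$-linear monoidal category generated by one object $1$ and morphisms $d\colon2\to0$, $c\colon0\to2$, $\eta\colon0\to1$, $\varepsilon\colon1\to0$ (where $0$ is the unit object, $k$ is the $k$-fold tensor power of $1$, and $\mathrm{id}=\mathrm{id}_1$), subject to the relations $d\circ(\mathrm{id}\otimes\eta)=\varepsilon=d\circ(\eta\otimes\mathrm{id})$; $(\mathrm{id}\otimes\varepsilon)\circ c=\eta=(\varepsilon\otimes\mathrm{id})\circ c$; $(d\otimes\mathrm{id})\circ(\mathrm{id}\otimes c)=\mathrm{id}=(\mathrm{id}\otimes d)\circ(c\otimes\mathrm{id})$; $d\circ c=\varepsilon\circ\eta=t\,\mathrm{id}_0$. Diagrams as morphisms. There is a canonical strict $\Bbbk$-linear monoidal functor $J\colon\mathcal{M}(t)\to\mathcal{P}ar(t)$ with $1\mapsto1$, $d\mapsto\{\{1,2\}\}$, $c\mapsto\{\{1',2'\}\}$, and $\eta,\varepsilon$ sent to the unique partitions of type $\binom10$, $\binom01$. A morphism of $\mathcal{M}(t)$ represents a Motzkin diagram $D$ if it is obtained from the generators and identity morphisms by finitely many compositions and tensor products and its image under $J$ is $D$. A Motzkin diagram is regarded as a morphism of $\mathcal{M}(t)$ via such a representing morphism. *)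

theory Defs
  imports
    "HOL-Analysis.Analysis"
    "HOL-Algebra.Module"
    "HOL-Library.Disjoint_Sets"
begin

section \<open>Partition diagrams\<close>

datatype vertex = Bot nat | Top nat

type_synonym diagram = "vertex set set"

definition vertices :: "nat \<Rightarrow> nat \<Rightarrow> vertex set" where
  "vertices k l = Bot ` {1..k} \<union> Top ` {1..l}"

text \<open>Partitions \<open>D : k \<rightarrow> l\<close>, with \<open>k\<close> bottom and \<open>l\<close> top vertices.\<close>

definition partitions :: "nat \<Rightarrow> nat \<Rightarrow> diagram set" where
  "partitions k l = {D. partition_on (vertices k l) D}"

text \<open>The connected components of the graph with vertex set \<open>V\<close> and adjacency relation \<open>r\<close>
  (which is meant to be symmetric).\<close>

definition components_of_rel :: "'v set \<Rightarrow> ('v \<times> 'v) set \<Rightarrow> 'v set set" where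
  "components_of_rel V r = V // (r\<^sup>* \<inter> V \<times> V)"

subsection \<open>Planarity\<close>

text \<open>The bottom vertices are placed at height 0 and the top vertices at height 1, from left to
  right; the rectangle formed by the vertices is their bounding box.\<close>

fun vertex_pos :: "vertex \<Rightarrow> real ^ 2" where
  "vertex_pos (Bot i) = vector [real i, 0]"
| "vertex_pos (Top j) = vector [real j, 1]"

definition rectangle :: "nat \<Rightarrow> nat \<Rightarrow> (real ^ 2) set" where
  "rectangle k l = cbox (vector [1, 0]) (vector [real (max k l), 1])"

text \<open>A choice \<open>E\<close> of (simple, undirected) edges for drawing the partition \<open>D\<close>.\<close>

definition edges_for :: "nat \<Rightarrow> nat \<Rightarrow> diagram \<Rightarrow> vertex set set \<Rightarrow> bool" where
  "edges_for k l D E \<longleftrightarrow>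
     (\<forall>e\<in>E. e \<subseteq> vertices k l \<and> card e = 2) \<and>
     components_of_rel (vertices k l) {(u, v). {u, v} \<in> E} = D"

text \<open>A drawing of the edges \<open>E\<close> inside the rectangle without crossings: the edge \<open>e\<close> is drawn as
  the simple arc \<open>\<gamma> e\<close>, which joins the two ends of \<open>e\<close> and runs through no other vertex, and two
  different edges may only meet in a common end.\<close>

definition crossing_free_drawing ::
  "nat \<Rightarrow> nat \<Rightarrow> vertex set set \<Rightarrow> (vertex set \<Rightarrow> real \<Rightarrow> real ^ 2) \<Rightarrow> bool" where
  "crossing_free_drawing k l E \<gamma> \<longleftrightarrow>
     (\<forall>e\<in>E. arc (\<gamma> e) \<and> path_image (\<gamma> e) \<subseteq> rectangle k l \<and>
        {pathstart (\<gamma> e), pathfinish (\<gamma> e)} = vertex_pos ` e \<and>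
        path_image (\<gamma> e) \<inter> vertex_pos ` vertices k l = vertex_pos ` e) \<and>
     (\<forall>e\<in>E. \<forall>e'\<in>E. e \<noteq> e' \<longrightarrow>
        path_image (\<gamma> e) \<inter> path_image (\<gamma> e') \<subseteq> vertex_pos ` (e \<inter> e'))"

definition planar :: "nat \<Rightarrow> nat \<Rightarrow> diagram \<Rightarrow> bool" where
  "planar k l D \<longleftrightarrow> (\<exists>E \<gamma>. edges_for k l D E \<and> crossing_free_drawing k l E \<gamma>)"

definition motzkin_diagrams :: "nat \<Rightarrow> nat \<Rightarrow> diagram set" where
  "motzkin_diagrams k l = {D \<in> partitions k l. planar k l D \<and> (\<forall>B\<in>D. card B \<le> 2)}"

subsection \<open>Stacking and juxtaposition\<close>

datatype stack_vertex = Lower nat | Middle nat | Upper nat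

fun in_upper_diagram :: "vertex \<Rightarrow> stack_vertex" where
  "in_upper_diagram (Bot i) = Middle i"
| "in_upper_diagram (Top j) = Upper j"

fun in_lower_diagram :: "vertex \<Rightarrow> stack_vertex" where
  "in_lower_diagram (Bot i) = Lower i"
| "in_lower_diagram (Top j) = Middle j"

text \<open>In the following, \<open>D : k \<rightarrow> l\<close> is stacked on top of \<open>D' : m \<rightarrow> k\<close>; then
  \<open>stack_loops\<close> is the exponent \<open>\<alpha>(D, D')\<close> and \<open>stack_diagram\<close> is \<open>D \<star> D'\<close>.\<close>

definition stack_vertices :: "nat \<Rightarrow> nat \<Rightarrow> nat \<Rightarrow> stack_vertex set" where
  "stack_vertices m k l = Lower ` {1..m} \<union> Middle ` {1..k} \<union> Upper ` {1..l}"

definition stack_adjacent :: "diagram \<Rightarrow> diagram \<Rightarrow> (stack_vertex \<times> stack_vertex) set" where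
  "stack_adjacent D D' =
     (\<Union>B\<in>D. in_upper_diagram ` B \<times> in_upper_diagram ` B) \<union>
     (\<Union>B\<in>D'. in_lower_diagram ` B \<times> in_lower_diagram ` B)"

definition stack_components ::
  "nat \<Rightarrow> nat \<Rightarrow> nat \<Rightarrow> diagram \<Rightarrow> diagram \<Rightarrow> stack_vertex set set" where
  "stack_components m k l D D' = components_of_rel (stack_vertices m k l) (stack_adjacent D D')"

definition stack_loops :: "nat \<Rightarrow> nat \<Rightarrow> nat \<Rightarrow> diagram \<Rightarrow> diagram \<Rightarrow> nat" where
  "stack_loops m k l D D' = card {C \<in> stack_components m k l D D'. C \<subseteq> range Middle}"

definition stack_diagram :: "nat \<Rightarrow> nat \<Rightarrow> nat \<Rightarrow> diagram \<Rightarrow> diagram \<Rightarrow> diagram" where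
  "stack_diagram m k l D D' =
     (\<lambda>C. {Bot i |i. Lower i \<in> C} \<union> {Top j |j. Upper j \<in> C}) ` stack_components m k l D D' - {{}}"

fun shift_vertex :: "nat \<Rightarrow> nat \<Rightarrow> vertex \<Rightarrow> vertex" where
  "shift_vertex k l (Bot i) = Bot (k + i)"
| "shift_vertex k l (Top j) = Top (l + j)"

text \<open>\<open>D : k \<rightarrow> l\<close> to the left of \<open>D'\<close>.\<close>

definition juxtapose :: "nat \<Rightarrow> nat \<Rightarrow> diagram \<Rightarrow> diagram \<Rightarrow> diagram" where
  "juxtapose k l D D' = D \<union> (\<lambda>B. shift_vertex k l ` B) ` D'"

definition id_diagram :: "nat \<Rightarrow> diagram" where
  "id_diagram n = {{Bot i, Top i} |i. i \<in> {1..n}}"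

section \<open>The partition category\<close>

text \<open>A morphism \<open>k \<rightarrow> l\<close> is given by its coefficients with respect to the partitions in
  \<^term>\<open>partitions k l\<close>, all other coefficients being zero.\<close>

definition par_basis :: "('a, 'b) ring_scheme \<Rightarrow> diagram \<Rightarrow> diagram \<Rightarrow> 'a" where
  "par_basis R D = (\<lambda>P. if P = D then \<one>\<^bsub>R\<^esub> else \<zero>\<^bsub>R\<^esub>)"

text \<open>The bilinear extension of \<open>D \<circ> D' = t\<^sup>\<alpha> D \<star> D'\<close> to \<open>x : k \<rightarrow> l\<close> and \<open>y : m \<rightarrow> k\<close>.\<close>

definition par_comp ::
  "('a, 'b) ring_scheme \<Rightarrow> 'a \<Rightarrow> nat \<Rightarrow> nat \<Rightarrow> nat \<Rightarrow>
   (diagram \<Rightarrow> 'a) \<Rightarrow> (diagram \<Rightarrow> 'a) \<Rightarrow> diagram \<Rightarrow> 'a" where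
  "par_comp R t m k l x y =
     (\<lambda>P. \<Oplus>\<^bsub>R\<^esub>D\<in>partitions k l. \<Oplus>\<^bsub>R\<^esub>D'\<in>partitions m k.
        x D \<otimes>\<^bsub>R\<^esub> y D' \<otimes>\<^bsub>R\<^esub>
          (t [^]\<^bsub>R\<^esub> stack_loops m k l D D' \<otimes>\<^bsub>R\<^esub> par_basis R (stack_diagram m k l D D') P))"

text \<open>The tensor product of \<open>x : k \<rightarrow> l\<close> and \<open>y : k' \<rightarrow> l'\<close>.\<close>

definition par_tensor ::
  "('a, 'b) ring_scheme \<Rightarrow> nat \<Rightarrow> nat \<Rightarrow> nat \<Rightarrow> nat \<Rightarrow>
   (diagram \<Rightarrow> 'a) \<Rightarrow> (diagram \<Rightarrow> 'a) \<Rightarrow> diagram \<Rightarrow> 'a" where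
  "par_tensor R k l k' l' x y =
     (\<lambda>P. \<Oplus>\<^bsub>R\<^esub>D\<in>partitions k l. \<Oplus>\<^bsub>R\<^esub>D'\<in>partitions k' l'.
        x D \<otimes>\<^bsub>R\<^esub> y D' \<otimes>\<^bsub>R\<^esub> par_basis R (juxtapose k l D D') P)"

section \<open>The Motzkin category\<close>

text \<open>Terms built from the generators by the operations of a linear monoidal category. The object
  \<open>k\<close> is the \<open>k\<close>-fold tensor power of the generating object.\<close>

datatype 'a mterm =
    IdM nat
  | Dgen
  | Cgen
  | Eta
  | Eps
  | CompM "'a mterm" "'a mterm"  (infixl \<open>\<circ>\<^sub>m\<close> 70)
  | TensM "'a mterm" "'a mterm"  (infixl \<open>\<otimes>\<^sub>m\<close> 75)
  | ZeroM nat nat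
  | AddM "'a mterm" "'a mterm"  (infixl \<open>\<oplus>\<^sub>m\<close> 65)
  | ScaleM 'a "'a mterm"  (infixr \<open>\<odot>\<^sub>m\<close> 80)

primrec src :: "'a mterm \<Rightarrow> nat" where
  "src (IdM n) = n"
| "src Dgen = 2"
| "src Cgen = 0"
| "src Eta = 0"
| "src Eps = 1"
| "src (f \<circ>\<^sub>m g) = src g"
| "src (f \<otimes>\<^sub>m g) = src f + src g"
| "src (ZeroM k l) = k"
| "src (f \<oplus>\<^sub>m g) = src f"
| "src (a \<odot>\<^sub>m f) = src f"

primrec tgt :: "'a mterm \<Rightarrow> nat" where
  "tgt (IdM n) = n"
| "tgt Dgen = 0"
| "tgt Cgen = 2"
| "tgt Eta = 1"
| "tgt Eps = 0"
| "tgt (f \<circ>\<^sub>m g) = tgt f"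
| "tgt (f \<otimes>\<^sub>m g) = tgt f + tgt g"
| "tgt (ZeroM k l) = l"
| "tgt (f \<oplus>\<^sub>m g) = tgt f"
| "tgt (a \<odot>\<^sub>m f) = tgt f"

primrec wf_term :: "('a, 'b) ring_scheme \<Rightarrow> 'a mterm \<Rightarrow> bool" where
  "wf_term R (IdM n) \<longleftrightarrow> True"
| "wf_term R Dgen \<longleftrightarrow> True"
| "wf_term R Cgen \<longleftrightarrow> True"
| "wf_term R Eta \<longleftrightarrow> True"
| "wf_term R Eps \<longleftrightarrow> True"
| "wf_term R (f \<circ>\<^sub>m g) \<longleftrightarrow> wf_term R f \<and> wf_term R g \<and> src f = tgt g"
| "wf_term R (f \<otimes>\<^sub>m g) \<longleftrightarrow> wf_term R f \<and> wf_term R g"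
| "wf_term R (ZeroM k l) \<longleftrightarrow> True"
| "wf_term R (f \<oplus>\<^sub>m g) \<longleftrightarrow> wf_term R f \<and> wf_term R g \<and> src f = src g \<and> tgt f = tgt g"
| "wf_term R (a \<odot>\<^sub>m f) \<longleftrightarrow> a \<in> carrier R \<and> wf_term R f"

definition terms :: "('a, 'b) ring_scheme \<Rightarrow> nat \<Rightarrow> nat \<Rightarrow> 'a mterm set" where
  "terms R k l = {f. wf_term R f \<and> src f = k \<and> tgt f = l}"

text \<open>Equality of morphisms in the Motzkin category: the least congruence on well-formed terms which
  contains the axioms of strict linear monoidal categories and the defining relations.\<close>

inductive meq :: "('a, 'b) ring_scheme \<Rightarrow> 'a \<Rightarrow> 'a mterm \<Rightarrow> 'a mterm \<Rightarrow> bool"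
  for R (structure) and t :: 'a
where
  refl: "wf_term R f \<Longrightarrow> meq R t f f"
| sym: "meq R t f g \<Longrightarrow> meq R t g f"
| trans: "meq R t f g \<Longrightarrow> meq R t g h \<Longrightarrow> meq R t f h"
\<comment> \<open>congruence\<close>
| cong_comp: "meq R t f f' \<Longrightarrow> meq R t g g' \<Longrightarrow> src f = tgt g \<Longrightarrow>
    meq R t (f \<circ>\<^sub>m g) (f' \<circ>\<^sub>m g')"
| cong_tens: "meq R t f f' \<Longrightarrow> meq R t g g' \<Longrightarrow> meq R t (f \<otimes>\<^sub>m g) (f' \<otimes>\<^sub>m g')"
| cong_add: "meq R t f f' \<Longrightarrow> meq R t g g' \<Longrightarrow> src f = src g \<Longrightarrow> tgt f = tgt g \<Longrightarrow>
    meq R t (f \<oplus>\<^sub>m g) (f' \<oplus>\<^sub>m g')"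
| cong_scale: "a \<in> carrier R \<Longrightarrow> meq R t f f' \<Longrightarrow> meq R t (a \<odot>\<^sub>m f) (a \<odot>\<^sub>m f')"
\<comment> \<open>category\<close>
| comp_assoc: "f \<in> terms R m n \<Longrightarrow> g \<in> terms R l m \<Longrightarrow> h \<in> terms R k l \<Longrightarrow>
    meq R t ((f \<circ>\<^sub>m g) \<circ>\<^sub>m h) (f \<circ>\<^sub>m (g \<circ>\<^sub>m h))"
| comp_id_right: "f \<in> terms R k l \<Longrightarrow> meq R t (f \<circ>\<^sub>m IdM k) f"
| comp_id_left: "f \<in> terms R k l \<Longrightarrow> meq R t (IdM l \<circ>\<^sub>m f) f"
\<comment> \<open>strict monoidal category\<close>
| tens_id: "meq R t (IdM k \<otimes>\<^sub>m IdM l) (IdM (k + l))"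
| interchange: "f \<in> terms R l m \<Longrightarrow> g \<in> terms R k l \<Longrightarrow> f' \<in> terms R l' m' \<Longrightarrow> g' \<in> terms R k' l' \<Longrightarrow>
    meq R t ((f \<circ>\<^sub>m g) \<otimes>\<^sub>m (f' \<circ>\<^sub>m g')) ((f \<otimes>\<^sub>m f') \<circ>\<^sub>m (g \<otimes>\<^sub>m g'))"
| tens_assoc: "wf_term R f \<Longrightarrow> wf_term R g \<Longrightarrow> wf_term R h \<Longrightarrow>
    meq R t ((f \<otimes>\<^sub>m g) \<otimes>\<^sub>m h) (f \<otimes>\<^sub>m (g \<otimes>\<^sub>m h))"
| tens_unit_right: "wf_term R f \<Longrightarrow> meq R t (f \<otimes>\<^sub>m IdM 0) f"
| tens_unit_left: "wf_term R f \<Longrightarrow> meq R t (IdM 0 \<otimes>\<^sub>m f) f"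
\<comment> \<open>modules of morphisms\<close>
| add_assoc: "f \<in> terms R k l \<Longrightarrow> g \<in> terms R k l \<Longrightarrow> h \<in> terms R k l \<Longrightarrow>
    meq R t ((f \<oplus>\<^sub>m g) \<oplus>\<^sub>m h) (f \<oplus>\<^sub>m (g \<oplus>\<^sub>m h))"
| add_comm: "f \<in> terms R k l \<Longrightarrow> g \<in> terms R k l \<Longrightarrow> meq R t (f \<oplus>\<^sub>m g) (g \<oplus>\<^sub>m f)"
| add_zero: "f \<in> terms R k l \<Longrightarrow> meq R t (f \<oplus>\<^sub>m ZeroM k l) f"
| add_minus: "f \<in> terms R k l \<Longrightarrow> meq R t (f \<oplus>\<^sub>m (\<ominus> \<one>) \<odot>\<^sub>m f) (ZeroM k l)"
| scale_one: "wf_term R f \<Longrightarrow> meq R t (\<one> \<odot>\<^sub>m f) f"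
| scale_scale: "a \<in> carrier R \<Longrightarrow> b \<in> carrier R \<Longrightarrow> wf_term R f \<Longrightarrow>
    meq R t ((a \<otimes> b) \<odot>\<^sub>m f) (a \<odot>\<^sub>m b \<odot>\<^sub>m f)"
| scale_add_left: "a \<in> carrier R \<Longrightarrow> b \<in> carrier R \<Longrightarrow> wf_term R f \<Longrightarrow>
    meq R t ((a \<oplus> b) \<odot>\<^sub>m f) (a \<odot>\<^sub>m f \<oplus>\<^sub>m b \<odot>\<^sub>m f)"
| scale_add_right: "a \<in> carrier R \<Longrightarrow> f \<in> terms R k l \<Longrightarrow> g \<in> terms R k l \<Longrightarrow>
    meq R t (a \<odot>\<^sub>m (f \<oplus>\<^sub>m g)) (a \<odot>\<^sub>m f \<oplus>\<^sub>m a \<odot>\<^sub>m g)"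
\<comment> \<open>bilinearity of composition and tensor product\<close>
| comp_add_left: "f \<in> terms R l m \<Longrightarrow> f' \<in> terms R l m \<Longrightarrow> g \<in> terms R k l \<Longrightarrow>
    meq R t ((f \<oplus>\<^sub>m f') \<circ>\<^sub>m g) (f \<circ>\<^sub>m g \<oplus>\<^sub>m f' \<circ>\<^sub>m g)"
| comp_add_right: "f \<in> terms R l m \<Longrightarrow> g \<in> terms R k l \<Longrightarrow> g' \<in> terms R k l \<Longrightarrow>
    meq R t (f \<circ>\<^sub>m (g \<oplus>\<^sub>m g')) (f \<circ>\<^sub>m g \<oplus>\<^sub>m f \<circ>\<^sub>m g')"
| comp_scale_left: "a \<in> carrier R \<Longrightarrow> f \<in> terms R l m \<Longrightarrow> g \<in> terms R k l \<Longrightarrow>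
    meq R t ((a \<odot>\<^sub>m f) \<circ>\<^sub>m g) (a \<odot>\<^sub>m (f \<circ>\<^sub>m g))"
| comp_scale_right: "a \<in> carrier R \<Longrightarrow> f \<in> terms R l m \<Longrightarrow> g \<in> terms R k l \<Longrightarrow>
    meq R t (f \<circ>\<^sub>m (a \<odot>\<^sub>m g)) (a \<odot>\<^sub>m (f \<circ>\<^sub>m g))"
| tens_add_left: "f \<in> terms R k l \<Longrightarrow> f' \<in> terms R k l \<Longrightarrow> wf_term R g \<Longrightarrow>
    meq R t ((f \<oplus>\<^sub>m f') \<otimes>\<^sub>m g) (f \<otimes>\<^sub>m g \<oplus>\<^sub>m f' \<otimes>\<^sub>m g)"
| tens_add_right: "wf_term R f \<Longrightarrow> g \<in> terms R k l \<Longrightarrow> g' \<in> terms R k l \<Longrightarrow>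
    meq R t (f \<otimes>\<^sub>m (g \<oplus>\<^sub>m g')) (f \<otimes>\<^sub>m g \<oplus>\<^sub>m f \<otimes>\<^sub>m g')"
| tens_scale_left: "a \<in> carrier R \<Longrightarrow> wf_term R f \<Longrightarrow> wf_term R g \<Longrightarrow>
    meq R t ((a \<odot>\<^sub>m f) \<otimes>\<^sub>m g) (a \<odot>\<^sub>m (f \<otimes>\<^sub>m g))"
| tens_scale_right: "a \<in> carrier R \<Longrightarrow> wf_term R f \<Longrightarrow> wf_term R g \<Longrightarrow>
    meq R t (f \<otimes>\<^sub>m (a \<odot>\<^sub>m g)) (a \<odot>\<^sub>m (f \<otimes>\<^sub>m g))"
\<comment> \<open>defining relations\<close>
| d_eta_right: "meq R t (Dgen \<circ>\<^sub>m (IdM 1 \<otimes>\<^sub>m Eta)) Eps"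
| d_eta_left: "meq R t (Dgen \<circ>\<^sub>m (Eta \<otimes>\<^sub>m IdM 1)) Eps"
| eps_c_right: "meq R t ((IdM 1 \<otimes>\<^sub>m Eps) \<circ>\<^sub>m Cgen) Eta"
| eps_c_left: "meq R t ((Eps \<otimes>\<^sub>m IdM 1) \<circ>\<^sub>m Cgen) Eta"
| zigzag_left: "meq R t ((Dgen \<otimes>\<^sub>m IdM 1) \<circ>\<^sub>m (IdM 1 \<otimes>\<^sub>m Cgen)) (IdM 1)"
| zigzag_right: "meq R t ((IdM 1 \<otimes>\<^sub>m Dgen) \<circ>\<^sub>m (Cgen \<otimes>\<^sub>m IdM 1)) (IdM 1)"
| d_c: "meq R t (Dgen \<circ>\<^sub>m Cgen) (t \<odot>\<^sub>m IdM 0)"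
| eps_eta: "meq R t (Eps \<circ>\<^sub>m Eta) (t \<odot>\<^sub>m IdM 0)"

definition morph :: "('a, 'b) ring_scheme \<Rightarrow> 'a \<Rightarrow> 'a mterm \<Rightarrow> 'a mterm set" where
  "morph R t f = {g. meq R t f g}"

text \<open>The module of morphisms \<open>k \<rightarrow> l\<close>, whose elements are equivalence classes of terms. The type of
  modules in \<^theory>\<open>HOL-Algebra.Module\<close> extends that of rings; the fields \<^const>\<open>mult\<close> and
  \<^const>\<open>one\<close> are irrelevant.\<close>

definition Hom_M ::
  "('a, 'b) ring_scheme \<Rightarrow> 'a \<Rightarrow> nat \<Rightarrow> nat \<Rightarrow> ('a, 'a mterm set) module" where
  "Hom_M R t k l =
     \<lparr>carrier = morph R t ` terms R k l,
      mult = undefined, one = undefined,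
      zero = morph R t (ZeroM k l),
      add = (\<lambda>X Y. \<Union>f\<in>X. \<Union>g\<in>Y. morph R t (f \<oplus>\<^sub>m g)),
      smult = (\<lambda>a X. \<Union>f\<in>X. morph R t (a \<odot>\<^sub>m f))\<rparr>"

section \<open>Diagrams as morphisms\<close>

text \<open>The functor from the Motzkin category to the partition category, on the level of terms.\<close>

primrec J :: "('a, 'b) ring_scheme \<Rightarrow> 'a \<Rightarrow> 'a mterm \<Rightarrow> diagram \<Rightarrow> 'a" where
  "J R t (IdM n) = par_basis R (id_diagram n)"
| "J R t Dgen = par_basis R {{Bot 1, Bot 2}}"
| "J R t Cgen = par_basis R {{Top 1, Top 2}}"
| "J R t Eta = par_basis R {{Top 1}}"
| "J R t Eps = par_basis R {{Bot 1}}"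
| "J R t (f \<circ>\<^sub>m g) = par_comp R t (src g) (src f) (tgt f) (J R t f) (J R t g)"
| "J R t (f \<otimes>\<^sub>m g) = par_tensor R (src f) (tgt f) (src g) (tgt g) (J R t f) (J R t g)"
| "J R t (ZeroM k l) = (\<lambda>P. \<zero>\<^bsub>R\<^esub>)"
| "J R t (f \<oplus>\<^sub>m g) = (\<lambda>P. J R t f P \<oplus>\<^bsub>R\<^esub> J R t g P)"
| "J R t (a \<odot>\<^sub>m f) = (\<lambda>P. a \<otimes>\<^bsub>R\<^esub> J R t f P)"

text \<open>Terms that are built without using the linear structure.\<close>

primrec monomial :: "'a mterm \<Rightarrow> bool" where
  "monomial (IdM n) \<longleftrightarrow> True"
| "monomial Dgen \<longleftrightarrow> True"
| "monomial Cgen \<longleftrightarrow> True"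
| "monomial Eta \<longleftrightarrow> True"
| "monomial Eps \<longleftrightarrow> True"
| "monomial (f \<circ>\<^sub>m g) \<longleftrightarrow> monomial f \<and> monomial g"
| "monomial (f \<otimes>\<^sub>m g) \<longleftrightarrow> monomial f \<and> monomial g"
| "monomial (ZeroM k l) \<longleftrightarrow> False"
| "monomial (f \<oplus>\<^sub>m g) \<longleftrightarrow> False"
| "monomial (a \<odot>\<^sub>m f) \<longleftrightarrow> False"

definition represents ::
  "('a, 'b) ring_scheme \<Rightarrow> 'a \<Rightarrow> nat \<Rightarrow> nat \<Rightarrow> 'a mterm set \<Rightarrow> diagram \<Rightarrow> bool" where
  "represents R t k l X D \<longleftrightarrow>
     (\<exists>f \<in> terms R k l. monomial f \<and> X = morph R t f \<and> J R t f = par_basis R D)"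

definition diagram_morphism ::
  "('a, 'b) ring_scheme \<Rightarrow> 'a \<Rightarrow> nat \<Rightarrow> nat \<Rightarrow> diagram \<Rightarrow> 'a mterm set" where
  "diagram_morphism R t k l D = (THE X. represents R t k l X D)"

section \<open>Bases of modules\<close>

text \<open>The family \<open>(b i)\<close>, \<open>i \<in> I\<close>, is a basis of the module \<open>M\<close>.\<close>

definition module_basis ::
  "('a, 'b) ring_scheme \<Rightarrow> ('a, 'c, 'd) module_scheme \<Rightarrow> 'i set \<Rightarrow> ('i \<Rightarrow> 'c) \<Rightarrow> bool" where
  "module_basis R M I b \<longleftrightarrow>
     Module.module R M \<and> b \<in> I \<rightarrow> carrier M \<and>
     (\<forall>A c. finite A \<and> A \<subseteq> I \<and> c \<in> A \<rightarrow> carrier R \<and>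
        (\<Oplus>\<^bsub>M\<^esub>i\<in>A. c i \<odot>\<^bsub>M\<^esub> b i) = \<zero>\<^bsub>M\<^esub> \<longrightarrow> (\<forall>i\<in>A. c i = \<zero>\<^bsub>R\<^esub>)) \<and>
     (\<forall>x\<in>carrier M. \<exists>A c. finite A \<and> A \<subseteq> I \<and> c \<in> A \<rightarrow> carrier R \<and>
        x = (\<Oplus>\<^bsub>M\<^esub>i\<in>A. c i \<odot>\<^bsub>M\<^esub> b i))"

end

theory Submission
  imports Defs
begin

text \<open>A partition \<open>D : k \<rightarrow> l\<close> is determined by the matrix recording which two-colourings of the bottom and
  the top row are constant on all blocks. Matrices multiply to \<open>2\<^sup>\<alpha>\<close> times the matrix of the stacked partition,
  so associativity and the interchange law of the partition category follow from those of matrices. Hence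
  \<^const>\<open>J\<close> is well defined on morphisms, and Motzkin diagrams are linearly independent.

  For spanning, a normal form is built from an identity by inserting units and cups on top and counits and
  caps below. The relations move every further counit or cap on top past the inserted pieces until it cancels or
  ends up below, so the normal forms span. Insertions at different places commute, so a normal form depends only
  on its diagram. The diagrams of normal forms are the matchings without crossings, which are the planar ones:
  mapping the strip to a half plane, arcs with interlaced ends have to meet, and semicircles over non-crossing
  pairs do not.\<close>

section \<open>Partitions as Boolean matrices\<close>

text \<open>The number of closed components cannot be recovered from a power of \<open>t\<close> in
  an arbitrary ring. The matrices therefore have entries in \<open>nat\<close>, where each closed
  middle component contributes a factor 2 for its two colours; one matrix identity then determines
  the stacked diagram and the exponent of \<open>t\<close> together, independently of
  \<open>R\<close>.

  Independence of the representing term needs no rewriting argument for monomial terms. Once normal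
  forms span and \<open>J\<close> sends each of them to its basis vector, the coefficients of a
  morphism in the normal forms are its coefficients under \<open>J\<close>, so two terms with the
  same image under \<open>J\<close> are equal. Uniqueness of normal forms is an argument about the
  two words of letters, where locating a removable block is a question about lists.

  A reflection that exchanges the rows exists both on diagrams and on terms and reduces most
  statements about the bottom row to the top row.\<close>

definition bools :: "nat \<Rightarrow> bool list set" where
  "bools k = {x. length x = k}"

text \<open>Vertices are numbered from 1 and list positions from 0, hence the shift. Colourings are
  lists so that placing diagrams side by side appends their colourings.\<close>

fun lab :: "bool list \<Rightarrow> bool list \<Rightarrow> vertex \<Rightarrow> bool" where
  "lab x y (Bot i) = x ! (i - 1)"
| "lab x y (Top j) = y ! (j - 1)"

definition sat :: "diagram \<Rightarrow> bool list \<Rightarrow> bool list \<Rightarrow> bool" where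
  "sat D x y \<longleftrightarrow> (\<forall>B\<in>D. \<forall>u\<in>B. \<forall>v\<in>B. lab x y u = lab x y v)"

lemma satD: "sat D x y \<Longrightarrow> B \<in> D \<Longrightarrow> u \<in> B \<Longrightarrow> v \<in> B \<Longrightarrow> lab x y u = lab x y v"
  unfolding sat_def by metis

definition dmat :: "diagram \<Rightarrow> bool list \<Rightarrow> bool list \<Rightarrow> nat" where
  "dmat D x y = of_bool (sat D x y)"

lemma finite_bools [simp]: "finite (bools k)"
  unfolding bools_def using finite_lists_length_eq[of "UNIV :: bool set" k] by simp

lemma bools_0 [simp]: "bools 0 = {[]}"
  by (auto simp: bools_def)

lemma bools_Suc: "bools (Suc n) = (\<lambda>(b, x). b # x) ` (UNIV \<times> bools n)"
  by (auto simp: bools_def image_iff length_Suc_conv)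

lemma sum_bools_Suc: "(\<Sum>x\<in>bools (Suc n). f x) = (\<Sum>b\<in>UNIV. \<Sum>x\<in>bools n. f (b # x))"
  unfolding bools_Suc
  by (subst sum.reindex) (auto simp: inj_on_def sum.cartesian_product case_prod_unfold)

lemma sum_bools_add: "(\<Sum>x\<in>bools (m + n). f x) = (\<Sum>y\<in>bools m. \<Sum>z\<in>bools n. f (y @ z))"
  by (induction m arbitrary: f) (simp_all add: sum_bools_Suc)

lemma sum_bools_delta:
  "u \<in> bools n \<Longrightarrow> (\<Sum>x\<in>bools n. of_bool (x = u) * f x) = (f u :: nat)"
  by (subst sum.mono_neutral_cong_right[of _ "{u}" _ f]) auto

lemma finite_vertices [simp]: "finite (vertices k l)"
  by (simp add: vertices_def)

lemma in_vertices [simp]: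
  "Bot i \<in> vertices k l \<longleftrightarrow> 1 \<le> i \<and> i \<le> k" "Top j \<in> vertices k l \<longleftrightarrow> 1 \<le> j \<and> j \<le> l"
  by (auto simp: vertices_def)

lemma finite_partitions [simp]: "finite (partitions k l)"
  unfolding partitions_def by (rule finitely_many_partition_on) simp

text \<open>Vertices of different blocks are separated by an admissible colouring, namely the
  indicator function of one of the blocks. The right-hand side mentions \<open>D\<close> only
  through \<open>sat\<close>, and this lets \<open>sat_inject\<close> recover the partition.\<close>

lemma partition_block_eq:
  assumes D: "D \<in> partitions k l" and B: "B \<in> D" "v \<in> B"
  shows "B = {u \<in> vertices k l. \<forall>x\<in>bools k. \<forall>y\<in>bools l. sat D x y \<longrightarrow> lab x y u = lab x y v}"
    (is "_ = ?S")
proof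
  have P: "partition_on (vertices k l) D" using D by (simp add: partitions_def)
  show "B \<subseteq> ?S" using partition_onD1[OF P] B unfolding sat_def by blast
  show "?S \<subseteq> B"
  proof
    fix u assume u: "u \<in> ?S"
    \<comment> \<open>The two rows of the indicator function of \<open>B\<close>; position
      \<open>i\<close> of a list belongs to vertex \<open>Suc i\<close>.\<close>
    define x where "x = map (\<lambda>i. Bot (Suc i) \<in> B) [0..<k]"
    define y where "y = map (\<lambda>i. Top (Suc i) \<in> B) [0..<l]"
    have lab: "lab x y w \<longleftrightarrow> w \<in> B" if "w \<in> vertices k l" for w
      using that by (cases w) (auto simp: x_def y_def)
    have "sat D x y" unfolding sat_def
    proof (intro ballI)
      fix C a b assume "C \<in> D" "a \<in> C" "b \<in> C"
      moreover have "a \<in> B \<longleftrightarrow> b \<in> B"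
        using partition_onD2[OF P] B(1) calculation by (auto simp: disjoint_def)
      ultimately show "lab x y a = lab x y b" using lab partition_onD1[OF P] by blast
    qed
    moreover have "x \<in> bools k" "y \<in> bools l" by (simp_all add: x_def y_def bools_def)
    ultimately have "lab x y u = lab x y v" using u by blast
    then show "u \<in> B" using lab[of u] lab[of v] u B partition_onD1[OF P] by blast
  qed
qed

lemma sat_inject:
  assumes D: "D \<in> partitions k l" and E: "E \<in> partitions k l"
    and eq: "\<And>x y. x \<in> bools k \<Longrightarrow> y \<in> bools l \<Longrightarrow> sat D x y = sat E x y"
  shows "D = E"
proof -
  have "D \<subseteq> E" if D: "D \<in> partitions k l" and E: "E \<in> partitions k l"
    and eq: "\<And>x y. x \<in> bools k \<Longrightarrow> y \<in> bools l \<Longrightarrow> sat D x y = sat E x y" for D E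
  proof
    fix B assume B: "B \<in> D"
    have U: "\<Union>D = vertices k l" "\<Union>E = vertices k l" "{} \<notin> D"
      using D E by (simp_all add: partitions_def partition_on_def)
    from U(3) B obtain v where v: "v \<in> B" by (metis ex_in_conv)
    then obtain C where C: "C \<in> E" "v \<in> C" using U(1,2) B by blast
    have "B = C"
      using partition_block_eq[OF D B v] partition_block_eq[OF E C] eq by auto
    then show "B \<in> E" using C by simp
  qed
  from this[OF D E] this[OF E D] eq show ?thesis by auto
qed

subsection \<open>Stacking\<close>

text \<open>Together with \<open>in_upper_diagram\<close> and \<open>in_lower_diagram\<close> this
  gives three embeddings of vertices into the stack. A colouring \<open>slab\<close> of the three
  rows restricts along them to colourings of the result, the upper and the lower diagram.\<close>

fun outer :: "vertex \<Rightarrow> stack_vertex" where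
  "outer (Bot i) = Lower i"
| "outer (Top j) = Upper j"

fun slab :: "bool list \<Rightarrow> bool list \<Rightarrow> bool list \<Rightarrow> stack_vertex \<Rightarrow> bool" where
  "slab x z y (Lower i) = x ! (i - 1)"
| "slab x z y (Middle i) = z ! (i - 1)"
| "slab x z y (Upper i) = y ! (i - 1)"

lemma slab_embeddings [simp]:
  "slab x z y (outer v) = lab x y v"
  "slab x z y (in_upper_diagram v) = lab z y v"
  "slab x z y (in_lower_diagram v) = lab x z v"
  by (cases v; simp)+

lemma finite_stack_vertices [simp]: "finite (stack_vertices m k l)"
  by (simp add: stack_vertices_def)

lemma in_stack_vertices [simp]:
  "Lower i \<in> stack_vertices m k l \<longleftrightarrow> 1 \<le> i \<and> i \<le> m"
  "Middle i \<in> stack_vertices m k l \<longleftrightarrow> 1 \<le> i \<and> i \<le> k"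
  "Upper i \<in> stack_vertices m k l \<longleftrightarrow> 1 \<le> i \<and> i \<le> l"
  by (auto simp: stack_vertices_def)

lemma partition_on_components_of_rel:
  assumes "sym r" "r \<subseteq> V \<times> V"
  shows "partition_on V (components_of_rel V r)"
proof -
  have "equiv V (r\<^sup>* \<inter> V \<times> V)"
  proof (rule equivI)
    show "sym (r\<^sup>* \<inter> V \<times> V)" using sym_rtrancl[OF assms(1)] by (auto simp: sym_def)
  qed (auto simp: refl_on_def trans_def)
  then show ?thesis unfolding components_of_rel_def by (rule partition_on_quotient)
qed

lemma constant_on_components_iff:
  assumes "sym r" "r \<subseteq> V \<times> V"
  shows "(\<forall>C\<in>components_of_rel V r. \<forall>a\<in>C. \<forall>b\<in>C. f a = f b) \<longleftrightarrow> (\<forall>(a, b)\<in>r. f a = f b)" (is "?L = ?R")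
proof
  assume L: ?L
  show ?R
  proof clarify
    fix a b assume ab: "(a, b) \<in> r"
    then have 1: "(r\<^sup>* \<inter> V \<times> V) `` {a} \<in> components_of_rel V r"
      using assms unfolding components_of_rel_def by (intro quotientI) auto
    have 2: "a \<in> (r\<^sup>* \<inter> V \<times> V) `` {a}" "b \<in> (r\<^sup>* \<inter> V \<times> V) `` {a}" using ab assms by auto
    show "f a = f b" by (rule bspec[OF bspec[OF bspec[OF L 1] 2(1)] 2(2)])
  qed
next
  assume R: ?R
  have *: "f a = f b" if "(a, b) \<in> r\<^sup>*" for a b
    using that by (induction) (use R in auto)
  show ?L
  proof (intro ballI)
    fix C a b assume "C \<in> components_of_rel V r" "a \<in> C" "b \<in> C"
    then obtain c where "(c, a) \<in> r\<^sup>*" "(c, b) \<in> r\<^sup>*"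
      unfolding components_of_rel_def quotient_def by blast
    then show "f a = f b" using * by metis
  qed
qed

context
  fixes m k l :: nat and D D' :: diagram
  assumes D: "D \<in> partitions k l" and D': "D' \<in> partitions m k"
begin

lemma partition_on_D: "partition_on (vertices k l) D" "partition_on (vertices m k) D'"
  using D D' by (simp_all add: partitions_def)

lemma stack_adjacent_sym: "sym (stack_adjacent D D')"
  by (auto simp: stack_adjacent_def sym_def)

lemma stack_adjacent_subset: "stack_adjacent D D' \<subseteq> stack_vertices m k l \<times> stack_vertices m k l"
proof -
  have "in_upper_diagram v \<in> stack_vertices m k l" if "v \<in> vertices k l" for v
    using that by (cases v) auto
  moreover have "in_lower_diagram v \<in> stack_vertices m k l" if "v \<in> vertices m k" for v
    using that by (cases v) auto
  ultimately show ?thesis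
    using partition_onD1[OF partition_on_D(1)] partition_onD1[OF partition_on_D(2)]
    unfolding stack_adjacent_def by blast
qed

lemma partition_on_stack_components:
  "partition_on (stack_vertices m k l) (stack_components m k l D D')"
  unfolding stack_components_def
  by (rule partition_on_components_of_rel[OF stack_adjacent_sym stack_adjacent_subset])

lemma stack_diagram_eq:
  "stack_diagram m k l D D' = (-`) outer ` stack_components m k l D D' - {{}}"
proof -
  have "{Bot i |i. Lower i \<in> C} \<union> {Top j |j. Upper j \<in> C} = outer -` C" for C
  proof (rule Set.set_eqI)
    show "v \<in> {Bot i |i. Lower i \<in> C} \<union> {Top j |j. Upper j \<in> C} \<longleftrightarrow> v \<in> outer -` C" for v
      by (cases v) auto
  qed
  then show ?thesis unfolding stack_diagram_def by simp
qed

lemma stack_diagram_closed [simp]: "stack_diagram m k l D D' \<in> partitions m l"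
proof -
  have "outer -` stack_vertices m k l = vertices m l"
  proof (rule Set.set_eqI)
    show "v \<in> outer -` stack_vertices m k l \<longleftrightarrow> v \<in> vertices m l" for v by (cases v) auto
  qed
  then show ?thesis
    using partition_on_vimage[OF partition_on_stack_components, of outer]
    by (simp add: stack_diagram_eq partitions_def)
qed

lemma sat_stack_iff:
  "sat (stack_diagram m k l D D') x y \<longleftrightarrow>
     (\<forall>C\<in>stack_components m k l D D'. \<forall>u v. outer u \<in> C \<longrightarrow> outer v \<in> C \<longrightarrow> lab x y u = lab x y v)"
proof
  assume L: "sat (stack_diagram m k l D D') x y"
  show "\<forall>C\<in>stack_components m k l D D'. \<forall>u v. outer u \<in> C \<longrightarrow> outer v \<in> C \<longrightarrow> lab x y u = lab x y v"
  proof (intro ballI allI impI)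
    fix C u v assume C: "C \<in> stack_components m k l D D'" "outer u \<in> C" "outer v \<in> C"
    then have "outer -` C \<in> stack_diagram m k l D D'" unfolding stack_diagram_eq by blast
    from L this show "lab x y u = lab x y v" by (rule satD) (use C in auto)
  qed
next
  assume R: "\<forall>C\<in>stack_components m k l D D'. \<forall>u v. outer u \<in> C \<longrightarrow> outer v \<in> C \<longrightarrow> lab x y u = lab x y v"
  show "sat (stack_diagram m k l D D') x y" unfolding sat_def
  proof (intro ballI)
    fix B u v assume B: "B \<in> stack_diagram m k l D D'" "u \<in> B" "v \<in> B"
    then obtain C where "C \<in> stack_components m k l D D'" "B = outer -` C"
      unfolding stack_diagram_eq by blast
    then show "lab x y u = lab x y v" using R B(2,3) by (metis vimageD)
  qed
qed

text \<open>Edges of the stacked graph join exactly the vertices in a common block of one layer. So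
  being constant on all blocks of both layers means being constant along edges, and hence on
  connected components.\<close>

lemma sat_both_iff:
  "sat D z y \<and> sat D' x z \<longleftrightarrow>
     (\<forall>C\<in>stack_components m k l D D'. \<forall>a\<in>C. \<forall>b\<in>C. slab x z y a = slab x z y b)"
  unfolding stack_components_def
    constant_on_components_iff[OF stack_adjacent_sym stack_adjacent_subset]
  unfolding stack_adjacent_def sat_def by (auto simp: ball_Un)

text \<open>The sum counts the middle rows \<open>z\<close> compatible with both layers. A component
  that meets an outer row forces the colours of its middle vertices; a component inside the middle
  row can be coloured in two ways. If \<open>x\<close> and \<open>y\<close> disagree on a component,
  there is no such \<open>z\<close>.\<close>

lemma sum_dmat_dmat:
  assumes x: "x \<in> bools m" and y: "y \<in> bools l"
  shows "(\<Sum>z\<in>bools k. dmat D z y * dmat D' x z) =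
    2 ^ stack_loops m k l D D' * dmat (stack_diagram m k l D D') x y"
proof -
  define CC where "CC = stack_components m k l D D'"
  define L where "L = {C\<in>CC. C \<subseteq> range Middle}"
  define Z where "Z = {z\<in>bools k. sat D z y \<and> sat D' x z}"
  have P: "partition_on (stack_vertices m k l) CC"
    unfolding CC_def by (rule partition_on_stack_components)
  have CC_unique: "C = C'" if "C \<in> CC" "C' \<in> CC" "a \<in> C" "a \<in> C'" for C C' a
    using partition_onD2[OF P] that by (auto simp: disjoint_def)
  have CC_sub: "C \<subseteq> stack_vertices m k l" if "C \<in> CC" for C
    using partition_onD1[OF P] that by blast
  have finL: "finite L" unfolding L_def using finite_elements[OF _ P] by simp
  have "(\<Sum>z\<in>bools k. dmat D z y * dmat D' x z) = (\<Sum>z\<in>bools k. of_bool (z \<in> Z))"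
    by (rule sum.cong) (auto simp: dmat_def Z_def)
  also have "\<dots> = card Z"
    by (simp add: Z_def Int_def)
  also have "card Z = 2 ^ card L * dmat (stack_diagram m k l D D') x y"
  proof (cases "sat (stack_diagram m k l D D') x y")
    case False
    have "Z = {}"
    proof (rule ccontr)
      assume "Z \<noteq> {}"
      then obtain z where z: "sat D z y \<and> sat D' x z" by (auto simp: Z_def)
      have "sat (stack_diagram m k l D D') x y"
        unfolding sat_stack_iff using z[unfolded sat_both_iff] by (metis slab_embeddings(1))
      with False show False by simp
    qed
    with False show ?thesis by (simp add: dmat_def)
  next
    case True
    \<comment> \<open>\<open>S\<close> is the set of closed components coloured \<open>True\<close>;
      any other component takes the colour of its outer vertices, which agree because
      \<open>x\<close> and \<open>y\<close> are admissible for the stacked diagram.\<close>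
    define val where "val S C = (if C \<in> L then C \<in> S else (\<exists>v. outer v \<in> C \<and> lab x y v))" for S C
    define comp where "comp a = (THE C. C \<in> CC \<and> a \<in> C)" for a
    have comp: "comp a = C" if "C \<in> CC" "a \<in> C" for C a
      unfolding comp_def using that CC_unique by (intro the_equality) auto
    define F where "F S = map (\<lambda>i. val S (comp (Middle (Suc i)))) [0..<k]" for S
    have slabF: "slab x (F S) y a = val S C" if C: "C \<in> CC" "a \<in> C" for S C a
    proof (cases "\<exists>v. a = outer v")
      case True
      then obtain v where v: "a = outer v" by blast
      have "C \<notin> L" using C v by (cases v) (auto simp: L_def)
      then have "val S C \<longleftrightarrow> lab x y v"
        using \<open>sat _ _ _\<close>[unfolded sat_stack_iff] C v unfolding val_def CC_def by metis
      then show ?thesis using v by simp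
    next
      case False
      then obtain i where i: "a = Middle i" by (metis outer.simps stack_vertex.exhaust)
      then have "1 \<le> i" "i \<le> k" using CC_sub[OF C(1)] C(2) by auto
      then show ?thesis using comp[OF C] i by (cases i) (simp_all add: F_def)
    qed
    \<comment> \<open>The free choices are the subsets of \<open>L\<close>; a compatible
      \<open>z\<close> is recovered from the closed components on which it is
      \<open>True\<close>.\<close>
    have "bij_betw F (Pow L) Z"
    proof (rule bij_betw_byWitness[where f' = "\<lambda>z. {C\<in>L. \<forall>a\<in>C. slab x z y a}"])
      have ne: "C \<noteq> {}" if "C \<in> CC" for C using partition_onD3[OF P] that by auto
      show "\<forall>S\<in>Pow L. {C \<in> L. \<forall>a\<in>C. slab x (F S) y a} = S"
      proof
        fix S assume S: "S \<in> Pow L"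
        have "(\<forall>a\<in>C. slab x (F S) y a) \<longleftrightarrow> C \<in> S" if "C \<in> L" for C
        proof -
          have "C \<in> CC" using that by (simp add: L_def)
          then show ?thesis using slabF[of C _ S] ne[of C] that by (auto simp: val_def)
        qed
        then show "{C \<in> L. \<forall>a\<in>C. slab x (F S) y a} = S" using S by blast
      qed
      show "F ` Pow L \<subseteq> Z"
        unfolding Z_def sat_both_iff using slabF by (auto simp: CC_def F_def bools_def)
      show "(\<lambda>z. {C \<in> L. \<forall>a\<in>C. slab x z y a}) ` Z \<subseteq> Pow L" by auto
      show "\<forall>z\<in>Z. F {C \<in> L. \<forall>a\<in>C. slab x z y a} = z"
      proof
        fix z assume z: "z \<in> Z"
        then have len: "length z = k" and c: "\<forall>C\<in>CC. \<forall>a\<in>C. \<forall>b\<in>C. slab x z y a = slab x z y b"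
          unfolding Z_def sat_both_iff CC_def bools_def by (blast, fast)
        have const: "slab x z y a = slab x z y b" if "C \<in> CC" "a \<in> C" "b \<in> C" for C a b
          by (rule bspec[OF bspec[OF bspec[OF c that(1)] that(2)] that(3)])
        show "F {C \<in> L. \<forall>a\<in>C. slab x z y a} = z"
        proof (rule nth_equalityI)
          fix i assume "i < length (F {C \<in> L. \<forall>a\<in>C. slab x z y a})"
          then have i: "i < k" by (simp add: F_def)
          then have "Middle (Suc i) \<in> \<Union>CC" using partition_onD1[OF P] by auto
          then obtain C where C: "C \<in> CC" "Middle (Suc i) \<in> C" by blast
          have "val {C \<in> L. \<forall>a\<in>C. slab x z y a} C = slab x z y (Middle (Suc i))"
          proof (cases "C \<in> L")
            case True
            then have "val {C \<in> L. \<forall>a\<in>C. slab x z y a} C = (\<forall>a\<in>C. slab x z y a)" by (simp add: val_def)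
            also have "\<dots> = slab x z y (Middle (Suc i))" using const[OF C(1) _ C(2)] C(2) by metis
            finally show ?thesis .
          next
            case False
            then obtain a where a: "a \<in> C" "a \<notin> range Middle" using C by (auto simp: L_def)
            then obtain v where v: "a = outer v" by (metis outer.simps rangeI stack_vertex.exhaust)
            have "\<forall>w. outer w \<in> C \<longrightarrow> lab x y w = z ! i"
              using const[OF C(1) _ C(2)] by (metis diff_Suc_1 slab.simps(2) slab_embeddings(1))
            then show ?thesis using False a v by (auto simp: val_def)
          qed
          then show "F {C \<in> L. \<forall>a\<in>C. slab x z y a} ! i = z ! i"
            using i comp[OF C] by (simp add: F_def)
        qed (simp add: F_def len)
      qed
    qed
    then have "card Z = card (Pow L)" using bij_betw_same_card by metis
    with True finL show ?thesis by (simp add: card_Pow dmat_def)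
  qed
  also have "card L = stack_loops m k l D D'" by (simp add: L_def CC_def stack_loops_def)
  finally show ?thesis .
qed

end

text \<open>The all-\<open>True\<close> colouring supplies a nonzero entry in every matrix, from
  which a power of 2 in front can be read off.\<close>

lemma sat_const: "D \<in> partitions k l \<Longrightarrow> sat D (replicate k True) (replicate l True)"
proof -
  assume "D \<in> partitions k l"
  then have "\<Union>D = vertices k l" by (simp add: partitions_def partition_on_def)
  moreover have "lab (replicate k True) (replicate l True) v" if "v \<in> vertices k l" for v
    using that by (cases v) auto
  ultimately show ?thesis unfolding sat_def by blast
qed

text \<open>At the all-\<open>True\<close> entry both matrices are 1, so the powers agree;
  cancelling them leaves equal matrices, which determine the partitions.\<close>

lemma dmat_inject:
  assumes D: "D \<in> partitions k l" and E: "E \<in> partitions k l"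
    and eq: "\<And>x y. x \<in> bools k \<Longrightarrow> y \<in> bools l \<Longrightarrow> 2 ^ p * dmat D x y = 2 ^ q * dmat E x y"
  shows "D = E \<and> p = q"
proof -
  have r: "replicate k True \<in> bools k" for k by (simp add: bools_def)
  have "(2::nat) ^ p = 2 ^ q"
    using eq[OF r r] sat_const[OF D] sat_const[OF E] by (simp add: dmat_def)
  then have pq: "p = q" by simp
  have "D = E"
  proof (rule sat_inject[OF D E])
    show "sat D x y = sat E x y" if "x \<in> bools k" "y \<in> bools l" for x y
      using eq[OF that] pq by (simp add: dmat_def split: split_of_bool_asm)
  qed
  with pq show ?thesis by simp
qed

text \<open>Replaces reasoning about connected components by a matrix computation: a product that is
  a power of 2 times the matrix of a diagram identifies both the stacked diagram and the
  loops.\<close>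

lemma stack_eqI:
  assumes "D \<in> partitions k l" "D' \<in> partitions m k" "E \<in> partitions m l"
    and "\<And>x y. x \<in> bools m \<Longrightarrow> y \<in> bools l \<Longrightarrow>
      (\<Sum>z\<in>bools k. dmat D z y * dmat D' x z) = 2 ^ n * dmat E x y"
  shows "stack_diagram m k l D D' = E" "stack_loops m k l D D' = n"
  using dmat_inject[OF stack_diagram_closed[OF assms(1,2)] assms(3), of "stack_loops m k l D D'" n]
    sum_dmat_dmat[OF assms(1,2)] assms(4) by auto

text \<open>Both bracketings are the same triple product of matrices up to powers of 2; the equation
  for the loops is the one between these powers.\<close>

lemma stack_assoc:
  assumes D: "D1 \<in> partitions c d" "D2 \<in> partitions b c" "D3 \<in> partitions a b"
  shows "stack_diagram a b d (stack_diagram b c d D1 D2) D3 = stack_diagram a c d D1 (stack_diagram a b c D2 D3)" (is ?th1)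
    and "stack_loops b c d D1 D2 + stack_loops a b d (stack_diagram b c d D1 D2) D3 =
      stack_loops a b c D2 D3 + stack_loops a c d D1 (stack_diagram a b c D2 D3)" (is ?th2)
proof -
  define E where "E = stack_diagram b c d D1 D2"
  define F where "F = stack_diagram a b c D2 D3"
  have E: "E \<in> partitions b d" and F: "F \<in> partitions a c"
    unfolding E_def F_def using D by auto
  have "2 ^ (stack_loops b c d D1 D2 + stack_loops a b d E D3) * dmat (stack_diagram a b d E D3) x y =
    2 ^ (stack_loops a b c D2 D3 + stack_loops a c d D1 F) * dmat (stack_diagram a c d D1 F) x y"
    if xy: "x \<in> bools a" "y \<in> bools d" for x y
  proof -
    have "2 ^ (stack_loops b c d D1 D2 + stack_loops a b d E D3) * dmat (stack_diagram a b d E D3) x y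
      = (\<Sum>z\<in>bools b. 2 ^ stack_loops b c d D1 D2 * dmat E z y * dmat D3 x z)"
      by (simp add: power_add sum_distrib_left[symmetric] mult.assoc sum_dmat_dmat[OF E D(3) xy])
    also have "\<dots> = (\<Sum>z\<in>bools b. \<Sum>w\<in>bools c. dmat D1 w y * dmat D2 z w * dmat D3 x z)"
    proof (intro sum.cong HOL.refl)
      fix z assume z: "z \<in> bools b"
      show "2 ^ stack_loops b c d D1 D2 * dmat E z y * dmat D3 x z =
          (\<Sum>w\<in>bools c. dmat D1 w y * dmat D2 z w * dmat D3 x z)"
        unfolding sum_distrib_right[symmetric] sum_dmat_dmat[OF D(1,2) z xy(2)] E_def ..
    qed
    also have "\<dots> = (\<Sum>w\<in>bools c. dmat D1 w y * (\<Sum>z\<in>bools b. dmat D2 z w * dmat D3 x z))"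
      by (subst sum.swap) (simp add: sum_distrib_left mult.assoc)
    also have "\<dots> = (\<Sum>w\<in>bools c. 2 ^ stack_loops a b c D2 D3 * (dmat D1 w y * dmat F x w))"
    proof (intro sum.cong HOL.refl)
      fix w assume w: "w \<in> bools c"
      show "dmat D1 w y * (\<Sum>z\<in>bools b. dmat D2 z w * dmat D3 x z) =
          2 ^ stack_loops a b c D2 D3 * (dmat D1 w y * dmat F x w)"
        unfolding sum_dmat_dmat[OF D(2,3) xy(1) w] F_def by (simp only: mult_ac)
    qed
    also have "\<dots> = 2 ^ (stack_loops a b c D2 D3 + stack_loops a c d D1 F) * dmat (stack_diagram a c d D1 F) x y"
      using sum_dmat_dmat[OF D(1) F xy] by (simp add: power_add sum_distrib_left[symmetric] mult.assoc)
    finally show ?thesis .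
  qed
  from dmat_inject[OF stack_diagram_closed[OF E D(3)] stack_diagram_closed[OF D(1) F] this]
  have "stack_diagram a b d E D3 = stack_diagram a c d D1 F \<and>
    stack_loops b c d D1 D2 + stack_loops a b d E D3 = stack_loops a b c D2 D3 + stack_loops a c d D1 F" .
  then show ?th1 ?th2 by (auto simp: E_def F_def)
qed

subsection \<open>Reflection, identities and juxtaposition\<close>

fun flip_vertex :: "vertex \<Rightarrow> vertex" where
  "flip_vertex (Bot i) = Top i"
| "flip_vertex (Top i) = Bot i"

text \<open>On matrices, reflection is transposition; this is why it reverses stacking and preserves
  the number of loops.\<close>

definition flip_diagram :: "diagram \<Rightarrow> diagram" where
  "flip_diagram D = (`) flip_vertex ` D"

lemma flip_vertex_flip_vertex [simp]: "flip_vertex (flip_vertex v) = v"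
  by (cases v) auto

lemma flip_diagram_flip_diagram [simp]: "flip_diagram (flip_diagram D) = D"
  by (simp add: flip_diagram_def image_image)

lemma inj_flip_vertex: "inj_on flip_vertex A"
  by (metis flip_vertex_flip_vertex inj_onI)

lemma flip_vertices: "flip_vertex ` vertices k l = vertices l k"
  by (auto simp: vertices_def image_Un image_image)

lemma partition_on_image_inj:
  assumes "partition_on A P" "inj_on f A"
  shows "partition_on (f ` A) ((`) f ` P)"
proof -
  have "(`) f ` P - {{}} = (`) f ` P" using partition_onD3[OF assms(1)] by auto
  then show ?thesis using partition_on_inj_image[OF assms] by simp
qed

lemma flip_diagram_closed: "D \<in> partitions k l \<Longrightarrow> flip_diagram D \<in> partitions l k"
  unfolding partitions_def flip_diagram_def
  using partition_on_image_inj[OF _ inj_flip_vertex[of "vertices k l"], of D] by (simp add: flip_vertices)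

lemma lab_flip_vertex [simp]: "lab x y (flip_vertex v) = lab y x v"
  by (cases v) auto

lemma sat_flip_diagram [simp]: "sat (flip_diagram D) x y \<longleftrightarrow> sat D y x"
  unfolding sat_def flip_diagram_def ball_simps by (simp only: lab_flip_vertex)

lemma flip_diagram_stack:
  assumes "D \<in> partitions k l" "D' \<in> partitions m k"
  shows "stack_diagram l k m (flip_diagram D') (flip_diagram D) = flip_diagram (stack_diagram m k l D D')" (is ?th1)
    and "stack_loops l k m (flip_diagram D') (flip_diagram D) = stack_loops m k l D D'" (is ?th2)
proof -
  have "(\<Sum>z\<in>bools k. dmat (flip_diagram D') z y * dmat (flip_diagram D) x z) =
    2 ^ stack_loops m k l D D' * dmat (flip_diagram (stack_diagram m k l D D')) x y"
    if "x \<in> bools l" "y \<in> bools m" for x y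
    using sum_dmat_dmat[OF assms that(2,1)] by (simp add: dmat_def mult.commute)
  note stack_eqI[OF flip_diagram_closed[OF assms(2)] flip_diagram_closed[OF assms(1)] _ this]
  from this[OF flip_diagram_closed[OF stack_diagram_closed[OF assms]]]
  show ?th1 ?th2 by auto
qed

lemma id_diagram_image: "id_diagram n = (\<lambda>i. {Bot i, Top i}) ` {1..n}"
  by (auto simp: id_diagram_def)

lemma id_diagram_closed [simp]: "id_diagram n \<in> partitions n n"
  by (auto simp: id_diagram_image partitions_def partition_on_def disjoint_def vertices_def)

lemma sat_id_diagram:
  assumes "x \<in> bools n" "y \<in> bools n" shows "sat (id_diagram n) x y \<longleftrightarrow> x = y"
proof -
  have "sat (id_diagram n) x y \<longleftrightarrow> (\<forall>i\<in>{1..n}. x ! (i - 1) = y ! (i - 1))"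
    unfolding sat_def id_diagram_image by (auto simp: all_conj_distrib ball_conj_distrib)
  also have "\<dots> \<longleftrightarrow> (\<forall>i<n. x ! i = y ! i)"
    unfolding image_Suc_lessThan[symmetric] by simp (simp add: Ball_def)
  also have "\<dots> \<longleftrightarrow> x = y"
    using assms by (auto simp: bools_def list_eq_iff_nth_eq)
  finally show ?thesis .
qed

lemma dmat_id_diagram:
  "x \<in> bools n \<Longrightarrow> y \<in> bools n \<Longrightarrow> dmat (id_diagram n) x y = of_bool (x = y)"
  by (simp add: dmat_def sat_id_diagram)

lemma stack_id_left:
  assumes "D \<in> partitions k l"
  shows "stack_diagram k l l (id_diagram l) D = D" "stack_loops k l l (id_diagram l) D = 0"
proof -
  have "(\<Sum>z\<in>bools l. dmat (id_diagram l) z y * dmat D x z) = 2 ^ 0 * dmat D x y"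
    if "x \<in> bools k" "y \<in> bools l" for x y
    using sum_bools_delta[OF that(2), of "dmat D x"] that(2) by (simp add: dmat_id_diagram)
  from stack_eqI[OF _ assms assms this]
  show "stack_diagram k l l (id_diagram l) D = D" "stack_loops k l l (id_diagram l) D = 0" by auto
qed

lemma stack_id_right:
  assumes "D \<in> partitions k l"
  shows "stack_diagram k k l D (id_diagram k) = D" "stack_loops k k l D (id_diagram k) = 0"
proof -
  have "(\<Sum>z\<in>bools k. dmat D z y * dmat (id_diagram k) x z) = 2 ^ 0 * dmat D x y"
    if "x \<in> bools k" "y \<in> bools l" for x y
    using sum_bools_delta[OF that(1), of "\<lambda>z. dmat D z y"] that(1)
    by (simp add: dmat_id_diagram mult.commute eq_commute)
  from stack_eqI[OF assms _ assms this]
  show "stack_diagram k k l D (id_diagram k) = D" "stack_loops k k l D (id_diagram k) = 0" by auto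
qed

lemma shift_vertices: "shift_vertex k l ` vertices k' l' = Bot ` {Suc k..k + k'} \<union> Top ` {Suc l..l + l'}"
proof -
  have "(\<lambda>i. k + i) ` {1..k'} = {Suc k..k + k'}" for k k' :: nat
    using image_add_atLeastAtMost[of k 1 k'] by simp
  then have "(\<lambda>i. Bot (k + i)) ` {1..k'} = Bot ` {Suc k..k + k'}"
    "(\<lambda>i. Top (l + i)) ` {1..l'} = Top ` {Suc l..l + l'}"
    using image_image[of Bot "\<lambda>i. k + i"] image_image[of Top "\<lambda>i. l + i"] by metis+
  then show ?thesis by (simp add: vertices_def image_Un image_image)
qed

lemma inj_shift_vertex: "inj_on (shift_vertex k l) A"
proof (rule inj_onI)
  show "u = v" if "shift_vertex k l u = shift_vertex k l v" for u v
    using that by (cases u; cases v) auto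
qed

lemma juxtapose_closed [simp]:
  assumes "D \<in> partitions k l" "D' \<in> partitions k' l'"
  shows "juxtapose k l D D' \<in> partitions (k + k') (l + l')"
proof -
  have D: "partition_on (vertices k l) D"
    and D': "partition_on (shift_vertex k l ` vertices k' l') ((`) (shift_vertex k l) ` D')"
    using assms by (auto simp: partitions_def intro!: partition_on_image_inj inj_shift_vertex)
  have "vertices k l \<inter> shift_vertex k l ` vertices k' l' = {}"
    unfolding shift_vertices by (auto simp: vertices_def)
  moreover have "vertices k l \<union> shift_vertex k l ` vertices k' l' = vertices (k + k') (l + l')"
    unfolding shift_vertices by (auto simp: vertices_def image_iff)
  ultimately show ?thesis
    using D D' disjoint_union[of D "(`) (shift_vertex k l) ` D'"]
    unfolding partitions_def juxtapose_def partition_on_def by auto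
qed

lemma bools_append [simp]: "x \<in> bools m \<Longrightarrow> y \<in> bools n \<Longrightarrow> x @ y \<in> bools (m + n)"
  by (simp add: bools_def)

lemma bools_addE:
  assumes "x \<in> bools (m + n)"
  obtains y z where "x = y @ z" "y \<in> bools m" "z \<in> bools n"
proof
  show "x = take m x @ drop m x" by simp
qed (use assms in \<open>auto simp: bools_def\<close>)

text \<open>The matrix of a juxtaposition is the Kronecker product of the two matrices.\<close>

lemma sat_juxtapose:
  assumes "D \<in> partitions k l" "D' \<in> partitions k' l'" "x \<in> bools k" "y \<in> bools l"
  shows "sat (juxtapose k l D D') (x @ x') (y @ y') \<longleftrightarrow> sat D x y \<and> sat D' x' y'"
proof -
  have "lab (x @ x') (y @ y') v = lab x y v" if "v \<in> vertices k l" for v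
    using that assms(3,4) by (cases v) (auto simp: nth_append bools_def)
  then have "lab (x @ x') (y @ y') v = lab x y v" if "v \<in> B" "B \<in> D" for v B
    using that assms(1) unfolding partitions_def partition_on_def by blast
  moreover have "lab (x @ x') (y @ y') (shift_vertex k l v) = lab x' y' v" if "v \<in> vertices k' l'" for v
    using that assms(3,4) by (cases v) (auto simp: nth_append bools_def)
  then have "lab (x @ x') (y @ y') (shift_vertex k l v) = lab x' y' v" if "v \<in> B" "B \<in> D'" for v B
    using that assms(2) unfolding partitions_def partition_on_def by blast
  ultimately show ?thesis
    unfolding sat_def juxtapose_def by (simp add: ball_Un)
qed

lemma juxtapose_assoc:
  assumes "D1 \<in> partitions k1 l1" "D2 \<in> partitions k2 l2" "D3 \<in> partitions k3 l3"
  shows "juxtapose (k1 + k2) (l1 + l2) (juxtapose k1 l1 D1 D2) D3 =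
    juxtapose k1 l1 D1 (juxtapose k2 l2 D2 D3)" (is "?L = ?R")
proof (rule sat_inject[of _ "k1 + (k2 + k3)" "l1 + (l2 + l3)"])
  show "?L \<in> partitions (k1 + (k2 + k3)) (l1 + (l2 + l3))"
    using juxtapose_closed[OF juxtapose_closed[OF assms(1,2)] assms(3)] by (simp add: add.assoc)
  show "?R \<in> partitions (k1 + (k2 + k3)) (l1 + (l2 + l3))" using assms by simp
  fix x y assume "x \<in> bools (k1 + (k2 + k3))" "y \<in> bools (l1 + (l2 + l3))"
  then obtain x1 x2 x3 y1 y2 y3 where x: "x = x1 @ x2 @ x3" "x1 \<in> bools k1" "x2 \<in> bools k2"
    and y: "y = y1 @ y2 @ y3" "y1 \<in> bools l1" "y2 \<in> bools l2"
    by (elim bools_addE) blast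
  have "sat ?L ((x1 @ x2) @ x3) ((y1 @ y2) @ y3) \<longleftrightarrow> sat D1 x1 y1 \<and> sat D2 x2 y2 \<and> sat D3 x3 y3"
    using sat_juxtapose[OF juxtapose_closed[OF assms(1,2)] assms(3) bools_append bools_append]
      sat_juxtapose[OF assms(1,2)] x y by simp
  moreover have "sat ?R (x1 @ x2 @ x3) (y1 @ y2 @ y3) \<longleftrightarrow> sat D1 x1 y1 \<and> sat D2 x2 y2 \<and> sat D3 x3 y3"
    using sat_juxtapose[OF assms(1) juxtapose_closed[OF assms(2,3)]]
      sat_juxtapose[OF assms(2,3)] x y by simp
  ultimately show "sat ?L x y = sat ?R x y" by (simp add: x y)
qed

lemma juxtapose_unit_right: "juxtapose k l D (id_diagram 0) = D"
  by (simp add: juxtapose_def id_diagram_def)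

lemma juxtapose_unit_left: "juxtapose 0 0 (id_diagram 0) D = D"
proof -
  have "shift_vertex 0 0 = id" by (rule ext, case_tac x) auto
  then show ?thesis by (simp add: juxtapose_def id_diagram_def)
qed

lemma juxtapose_id: "juxtapose k k (id_diagram k) (id_diagram l) = id_diagram (k + l)"
proof (rule sat_inject[of _ "k + l" "k + l"])
  fix x y assume "x \<in> bools (k + l)" "y \<in> bools (k + l)"
  then obtain x1 x2 y1 y2 where x: "x = x1 @ x2" "x1 \<in> bools k" "x2 \<in> bools l"
    and y: "y = y1 @ y2" "y1 \<in> bools k" "y2 \<in> bools l"
    by (elim bools_addE) blast
  then show "sat (juxtapose k k (id_diagram k) (id_diagram l)) x y = sat (id_diagram (k + l)) x y"
    using sat_juxtapose[OF id_diagram_closed id_diagram_closed x(2) y(2), of l x2 y2] bools_append[OF x(2,3)]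
      bools_append[OF y(2,3)] by (simp add: sat_id_diagram) (simp add: bools_def)
qed auto

text \<open>The mixed-product rule for Kronecker products: the sum over the middle row splits into a
  product of two sums.\<close>

lemma stack_juxtapose:
  assumes D: "D1 \<in> partitions k l" "D1' \<in> partitions m k" "D2 \<in> partitions k' l'" "D2' \<in> partitions m' k'"
  shows "stack_diagram (m + m') (k + k') (l + l') (juxtapose k l D1 D2) (juxtapose m k D1' D2') =
      juxtapose m l (stack_diagram m k l D1 D1') (stack_diagram m' k' l' D2 D2')" (is ?th1)
    and "stack_loops (m + m') (k + k') (l + l') (juxtapose k l D1 D2) (juxtapose m k D1' D2') =
      stack_loops m k l D1 D1' + stack_loops m' k' l' D2 D2'" (is ?th2)
proof -
  have "(\<Sum>z\<in>bools (k + k'). dmat (juxtapose k l D1 D2) z y * dmat (juxtapose m k D1' D2') x z) =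
    2 ^ (stack_loops m k l D1 D1' + stack_loops m' k' l' D2 D2') *
      dmat (juxtapose m l (stack_diagram m k l D1 D1') (stack_diagram m' k' l' D2 D2')) x y"
    if xy: "x \<in> bools (m + m')" "y \<in> bools (l + l')" for x y
  proof -
    obtain x1 x2 y1 y2 where x: "x = x1 @ x2" "x1 \<in> bools m" "x2 \<in> bools m'"
      and y: "y = y1 @ y2" "y1 \<in> bools l" "y2 \<in> bools l'"
      using xy by (elim bools_addE) blast
    have dmat_juxtapose: "dmat (juxtapose k l D D') (x @ x') (y @ y') = dmat D x y * dmat D' x' y'"
      if "D \<in> partitions k l" "D' \<in> partitions k' l'" "x \<in> bools k" "y \<in> bools l" for D D' k l k' l' x y x' y'
      using sat_juxtapose[OF that] by (simp add: dmat_def)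
    have "(\<Sum>z\<in>bools (k + k'). dmat (juxtapose k l D1 D2) z y * dmat (juxtapose m k D1' D2') x z) =
      (\<Sum>z1\<in>bools k. \<Sum>z2\<in>bools k'. (dmat D1 z1 y1 * dmat D1' x1 z1) * (dmat D2 z2 y2 * dmat D2' x2 z2))"
      unfolding sum_bools_add x y
      by (intro sum.cong HOL.refl)
        (simp add: dmat_juxtapose[OF D(1,3) _ y(2)] dmat_juxtapose[OF D(2,4) x(2)])
    also have "\<dots> = (2 ^ stack_loops m k l D1 D1' * dmat (stack_diagram m k l D1 D1') x1 y1) *
       (2 ^ stack_loops m' k' l' D2 D2' * dmat (stack_diagram m' k' l' D2 D2') x2 y2)"
      by (simp add: sum_product[symmetric] sum_dmat_dmat[OF D(1,2) x(2) y(2)] sum_dmat_dmat[OF D(3,4) x(3) y(3)])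
    also have "\<dots> = 2 ^ (stack_loops m k l D1 D1' + stack_loops m' k' l' D2 D2') *
      dmat (juxtapose m l (stack_diagram m k l D1 D1') (stack_diagram m' k' l' D2 D2')) x y"
      unfolding x y
      using dmat_juxtapose[OF stack_diagram_closed[OF D(1,2)] stack_diagram_closed[OF D(3,4)] x(2) y(2)]
      by (simp add: power_add)
    finally show ?thesis .
  qed
  from stack_eqI[OF juxtapose_closed[OF D(1,3)] juxtapose_closed[OF D(2,4)]
      juxtapose_closed[OF stack_diagram_closed[OF D(1,2)] stack_diagram_closed[OF D(3,4)]] this]
  show ?th1 ?th2 by auto
qed

subsection \<open>The generators\<close>

abbreviation "cap_diagram \<equiv> {{Bot 1, Bot 2}}"
abbreviation "cup_diagram \<equiv> {{Top 1, Top 2}}"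
abbreviation "unit_diagram \<equiv> {{Top 1}}"
abbreviation "counit_diagram \<equiv> {{Bot 1}}"

lemma vertices_small:
  "vertices 0 (Suc 0) = {Top 1}" "vertices (Suc 0) 0 = {Bot 1}"
  "vertices 0 2 = {Top 1, Top 2}" "vertices 2 0 = {Bot 1, Bot 2}"
proof -
  have "{1..2::nat} = {1, 2}" by auto
  then show "vertices 0 2 = {Top 1, Top 2}" "vertices 2 0 = {Bot 1, Bot 2}"
    by (simp_all add: vertices_def)
qed (simp_all add: vertices_def)

lemma generator_closed [simp]:
  "cap_diagram \<in> partitions 2 0" "cup_diagram \<in> partitions 0 2"
  "unit_diagram \<in> partitions 0 (Suc 0)" "counit_diagram \<in> partitions (Suc 0) 0"
  by (simp_all add: partitions_def partition_on_def vertices_small disjoint_def)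

lemma bools_1E:
  assumes "x \<in> bools (Suc 0)" obtains p where "x = [p]"
  using assms by (auto simp: bools_def length_Suc_conv)

lemma sat_generator:
  "sat unit_diagram [] y" "sat counit_diagram x []"
  "sat cap_diagram [p, q] [] \<longleftrightarrow> p = q" "sat cup_diagram [] [p, q] \<longleftrightarrow> p = q"
  by (auto simp: sat_def)

lemma sum_bools_small:
  "(\<Sum>z\<in>bools (Suc 0). f z) = f [False] + f [True]"
  "(\<Sum>z\<in>bools 2. f z) = f [False, False] + f [False, True] + f [True, False] + f [True, True]"
  "(\<Sum>z\<in>bools 3. f z) = f [False, False, False] + f [False, False, True] +
    f [False, True, False] + f [False, True, True] + f [True, False, False] + f [True, False, True] +
    f [True, True, False] + f [True, True, True]"
  by (simp_all add: sum_bools_Suc numeral_2_eq_2 numeral_3_eq_3 UNIV_bool add_ac)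

lemma sat_id_diagram_small:
  "sat (id_diagram 0) [] []" "sat (id_diagram (Suc 0)) [p] [q] \<longleftrightarrow> p = q"
  using sat_id_diagram[of "[]" 0 "[]"] sat_id_diagram[of "[p]" "Suc 0" "[q]"] by (simp_all add: bools_def)

lemma sat_juxtapose_generator:
  "sat (juxtapose (Suc 0) (Suc 0) (id_diagram (Suc 0)) unit_diagram) [p] [q, r] \<longleftrightarrow> p = q"
  "sat (juxtapose 0 (Suc 0) unit_diagram (id_diagram (Suc 0))) [p] [q, r] \<longleftrightarrow> p = r"
  "sat (juxtapose (Suc 0) (Suc 0) (id_diagram (Suc 0)) counit_diagram) [q, r] [p] \<longleftrightarrow> q = p"
  "sat (juxtapose (Suc 0) 0 counit_diagram (id_diagram (Suc 0))) [q, r] [p] \<longleftrightarrow> r = p"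
  "sat (juxtapose 2 0 cap_diagram (id_diagram (Suc 0))) [p, q, r] [s] \<longleftrightarrow> p = q \<and> r = s"
  "sat (juxtapose (Suc 0) (Suc 0) (id_diagram (Suc 0)) cup_diagram) [s] [p, q, r] \<longleftrightarrow> s = p \<and> q = r"
  "sat (juxtapose (Suc 0) (Suc 0) (id_diagram (Suc 0)) cap_diagram) [p, q, r] [s] \<longleftrightarrow> p = s \<and> q = r"
  "sat (juxtapose 0 2 cup_diagram (id_diagram (Suc 0))) [s] [p, q, r] \<longleftrightarrow> p = q \<and> s = r"
  using sat_juxtapose[of "id_diagram (Suc 0)" "Suc 0" "Suc 0" unit_diagram 0 "Suc 0" "[p]" "[q]" "[]" "[r]"]
    sat_juxtapose[of unit_diagram 0 "Suc 0" "id_diagram (Suc 0)" "Suc 0" "Suc 0" "[]" "[q]" "[p]" "[r]"]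
    sat_juxtapose[of "id_diagram (Suc 0)" "Suc 0" "Suc 0" counit_diagram "Suc 0" 0 "[q]" "[p]" "[r]" "[]"]
    sat_juxtapose[of counit_diagram "Suc 0" 0 "id_diagram (Suc 0)" "Suc 0" "Suc 0" "[q]" "[]" "[r]" "[p]"]
    sat_juxtapose[of cap_diagram 2 0 "id_diagram (Suc 0)" "Suc 0" "Suc 0" "[p, q]" "[]" "[r]" "[s]"]
    sat_juxtapose[of "id_diagram (Suc 0)" "Suc 0" "Suc 0" cup_diagram 0 2 "[s]" "[p]" "[]" "[q, r]"]
    sat_juxtapose[of "id_diagram (Suc 0)" "Suc 0" "Suc 0" cap_diagram 2 0 "[p]" "[s]" "[q, r]" "[]"]
    sat_juxtapose[of cup_diagram 0 2 "id_diagram (Suc 0)" "Suc 0" "Suc 0" "[]" "[p, q]" "[s]" "[r]"]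
  by (simp_all add: bools_def sat_generator [simplified] generator_closed [simplified] sat_id_diagram_small)

lemma juxtapose_generator_closed:
  "juxtapose (Suc 0) (Suc 0) (id_diagram (Suc 0)) unit_diagram \<in> partitions (Suc 0) 2"
  "juxtapose 0 (Suc 0) unit_diagram (id_diagram (Suc 0)) \<in> partitions (Suc 0) 2"
  "juxtapose (Suc 0) (Suc 0) (id_diagram (Suc 0)) counit_diagram \<in> partitions 2 (Suc 0)"
  "juxtapose (Suc 0) 0 counit_diagram (id_diagram (Suc 0)) \<in> partitions 2 (Suc 0)"
  "juxtapose 2 0 cap_diagram (id_diagram (Suc 0)) \<in> partitions 3 (Suc 0)"
  "juxtapose (Suc 0) (Suc 0) (id_diagram (Suc 0)) cup_diagram \<in> partitions (Suc 0) 3"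
  "juxtapose (Suc 0) (Suc 0) (id_diagram (Suc 0)) cap_diagram \<in> partitions 3 (Suc 0)"
  "juxtapose 0 2 cup_diagram (id_diagram (Suc 0)) \<in> partitions (Suc 0) 3"
  using juxtapose_closed[OF id_diagram_closed generator_closed(3), of "Suc 0"]
    juxtapose_closed[OF generator_closed(3) id_diagram_closed, of "Suc 0"]
    juxtapose_closed[OF id_diagram_closed generator_closed(4), of "Suc 0"]
    juxtapose_closed[OF generator_closed(4) id_diagram_closed, of "Suc 0"]
    juxtapose_closed[OF generator_closed(1) id_diagram_closed, of "Suc 0"]
    juxtapose_closed[OF id_diagram_closed generator_closed(2), of "Suc 0"]
    juxtapose_closed[OF id_diagram_closed generator_closed(1), of "Suc 0"]
    juxtapose_closed[OF generator_closed(2) id_diagram_closed, of "Suc 0"]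
  by (simp_all add: numeral_2_eq_2 numeral_3_eq_3)

lemma card_bools_1: "card (bools (Suc 0)) = 2"
  using sum_bools_small(1)[of "\<lambda>_. 1 :: nat"] by simp

lemmas relation_simps = dmat_def sat_generator sat_juxtapose_generator sum_bools_small card_bools_1
  sat_id_diagram_small

lemma stack_eqI_conj:
  assumes "D \<in> partitions k l" "D' \<in> partitions m k" "E \<in> partitions m l"
    and "\<And>x y. x \<in> bools m \<Longrightarrow> y \<in> bools l \<Longrightarrow>
      (\<Sum>z\<in>bools k. dmat D z y * dmat D' x z) = 2 ^ n * dmat E x y"
  shows "stack_diagram m k l D D' = E \<and> stack_loops m k l D D' = n"
  using stack_eqI[OF assms] by blast

text \<open>The eight defining relations on diagrams, each with its number of closed components. It
  is 1 only for \<open>cap_diagram\<close> on \<open>cup_diagram\<close> and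
  \<open>counit_diagram\<close> on \<open>unit_diagram\<close>, which accounts for the factor
  \<open>t\<close> there. Each is checked by evaluating small matrices on all colourings.\<close>

lemma stack_relations:
  "stack_diagram (Suc 0) 2 0 cap_diagram (juxtapose (Suc 0) (Suc 0) (id_diagram (Suc 0)) unit_diagram) = counit_diagram \<and>
    stack_loops (Suc 0) 2 0 cap_diagram (juxtapose (Suc 0) (Suc 0) (id_diagram (Suc 0)) unit_diagram) = 0"
  "stack_diagram (Suc 0) 2 0 cap_diagram (juxtapose 0 (Suc 0) unit_diagram (id_diagram (Suc 0))) = counit_diagram \<and>
    stack_loops (Suc 0) 2 0 cap_diagram (juxtapose 0 (Suc 0) unit_diagram (id_diagram (Suc 0))) = 0"
  "stack_diagram 0 2 (Suc 0) (juxtapose (Suc 0) (Suc 0) (id_diagram (Suc 0)) counit_diagram) cup_diagram = unit_diagram \<and>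
    stack_loops 0 2 (Suc 0) (juxtapose (Suc 0) (Suc 0) (id_diagram (Suc 0)) counit_diagram) cup_diagram = 0"
  "stack_diagram 0 2 (Suc 0) (juxtapose (Suc 0) 0 counit_diagram (id_diagram (Suc 0))) cup_diagram = unit_diagram \<and>
    stack_loops 0 2 (Suc 0) (juxtapose (Suc 0) 0 counit_diagram (id_diagram (Suc 0))) cup_diagram = 0"
  "stack_diagram (Suc 0) 3 (Suc 0) (juxtapose 2 0 cap_diagram (id_diagram (Suc 0))) (juxtapose (Suc 0) (Suc 0) (id_diagram (Suc 0)) cup_diagram) = id_diagram (Suc 0) \<and>
    stack_loops (Suc 0) 3 (Suc 0) (juxtapose 2 0 cap_diagram (id_diagram (Suc 0))) (juxtapose (Suc 0) (Suc 0) (id_diagram (Suc 0)) cup_diagram) = 0"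
  "stack_diagram (Suc 0) 3 (Suc 0) (juxtapose (Suc 0) (Suc 0) (id_diagram (Suc 0)) cap_diagram) (juxtapose 0 2 cup_diagram (id_diagram (Suc 0))) = id_diagram (Suc 0) \<and>
    stack_loops (Suc 0) 3 (Suc 0) (juxtapose (Suc 0) (Suc 0) (id_diagram (Suc 0)) cap_diagram) (juxtapose 0 2 cup_diagram (id_diagram (Suc 0))) = 0"
  "stack_diagram 0 2 0 cap_diagram cup_diagram = id_diagram 0 \<and>
    stack_loops 0 2 0 cap_diagram cup_diagram = Suc 0"
  "stack_diagram 0 (Suc 0) 0 counit_diagram unit_diagram = id_diagram 0 \<and>
    stack_loops 0 (Suc 0) 0 counit_diagram unit_diagram = Suc 0"
  by (rule stack_eqI_conj, (rule juxtapose_generator_closed generator_closed id_diagram_closed)+,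
    ((erule bools_1E)+)?, simp add: relation_simps del: One_nat_def)+

section \<open>The functor to the partition category is well defined\<close>

lemma meq_wf:
  assumes "cring R" "t \<in> carrier R" "meq R t f g"
  shows "wf_term R f \<and> wf_term R g \<and> src f = src g \<and> tgt f = tgt g"
proof -
  interpret cring R by fact
  show ?thesis
    using assms(3)
    by (induction rule: meq.induct) (auto simp: terms_def assms(2))
qed

section \<open>Calculus of linear and bilinear extensions\<close>

locale par_category = cring R for R (structure) +
  fixes t :: 'a
  assumes t_closed [simp]: "t \<in> carrier R"
begin

text \<open>The value at \<open>x\<close> of the linear extension of \<open>h\<close>. Coefficient
  families are total functions into the carrier (\<open>funs\<close>), so closure holds outside of
  \<open>S\<close> as well and nested sums can be rearranged with few side conditions.\<close>

definition pairing :: "'d set \<Rightarrow> ('d \<Rightarrow> 'a) \<Rightarrow> ('d \<Rightarrow> 'a) \<Rightarrow> 'a" where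
  "pairing S x h = (\<Oplus>D\<in>S. x D \<otimes> h D)"

abbreviation funs :: "('d \<Rightarrow> 'a) set" where
  "funs \<equiv> UNIV \<rightarrow> carrier R"

lemma funs_closed [simp]: "x \<in> funs \<Longrightarrow> x D \<in> carrier R"
  by auto

lemma pairing_closed [simp]:
  "x \<in> funs \<Longrightarrow> (\<And>D. h D \<in> carrier R) \<Longrightarrow> pairing S x h \<in> carrier R"
  unfolding pairing_def by (intro finsum_closed) auto

lemma pairing_cong:
  assumes "x \<in> funs" "\<And>D. h' D \<in> carrier R" "\<And>D. D \<in> S \<Longrightarrow> h D = h' D"
  shows "pairing S x h = pairing S x h'"
  unfolding pairing_def using assms by (intro finsum_cong') auto

lemma pairing_smult_right:
  assumes "finite S" "x \<in> funs" "\<And>D. h D \<in> carrier R" "a \<in> carrier R"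
  shows "pairing S x (\<lambda>D. a \<otimes> h D) = a \<otimes> pairing S x h"
proof -
  have "pairing S x (\<lambda>D. a \<otimes> h D) = (\<Oplus>D\<in>S. a \<otimes> (x D \<otimes> h D))"
    unfolding pairing_def using assms by (intro finsum_cong') (auto simp: m_lcomm)
  then show ?thesis
    using finsum_rdistr[OF assms(1,4), of "\<lambda>D. x D \<otimes> h D"] assms by (simp add: pairing_def)
qed

lemma pairing_smult_left:
  assumes "finite S" "x \<in> funs" "\<And>D. h D \<in> carrier R" "a \<in> carrier R"
  shows "pairing S (\<lambda>D. a \<otimes> x D) h = a \<otimes> pairing S x h"
proof -
  have "pairing S (\<lambda>D. a \<otimes> x D) h = (\<Oplus>D\<in>S. a \<otimes> (x D \<otimes> h D))"
    unfolding pairing_def using assms by (intro finsum_cong') (auto simp: m_assoc)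
  then show ?thesis
    using finsum_rdistr[OF assms(1,4), of "\<lambda>D. x D \<otimes> h D"] assms by (simp add: pairing_def)
qed

lemma pairing_add_left:
  assumes "x \<in> funs" "y \<in> funs" "\<And>D. h D \<in> carrier R"
  shows "pairing S (\<lambda>D. x D \<oplus> y D) h = pairing S x h \<oplus> pairing S y h"
proof -
  have "pairing S (\<lambda>D. x D \<oplus> y D) h = (\<Oplus>D\<in>S. x D \<otimes> h D \<oplus> y D \<otimes> h D)"
    unfolding pairing_def using assms by (intro finsum_cong') (auto simp: l_distr)
  then show ?thesis
    using finsum_addf[of "\<lambda>D. x D \<otimes> h D" S "\<lambda>D. y D \<otimes> h D"] assms by (simp add: pairing_def)
qed

lemma pairing_add_right:
  assumes "x \<in> funs" "\<And>D. h D \<in> carrier R" "\<And>D. h' D \<in> carrier R"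
  shows "pairing S x (\<lambda>D. h D \<oplus> h' D) = pairing S x h \<oplus> pairing S x h'"
proof -
  have "pairing S x (\<lambda>D. h D \<oplus> h' D) = (\<Oplus>D\<in>S. x D \<otimes> h D \<oplus> x D \<otimes> h' D)"
    unfolding pairing_def using assms by (intro finsum_cong') (auto simp: r_distr)
  then show ?thesis
    using finsum_addf[of "\<lambda>D. x D \<otimes> h D" S "\<lambda>D. x D \<otimes> h' D"] assms by (simp add: pairing_def)
qed

lemma pairing_zero_left [simp]: "(\<And>D. h D \<in> carrier R) \<Longrightarrow> pairing S (\<lambda>D. \<zero>) h = \<zero>"
  unfolding pairing_def by (simp add: add.finprod_one_eqI)

lemma pairing_zero_right [simp]: "x \<in> funs \<Longrightarrow> pairing S x (\<lambda>D. \<zero>) = \<zero>"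
  unfolding pairing_def by (simp add: add.finprod_one_eqI)

lemma pairing_swap:
  assumes "finite S" "finite T" and x: "x \<in> funs" and y: "y \<in> funs" and h: "\<And>D E. h D E \<in> carrier R"
  shows "pairing S x (\<lambda>D. pairing T y (h D)) = pairing T y (\<lambda>E. pairing S x (\<lambda>D. h D E))"
  using assms(1)
proof (induction S)
  case empty
  then show ?case using y by (simp add: pairing_def finsum_zero)
next
  case (insert A S)
  have ins: "pairing (insert A S) x g = x A \<otimes> g A \<oplus> pairing S x g" if "\<And>D. g D \<in> carrier R" for g
    unfolding pairing_def using insert.hyps x that by (subst finsum_insert) auto
  have "pairing (insert A S) x (\<lambda>D. pairing T y (h D)) =
      pairing T y (\<lambda>E. x A \<otimes> h A E) \<oplus> pairing T y (\<lambda>E. pairing S x (\<lambda>D. h D E))"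
    using x y h insert.IH by (simp add: ins pairing_smult_right[OF assms(2)])
  also have "\<dots> = pairing T y (\<lambda>E. pairing (insert A S) x (\<lambda>D. h D E))"
    using x y h by (simp add: ins pairing_add_right)
  finally show ?case .
qed

lemma par_basis_closed [simp]: "par_basis R D P \<in> carrier R"
  by (simp add: par_basis_def)

lemma par_basis_funs [simp]: "par_basis R D \<in> funs"
  by simp

lemma pairing_par_basis_left:
  assumes "finite S" "D \<in> S" "\<And>D. h D \<in> carrier R"
  shows "pairing S (par_basis R D) h = h D"
proof -
  have "pairing S (par_basis R D) h = (\<Oplus>E\<in>S. if D = E then h E else \<zero>)"
    unfolding pairing_def using assms by (intro finsum_cong') (auto simp: par_basis_def)
  then show ?thesis using finsum_singleton[OF assms(2,1), of h] assms by simp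
qed

lemma pairing_par_basis_right:
  assumes "finite S" "x \<in> funs" "\<And>D. D \<notin> S \<Longrightarrow> x D = \<zero>"
  shows "pairing S x (\<lambda>D. par_basis R D P) = x P"
proof (cases "P \<in> S")
  case True
  have "pairing S x (\<lambda>D. par_basis R D P) = (\<Oplus>E\<in>S. if P = E then x E else \<zero>)"
    unfolding pairing_def using assms by (intro finsum_cong') (auto simp: par_basis_def)
  then show ?thesis using finsum_singleton[OF True assms(1), of x] assms by simp
next
  case False
  have "pairing S x (\<lambda>D. par_basis R D P) = pairing S x (\<lambda>D. \<zero>)"
    using False assms by (intro pairing_cong) (auto simp: par_basis_def)
  with False assms show ?thesis by simp
qed

text \<open>The bilinear extension of a product of basis elements with weight \<open>c\<close> and
  value \<open>p\<close>. Composition has a power of \<open>t\<close> as its weight, the tensor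
  product has weight 1.\<close>

definition bilin :: "'d set \<Rightarrow> 'e set \<Rightarrow> ('d \<Rightarrow> 'e \<Rightarrow> 'a) \<Rightarrow> ('d \<Rightarrow> 'e \<Rightarrow> diagram) \<Rightarrow>
    ('d \<Rightarrow> 'a) \<Rightarrow> ('e \<Rightarrow> 'a) \<Rightarrow> diagram \<Rightarrow> 'a" where
  "bilin S T c p x y = (\<lambda>P. pairing S x (\<lambda>D. pairing T y (\<lambda>E. c D E \<otimes> par_basis R (p D E) P)))"

lemma bilin_funs [simp]:
  "x \<in> funs \<Longrightarrow> y \<in> funs \<Longrightarrow> (\<And>D E. c D E \<in> carrier R) \<Longrightarrow> bilin S T c p x y \<in> funs"
  by (auto simp: bilin_def)

text \<open>Summing against \<open>par_basis\<close> leaves only the term at \<open>p D E\<close>,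
  provided that this lies in \<open>U\<close>. In this way an inner product is eliminated from
  nested sums.\<close>

lemma pairing_bilin:
  assumes fin: "finite S" "finite T" "finite U" and x: "x \<in> funs" and y: "y \<in> funs"
    and c: "\<And>D E. c D E \<in> carrier R" and h: "\<And>P. h P \<in> carrier R"
    and p: "\<And>D E. D \<in> S \<Longrightarrow> E \<in> T \<Longrightarrow> p D E \<in> U"
  shows "pairing U (bilin S T c p x y) h = pairing S x (\<lambda>D. pairing T y (\<lambda>E. c D E \<otimes> h (p D E)))"
proof -
  have "pairing U (bilin S T c p x y) h = pairing U h (bilin S T c p x y)"
    unfolding pairing_def using x y c h by (intro finsum_cong') (auto simp: m_comm)
  also have "\<dots> = pairing S x (\<lambda>D. pairing U h (\<lambda>P. pairing T y (\<lambda>E. c D E \<otimes> par_basis R (p D E) P)))"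
    unfolding bilin_def using x y c h by (subst pairing_swap[OF fin(1,3)]) auto
  also have "\<dots> = pairing S x (\<lambda>D. pairing T y (\<lambda>E. pairing U h (\<lambda>P. c D E \<otimes> par_basis R (p D E) P)))"
    using x y c h by (intro pairing_cong pairing_swap fin) auto
  also have "\<dots> = pairing S x (\<lambda>D. pairing T y (\<lambda>E. c D E \<otimes> h (p D E)))"
  proof (intro pairing_cong)
    fix D E assume DE: "D \<in> S" "E \<in> T"
    have "pairing U h (\<lambda>P. par_basis R (p D E) P) = pairing U (par_basis R (p D E)) h"
      unfolding pairing_def using h by (intro finsum_cong') (auto simp: m_comm)
    also have "\<dots> = h (p D E)" using fin p DE h by (intro pairing_par_basis_left) auto
    finally show "pairing U h (\<lambda>P. c D E \<otimes> par_basis R (p D E) P) = c D E \<otimes> h (p D E)"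
      using c h by (subst pairing_smult_right[OF fin(3)]) auto
  qed (use x y c h in auto)
  finally show ?thesis .
qed

lemma double_finsum_eq_pairing:
  assumes "finite T" and x: "x \<in> funs" and y: "y \<in> funs" and g: "\<And>D E. g D E \<in> carrier R"
  shows "(\<Oplus>D\<in>S. \<Oplus>E\<in>T. x D \<otimes> y E \<otimes> g D E) = pairing S x (\<lambda>D. pairing T y (g D))"
  unfolding pairing_def[of S]
proof (rule finsum_cong')
  show "(\<lambda>D. x D \<otimes> pairing T y (g D)) \<in> S \<rightarrow> carrier R" using x y g by simp
  fix D
  have "(\<Oplus>E\<in>T. x D \<otimes> y E \<otimes> g D E) = (\<Oplus>E\<in>T. x D \<otimes> (y E \<otimes> g D E))"
    using x y g by (simp add: m_assoc)
  also have "\<dots> = x D \<otimes> pairing T y (g D)"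
    unfolding pairing_def using assms by (intro finsum_rdistr[symmetric]) auto
  finally show "(\<Oplus>E\<in>T. x D \<otimes> y E \<otimes> g D E) = x D \<otimes> pairing T y (g D)" .
qed simp

lemma par_comp_eq_bilin:
  assumes "x \<in> funs" "y \<in> funs"
  shows "par_comp R t m k l x y =
    bilin (partitions k l) (partitions m k) (\<lambda>D E. t [^] stack_loops m k l D E) (stack_diagram m k l) x y"
  unfolding par_comp_def bilin_def using assms by (intro ext double_finsum_eq_pairing) simp_all

lemma par_tensor_eq_bilin:
  assumes "x \<in> funs" "y \<in> funs"
  shows "par_tensor R k l k' l' x y =
    bilin (partitions k l) (partitions k' l') (\<lambda>D E. \<one>) (juxtapose k l) x y"
  unfolding par_tensor_def bilin_def
  using double_finsum_eq_pairing[OF finite_partitions assms, of "\<lambda>D E. par_basis R (juxtapose k l D E) _"]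
  by simp

lemma par_comp_funs [simp]: "x \<in> funs \<Longrightarrow> y \<in> funs \<Longrightarrow> par_comp R t m k l x y \<in> funs"
  by (simp only: par_comp_eq_bilin) simp

lemma par_tensor_funs [simp]: "x \<in> funs \<Longrightarrow> y \<in> funs \<Longrightarrow> par_tensor R k l k' l' x y \<in> funs"
  by (simp only: par_tensor_eq_bilin) simp

lemma bilin_outside:
  assumes "x \<in> funs" "y \<in> funs" "\<And>D E. c D E \<in> carrier R"
    "\<And>D E. D \<in> S \<Longrightarrow> E \<in> T \<Longrightarrow> p D E \<in> U" "P \<notin> U"
  shows "bilin S T c p x y P = \<zero>"
proof -
  have "bilin S T c p x y P = pairing S x (\<lambda>D. pairing T y (\<lambda>E. \<zero>))"
    unfolding bilin_def using assms by (intro pairing_cong) (auto simp: par_basis_def)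
  then show ?thesis using assms by simp
qed

lemma bilin_par_basis:
  assumes "finite S" "finite T" "D \<in> S" "E \<in> T" "\<And>D E. c D E \<in> carrier R"
  shows "bilin S T c p (par_basis R D) (par_basis R E) = (\<lambda>P. c D E \<otimes> par_basis R (p D E) P)"
  unfolding bilin_def using assms by (simp add: pairing_par_basis_left)

lemma par_comp_basis:
  assumes "D \<in> partitions k l" "E \<in> partitions m k"
  shows "par_comp R t m k l (par_basis R D) (par_basis R E) =
    (\<lambda>P. t [^] stack_loops m k l D E \<otimes> par_basis R (stack_diagram m k l D E) P)"
  using assms by (simp add: par_comp_eq_bilin bilin_par_basis)

lemma par_tensor_basis:
  assumes "D \<in> partitions k l" "E \<in> partitions k' l'"
  shows "par_tensor R k l k' l' (par_basis R D) (par_basis R E) = par_basis R (juxtapose k l D E)"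
  using assms by (simp add: par_tensor_eq_bilin bilin_par_basis)

lemma bilin_add_left:
  assumes "x \<in> funs" "x' \<in> funs" "y \<in> funs" "\<And>D E. c D E \<in> carrier R"
  shows "bilin S T c p (\<lambda>D. x D \<oplus> x' D) y = (\<lambda>P. bilin S T c p x y P \<oplus> bilin S T c p x' y P)"
  unfolding bilin_def using assms by (simp add: pairing_add_left)

lemma bilin_add_right:
  assumes "x \<in> funs" "y \<in> funs" "y' \<in> funs" "\<And>D E. c D E \<in> carrier R"
  shows "bilin S T c p x (\<lambda>D. y D \<oplus> y' D) = (\<lambda>P. bilin S T c p x y P \<oplus> bilin S T c p x y' P)"
  unfolding bilin_def using assms by (simp add: pairing_add_left pairing_add_right)

lemma bilin_smult_left:
  assumes "finite S" "x \<in> funs" "y \<in> funs" "a \<in> carrier R" "\<And>D E. c D E \<in> carrier R"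
  shows "bilin S T c p (\<lambda>D. a \<otimes> x D) y = (\<lambda>P. a \<otimes> bilin S T c p x y P)"
  unfolding bilin_def using assms by (simp add: pairing_smult_left)

lemma bilin_smult_right:
  assumes "finite S" "finite T" "x \<in> funs" "y \<in> funs" "a \<in> carrier R" "\<And>D E. c D E \<in> carrier R"
  shows "bilin S T c p x (\<lambda>D. a \<otimes> y D) = (\<lambda>P. a \<otimes> bilin S T c p x y P)"
  unfolding bilin_def using assms by (simp add: pairing_smult_left pairing_smult_right)

text \<open>Associativity on basis elements, with a matching condition on the weights, extends to
  all coefficient families. Composition and tensor product are both instances.\<close>

lemma bilin_assoc:
  assumes fin: "finite S1" "finite S2" "finite S3" "finite S12" "finite S23"
    and xyz: "x \<in> funs" "y \<in> funs" "z \<in> funs"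
    and c: "\<And>D E. c D E \<in> carrier R" "\<And>D E. c' D E \<in> carrier R"
      "\<And>D E. d D E \<in> carrier R" "\<And>D E. d' D E \<in> carrier R"
    and p: "\<And>A B. A \<in> S1 \<Longrightarrow> B \<in> S2 \<Longrightarrow> p A B \<in> S12"
    and q: "\<And>B C. B \<in> S2 \<Longrightarrow> C \<in> S3 \<Longrightarrow> q B C \<in> S23"
    and eq: "\<And>A B C. A \<in> S1 \<Longrightarrow> B \<in> S2 \<Longrightarrow> C \<in> S3 \<Longrightarrow> p' (p A B) C = q' A (q B C)"
      "\<And>A B C. A \<in> S1 \<Longrightarrow> B \<in> S2 \<Longrightarrow> C \<in> S3 \<Longrightarrow> c A B \<otimes> c' (p A B) C = d B C \<otimes> d' A (q B C)"
  shows "bilin S12 S3 c' p' (bilin S1 S2 c p x y) z = bilin S1 S23 d' q' x (bilin S2 S3 d q y z)"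
proof
  fix P
  have "bilin S12 S3 c' p' (bilin S1 S2 c p x y) z P =
    pairing S1 x (\<lambda>A. pairing S2 y (\<lambda>B. c A B \<otimes> pairing S3 z (\<lambda>C. c' (p A B) C \<otimes> par_basis R (p' (p A B) C) P)))"
    unfolding bilin_def[of S12] using fin xyz c p by (intro pairing_bilin) auto
  also have "\<dots> = pairing S1 x (\<lambda>A. pairing S2 y (\<lambda>B. pairing S3 z
      (\<lambda>C. c A B \<otimes> (c' (p A B) C \<otimes> par_basis R (p' (p A B) C) P))))"
    using fin xyz c by (simp add: pairing_smult_right)
  also have "\<dots> = pairing S1 x (\<lambda>A. pairing S2 y (\<lambda>B. pairing S3 z
      (\<lambda>C. d B C \<otimes> (d' A (q B C) \<otimes> par_basis R (q' A (q B C)) P))))"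
    using xyz c eq by (intro pairing_cong) (auto simp: m_assoc[symmetric])
  also have "\<dots> = bilin S1 S23 d' q' x (bilin S2 S3 d q y z) P"
    unfolding bilin_def[of S1] using fin xyz c q
    by (intro pairing_cong pairing_bilin[symmetric]) auto
  finally show "bilin S12 S3 c' p' (bilin S1 S2 c p x y) z P = bilin S1 S23 d' q' x (bilin S2 S3 d q y z) P" .
qed

section \<open>Laws of the partition category\<close>

lemma par_comp_assoc:
  assumes "x \<in> funs" "y \<in> funs" "z \<in> funs"
  shows "par_comp R t a b d (par_comp R t b c d x y) z = par_comp R t a c d x (par_comp R t a b c y z)"
proof -
  let ?c = "\<lambda>m k l D E. t [^] stack_loops m k l D E"
  have "bilin (partitions b d) (partitions a b) (?c a b d) (stack_diagram a b d)
      (bilin (partitions c d) (partitions b c) (?c b c d) (stack_diagram b c d) x y) z =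
    bilin (partitions c d) (partitions a c) (?c a c d) (stack_diagram a c d) x
      (bilin (partitions b c) (partitions a b) (?c a b c) (stack_diagram a b c) y z)"
    using assms by (intro bilin_assoc) (auto simp: stack_assoc nat_pow_mult)
  then show ?thesis using assms by (simp add: par_comp_eq_bilin)
qed

lemma par_tensor_assoc:
  assumes "x \<in> funs" "y \<in> funs" "z \<in> funs"
  shows "par_tensor R (k1 + k2) (l1 + l2) k3 l3 (par_tensor R k1 l1 k2 l2 x y) z =
    par_tensor R k1 l1 (k2 + k3) (l2 + l3) x (par_tensor R k2 l2 k3 l3 y z)"
proof -
  have "bilin (partitions (k1 + k2) (l1 + l2)) (partitions k3 l3) (\<lambda>D E. \<one>) (juxtapose (k1 + k2) (l1 + l2))
      (bilin (partitions k1 l1) (partitions k2 l2) (\<lambda>D E. \<one>) (juxtapose k1 l1) x y) z =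
    bilin (partitions k1 l1) (partitions (k2 + k3) (l2 + l3)) (\<lambda>D E. \<one>) (juxtapose k1 l1) x
      (bilin (partitions k2 l2) (partitions k3 l3) (\<lambda>D E. \<one>) (juxtapose k2 l2) y z)"
    using assms by (intro bilin_assoc) (auto simp: juxtapose_assoc)
  then show ?thesis using assms by (simp add: par_tensor_eq_bilin)
qed

lemma pairing_par_tensor:
  assumes "x \<in> funs" "y \<in> funs" "\<And>D. h D \<in> carrier R"
  shows "pairing (partitions (k + k') (l + l')) (par_tensor R k l k' l' x y) h =
    pairing (partitions k l) x (\<lambda>D. pairing (partitions k' l') y (\<lambda>E. h (juxtapose k l D E)))"
  using pairing_bilin[of "partitions k l" "partitions k' l'" "partitions (k + k') (l + l')" x y "\<lambda>D E. \<one>" h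
      "juxtapose k l"] assms
  by (simp add: par_tensor_eq_bilin)

text \<open>Both sides expand to a fourfold sum over diagrams. The summands agree by
  \<open>stack_juxtapose\<close>, and the orders of summation differ by swapping the two sums in the
  middle.\<close>

lemma par_interchange:
  assumes x: "x \<in> funs" and y: "y \<in> funs" and x': "x' \<in> funs" and y': "y' \<in> funs"
  shows "par_tensor R k m k' m' (par_comp R t k l m x y) (par_comp R t k' l' m' x' y') =
    par_comp R t (k + k') (l + l') (m + m') (par_tensor R l m l' m' x x') (par_tensor R k l k' l' y y')"
    (is "?lhs = ?rhs")
proof
  fix P
  note clo = x y x' y' par_comp_funs par_tensor_funs
  define h where "h = (\<lambda>D E. par_basis R (juxtapose k m D E) P)"
  define c where "c = (\<lambda>A B. t [^] stack_loops k l m A B)"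
  define c' where "c' = (\<lambda>A B. t [^] stack_loops k' l' m' A B)"
  define s where "s = stack_diagram k l m"
  define s' where "s' = stack_diagram k' l' m'"
  have [simp]: "h D E \<in> carrier R" "c A B \<in> carrier R" "c' A B \<in> carrier R" for D E A B
    by (simp_all add: h_def c_def c'_def)
  have key: "c A B \<otimes> (c' A' B' \<otimes> h (s A B) (s' A' B')) =
      t [^] stack_loops (k + k') (l + l') (m + m') (juxtapose l m A A') (juxtapose k l B B') \<otimes>
        par_basis R (stack_diagram (k + k') (l + l') (m + m') (juxtapose l m A A') (juxtapose k l B B')) P"
    if "A \<in> partitions l m" "A' \<in> partitions l' m'" "B \<in> partitions k l" "B' \<in> partitions k' l'" for A A' B B'
    unfolding stack_juxtapose[OF that(1,3,2,4)] c_def c'_def h_def s_def s'_def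
    by (simp add: nat_pow_mult[symmetric] m_assoc)
  let ?S = "partitions l m" and ?S' = "partitions l' m'" and ?T = "partitions k l" and ?T' = "partitions k' l'"
  have "?lhs P = pairing (partitions k m) (par_comp R t k l m x y) (\<lambda>D. pairing (partitions k' m') (par_comp R t k' l' m' x' y') (h D))"
    by (simp add: par_tensor_eq_bilin[OF par_comp_funs[OF x y] par_comp_funs[OF x' y']] bilin_def h_def)
  also have "\<dots> = pairing ?S x (\<lambda>A. pairing ?T y (\<lambda>B. c A B \<otimes>
      pairing (partitions k' m') (par_comp R t k' l' m' x' y') (h (s A B))))"
    using clo by (simp only: par_comp_eq_bilin[OF x y], subst pairing_bilin)
       (auto simp: c_def s_def)
  also have "\<dots> = pairing ?S x (\<lambda>A. pairing ?T y (\<lambda>B. c A B \<otimes>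
      pairing ?S' x' (\<lambda>A'. pairing ?T' y' (\<lambda>B'. c' A' B' \<otimes> h (s A B) (s' A' B')))))"
    using clo by (simp only: par_comp_eq_bilin[OF x' y'], subst pairing_bilin)
       (auto simp: c'_def s'_def)
  also have "\<dots> = pairing ?S x (\<lambda>A. pairing ?T y (\<lambda>B.
      pairing ?S' x' (\<lambda>A'. pairing ?T' y' (\<lambda>B'. c A B \<otimes> (c' A' B' \<otimes> h (s A B) (s' A' B'))))))"
    using clo by (simp add: pairing_smult_right)
  also have "\<dots> = pairing ?S x (\<lambda>A. pairing ?S' x' (\<lambda>A'. pairing ?T y (\<lambda>B.
      pairing ?T' y' (\<lambda>B'. c A B \<otimes> (c' A' B' \<otimes> h (s A B) (s' A' B'))))))"
    using clo by (intro pairing_cong pairing_swap) auto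
  also have "\<dots> = pairing ?S x (\<lambda>A. pairing ?S' x' (\<lambda>A'. pairing ?T y (\<lambda>B.
      pairing ?T' y' (\<lambda>B'. t [^] stack_loops (k + k') (l + l') (m + m') (juxtapose l m A A') (juxtapose k l B B') \<otimes>
        par_basis R (stack_diagram (k + k') (l + l') (m + m') (juxtapose l m A A') (juxtapose k l B B')) P))))"
    using clo by (intro pairing_cong key) simp_all
  also have "\<dots> = pairing ?S x (\<lambda>A. pairing ?S' x' (\<lambda>A'.
      pairing (partitions (k + k') (l + l')) (par_tensor R k l k' l' y y')
      (\<lambda>E. t [^] stack_loops (k + k') (l + l') (m + m') (juxtapose l m A A') E \<otimes>
        par_basis R (stack_diagram (k + k') (l + l') (m + m') (juxtapose l m A A') E) P)))"
    by (simp add: pairing_par_tensor y y')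
  also have "\<dots> = pairing (partitions (l + l') (m + m')) (par_tensor R l m l' m' x x')
    (\<lambda>D. pairing (partitions (k + k') (l + l')) (par_tensor R k l k' l' y y')
      (\<lambda>E. t [^] stack_loops (k + k') (l + l') (m + m') D E \<otimes>
        par_basis R (stack_diagram (k + k') (l + l') (m + m') D E) P))"
    using pairing_par_tensor[OF x x'] par_tensor_funs[OF y y'] by simp
  also have "\<dots> = ?rhs P"
    by (simp only: par_comp_eq_bilin[OF par_tensor_funs[OF x x'] par_tensor_funs[OF y y']] bilin_def)
  finally show "?lhs P = ?rhs P" .
qed

lemma par_comp_id_left:
  assumes "x \<in> funs" "\<And>D. D \<notin> partitions k l \<Longrightarrow> x D = \<zero>"
  shows "par_comp R t k l l (par_basis R (id_diagram l)) x = x"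
proof
  fix P
  have "par_comp R t k l l (par_basis R (id_diagram l)) x P =
    pairing (partitions k l) x (\<lambda>D. par_basis R D P)"
    using assms(1) by (simp add: par_comp_eq_bilin bilin_def pairing_par_basis_left)
      (intro pairing_cong, auto simp: stack_id_left)
  then show "par_comp R t k l l (par_basis R (id_diagram l)) x P = x P"
    using assms by (simp add: pairing_par_basis_right)
qed

lemma par_comp_id_right:
  assumes "x \<in> funs" "\<And>D. D \<notin> partitions k l \<Longrightarrow> x D = \<zero>"
  shows "par_comp R t k k l x (par_basis R (id_diagram k)) = x"
proof
  fix P
  have "par_comp R t k k l x (par_basis R (id_diagram k)) P =
    pairing (partitions k l) x (\<lambda>D. par_basis R D P)"
    using assms(1) by (simp add: par_comp_eq_bilin bilin_def pairing_par_basis_left)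
      (intro pairing_cong, auto simp: stack_id_right)
  then show "par_comp R t k k l x (par_basis R (id_diagram k)) P = x P"
    using assms by (simp add: pairing_par_basis_right)
qed

lemma par_tensor_unit_left:
  assumes "x \<in> funs" "\<And>D. D \<notin> partitions k l \<Longrightarrow> x D = \<zero>"
  shows "par_tensor R 0 0 k l (par_basis R (id_diagram 0)) x = x"
proof
  fix P
  have "par_tensor R 0 0 k l (par_basis R (id_diagram 0)) x P = pairing (partitions k l) x (\<lambda>D. par_basis R D P)"
    using assms(1) by (simp add: par_tensor_eq_bilin bilin_def pairing_par_basis_left juxtapose_unit_left)
  then show "par_tensor R 0 0 k l (par_basis R (id_diagram 0)) x P = x P"
    using assms by (simp add: pairing_par_basis_right)
qed

lemma par_tensor_unit_right:
  assumes "x \<in> funs" "\<And>D. D \<notin> partitions k l \<Longrightarrow> x D = \<zero>"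
  shows "par_tensor R k l 0 0 x (par_basis R (id_diagram 0)) = x"
proof
  fix P
  have "par_tensor R k l 0 0 x (par_basis R (id_diagram 0)) P = pairing (partitions k l) x (\<lambda>D. par_basis R D P)"
    using assms(1) by (simp add: par_tensor_eq_bilin bilin_def pairing_par_basis_left juxtapose_unit_right)
  then show "par_tensor R k l 0 0 x (par_basis R (id_diagram 0)) P = x P"
    using assms by (simp add: pairing_par_basis_right)
qed

section \<open>Compatibility of the functor with all relations\<close>

lemma J_funs [simp]: "wf_term R f \<Longrightarrow> J R t f \<in> funs"
  by (induction f) (auto intro!: par_comp_funs[THEN funcset_mem] par_tensor_funs[THEN funcset_mem])

text \<open>The unit laws of \<open>par_comp\<close> and \<open>par_tensor\<close> hold only for
  families supported on the partitions of the right type, since a product with an identity erases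
  all other coefficients.\<close>

lemma J_outside: "wf_term R f \<Longrightarrow> D \<notin> partitions (src f) (tgt f) \<Longrightarrow> J R t f D = \<zero>"
proof (induction f arbitrary: D)
  case (CompM f g)
  then show ?case
    by (simp add: par_comp_eq_bilin) (rule bilin_outside[of _ _ _ _ _ _ "partitions (src g) (tgt f)"]; simp)
next
  case (TensM f g)
  then show ?case
    by (simp add: par_tensor_eq_bilin)
      (rule bilin_outside[of _ _ _ _ _ _ "partitions (src f + src g) (tgt f + tgt g)"]; simp)
qed (use generator_closed id_diagram_closed in \<open>auto simp: par_basis_def\<close>)

lemmas relations = par_tensor_basis par_comp_basis stack_relations[simplified]
  generator_closed[simplified] juxtapose_generator_closed[simplified]

lemma J_sound: "meq R t f g \<Longrightarrow> J R t f = J R t g"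
proof (induction rule: meq.induct)
  case (cong_comp f f' g g')
  then show ?case using meq_wf[OF cring_axioms t_closed] by simp
next
  case (cong_tens f f' g g')
  then show ?case using meq_wf[OF cring_axioms t_closed] by simp
next
  case (add_minus f k l)
  then show ?case by (auto simp: terms_def l_minus r_neg)
next
  case comp_assoc
  then show ?case by (auto simp: terms_def par_comp_assoc)
next
  case comp_id_right
  then show ?case by (auto simp: terms_def par_comp_id_right J_outside)
next
  case comp_id_left
  then show ?case by (auto simp: terms_def par_comp_id_left J_outside)
next
  case tens_id
  then show ?case by (auto simp: par_tensor_basis juxtapose_id)
next
  case interchange
  then show ?case by (auto simp: terms_def par_interchange)
next
  case tens_assoc
  then show ?case by (auto simp: par_tensor_assoc)
next
  case tens_unit_right
  then show ?case by (auto simp: par_tensor_unit_right J_outside)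
next
  case tens_unit_left
  then show ?case by (auto simp: par_tensor_unit_left J_outside)
next
  case comp_add_left
  then show ?case by (auto simp: terms_def par_comp_eq_bilin bilin_add_left)
next
  case comp_add_right
  then show ?case by (auto simp: terms_def par_comp_eq_bilin bilin_add_right)
next
  case comp_scale_left
  then show ?case by (auto simp: terms_def par_comp_eq_bilin bilin_smult_left)
next
  case comp_scale_right
  then show ?case by (auto simp: terms_def par_comp_eq_bilin bilin_smult_right)
next
  case tens_add_left
  then show ?case by (auto simp: terms_def par_tensor_eq_bilin bilin_add_left)
next
  case tens_add_right
  then show ?case by (auto simp: terms_def par_tensor_eq_bilin bilin_add_right)
next
  case tens_scale_left
  then show ?case by (auto simp: terms_def par_tensor_eq_bilin bilin_smult_left)
next
  case tens_scale_right
  then show ?case by (auto simp: terms_def par_tensor_eq_bilin bilin_smult_right)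
next
  case add_assoc
  then show ?case by (auto simp: terms_def a_assoc)
next
  case add_comm
  then show ?case by (auto simp: terms_def a_comm)
next
  case scale_scale
  then show ?case by (auto simp: m_assoc)
next
  case scale_add_left
  then show ?case by (auto simp: l_distr)
next
  case scale_add_right
  then show ?case by (auto simp: terms_def r_distr)
next
  case d_eta_right
  then show ?case by (simp add: relations flip: numeral_2_eq_2)
next
  case d_eta_left
  then show ?case by (simp add: relations flip: numeral_2_eq_2)
next
  case eps_c_right
  then show ?case by (simp add: relations flip: numeral_2_eq_2)
next
  case eps_c_left
  then show ?case by (simp add: relations flip: numeral_2_eq_2)
next
  case zigzag_left
  then show ?case by (simp add: relations flip: numeral_2_eq_2)
next
  case zigzag_right
  then show ?case by (simp add: relations flip: numeral_2_eq_2)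
next
  case d_c
  then show ?case by (simp add: relations flip: numeral_2_eq_2)
next
  case eps_eta
  then show ?case by (simp add: relations flip: numeral_2_eq_2)
qed (auto simp: terms_def)

end

section \<open>Normal forms in the Motzkin category\<close>

text \<open>A morphism with \<open>a\<close> identity strands on its left and \<open>b\<close> on
  its right. Rewriting is done on composites of such layers, where only offsets have to be
  tracked.\<close>

definition lay :: "nat \<Rightarrow> 'a mterm \<Rightarrow> nat \<Rightarrow> 'a mterm" where
  "lay a g b = IdM a \<otimes>\<^sub>m g \<otimes>\<^sub>m IdM b"

lemma lay_simps [simp]:
  "src (lay a g b) = a + src g + b" "tgt (lay a g b) = a + tgt g + b"
  "wf_term R (lay a g b) = wf_term R g" "monomial (lay a g b) = monomial g"
  by (simp_all add: lay_def)

text \<open>The truth value \<open>c\<close> distinguishes a pair of adjacent vertices (\<^const>\<open>True\<close>) from a single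
  vertex (\<^const>\<open>False\<close>).\<close>

abbreviation creator :: "bool \<Rightarrow> 'a mterm" where
  "creator c \<equiv> (if c then Cgen else Eta)"

abbreviation annihilator :: "bool \<Rightarrow> 'a mterm" where
  "annihilator c \<equiv> (if c then Dgen else Eps)"

abbreviation width :: "bool \<Rightarrow> nat" where
  "width c \<equiv> (if c then 2 else Suc 0)"

lemma generator_simps [simp]:
  "src (creator c) = 0" "tgt (creator c) = width c" "wf_term R (creator c)" "monomial (creator c)"
  "src (annihilator c) = width c" "tgt (annihilator c) = 0" "wf_term R (annihilator c)" "monomial (annihilator c)"
  by auto

primrec flip :: "'a mterm \<Rightarrow> 'a mterm" where
  "flip (IdM n) = IdM n"
| "flip Dgen = Cgen"
| "flip Cgen = Dgen"
| "flip Eta = Eps"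
| "flip Eps = Eta"
| "flip (f \<circ>\<^sub>m g) = flip g \<circ>\<^sub>m flip f"
| "flip (f \<otimes>\<^sub>m g) = flip f \<otimes>\<^sub>m flip g"
| "flip (ZeroM k l) = ZeroM l k"
| "flip (f \<oplus>\<^sub>m g) = flip f \<oplus>\<^sub>m flip g"
| "flip (a \<odot>\<^sub>m f) = a \<odot>\<^sub>m flip f"

lemma flip_simps [simp]:
  "flip (flip f) = f" "src (flip f) = tgt f" "tgt (flip f) = src f" "flip (lay a f b) = lay a (flip f) b"
  by (induction f) (simp_all add: lay_def)

lemma wf_term_flip [simp]: "wf_term R (flip f) = wf_term R f"
  by (induction f) auto

lemma flip_creator [simp]: "flip (creator c) = annihilator c" "flip (annihilator c) = creator c"
  by auto

context par_category
begin

section \<open>Equational reasoning with layers\<close>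

abbreviation equ :: "'a mterm \<Rightarrow> 'a mterm \<Rightarrow> bool"  (infix \<open>\<triangleq>\<close> 50) where
  "f \<triangleq> g \<equiv> meq R t f g"

lemma equ_wf: "f \<triangleq> g \<Longrightarrow> wf_term R f \<and> wf_term R g \<and> src f = src g \<and> tgt f = tgt g"
  by (rule meq_wf[OF cring_axioms t_closed])

lemma equ_trans [trans]: "f \<triangleq> g \<Longrightarrow> g \<triangleq> h \<Longrightarrow> f \<triangleq> h"
  by (rule meq.trans)

lemma comp_cong_left: "f \<triangleq> f' \<Longrightarrow> src f = tgt g \<Longrightarrow> wf_term R g \<Longrightarrow> f \<circ>\<^sub>m g \<triangleq> f' \<circ>\<^sub>m g"
  by (intro meq.cong_comp meq.refl)

lemma comp_cong_right: "g \<triangleq> g' \<Longrightarrow> src f = tgt g \<Longrightarrow> wf_term R f \<Longrightarrow> f \<circ>\<^sub>m g \<triangleq> f \<circ>\<^sub>m g'"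
  by (intro meq.cong_comp meq.refl)

lemma tens_cong_left: "f \<triangleq> f' \<Longrightarrow> wf_term R g \<Longrightarrow> f \<otimes>\<^sub>m g \<triangleq> f' \<otimes>\<^sub>m g"
  by (intro meq.cong_tens meq.refl)

lemma tens_cong_right: "g \<triangleq> g' \<Longrightarrow> wf_term R f \<Longrightarrow> f \<otimes>\<^sub>m g \<triangleq> f \<otimes>\<^sub>m g'"
  by (intro meq.cong_tens meq.refl)

lemma equ_assoc:
  "wf_term R f \<Longrightarrow> wf_term R g \<Longrightarrow> wf_term R h \<Longrightarrow> src f = tgt g \<Longrightarrow> src g = tgt h \<Longrightarrow>
    (f \<circ>\<^sub>m g) \<circ>\<^sub>m h \<triangleq> f \<circ>\<^sub>m (g \<circ>\<^sub>m h)"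
  by (rule meq.comp_assoc) (auto simp: terms_def)

lemma equ_assoc':
  "wf_term R f \<Longrightarrow> wf_term R g \<Longrightarrow> wf_term R h \<Longrightarrow> src f = tgt g \<Longrightarrow> src g = tgt h \<Longrightarrow>
    f \<circ>\<^sub>m (g \<circ>\<^sub>m h) \<triangleq> (f \<circ>\<^sub>m g) \<circ>\<^sub>m h"
  by (intro meq.sym[OF equ_assoc])

lemma equ_id_left: "wf_term R f \<Longrightarrow> tgt f = n \<Longrightarrow> IdM n \<circ>\<^sub>m f \<triangleq> f"
  by (rule meq.comp_id_left) (auto simp: terms_def)

lemma equ_id_right: "wf_term R f \<Longrightarrow> src f = n \<Longrightarrow> f \<circ>\<^sub>m IdM n \<triangleq> f"
  by (rule meq.comp_id_right) (auto simp: terms_def)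

lemma equ_interchange:
  "wf_term R f \<Longrightarrow> wf_term R g \<Longrightarrow> wf_term R f' \<Longrightarrow> wf_term R g' \<Longrightarrow> src f = tgt g \<Longrightarrow> src f' = tgt g' \<Longrightarrow>
    (f \<circ>\<^sub>m g) \<otimes>\<^sub>m (f' \<circ>\<^sub>m g') \<triangleq> (f \<otimes>\<^sub>m f') \<circ>\<^sub>m (g \<otimes>\<^sub>m g')"
  by (rule meq.interchange) (auto simp: terms_def)

lemma lay_cong: "f \<triangleq> g \<Longrightarrow> lay a f b \<triangleq> lay a g b"
  unfolding lay_def by (intro tens_cong_left tens_cong_right) auto

lemma id_comp_id: "IdM n \<triangleq> IdM n \<circ>\<^sub>m IdM n"
  by (intro meq.sym[OF equ_id_left]) auto

lemma lay_comp:
  assumes "wf_term R f" "wf_term R g" "src f = tgt g"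
  shows "lay a (f \<circ>\<^sub>m g) b \<triangleq> lay a f b \<circ>\<^sub>m lay a g b"
proof -
  have "lay a (f \<circ>\<^sub>m g) b \<triangleq> (IdM a \<circ>\<^sub>m IdM a) \<otimes>\<^sub>m (f \<circ>\<^sub>m g) \<otimes>\<^sub>m (IdM b \<circ>\<^sub>m IdM b)"
    unfolding lay_def using assms by (intro meq.cong_tens id_comp_id meq.refl) auto
  also have "\<dots> \<triangleq> ((IdM a \<otimes>\<^sub>m f) \<circ>\<^sub>m (IdM a \<otimes>\<^sub>m g)) \<otimes>\<^sub>m (IdM b \<circ>\<^sub>m IdM b)"
    using assms by (intro tens_cong_left equ_interchange) auto
  also have "\<dots> \<triangleq> lay a f b \<circ>\<^sub>m lay a g b"
    unfolding lay_def using assms by (intro equ_interchange) auto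
  finally show ?thesis .
qed

lemma lay_id: "lay a (IdM n) b \<triangleq> IdM (a + n + b)"
  unfolding lay_def using equ_trans[OF tens_cong_left[OF meq.tens_id] meq.tens_id] by simp

lemma lay_tens_id:
  assumes "wf_term R g"
  shows "lay a (g \<otimes>\<^sub>m IdM n) b \<triangleq> lay a g (n + b)"
proof -
  have "lay a (g \<otimes>\<^sub>m IdM n) b \<triangleq> ((IdM a \<otimes>\<^sub>m g) \<otimes>\<^sub>m IdM n) \<otimes>\<^sub>m IdM b"
    unfolding lay_def using assms by (intro tens_cong_left meq.sym[OF meq.tens_assoc]) auto
  also have "\<dots> \<triangleq> (IdM a \<otimes>\<^sub>m g) \<otimes>\<^sub>m (IdM n \<otimes>\<^sub>m IdM b)"
    using assms by (intro meq.tens_assoc) auto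
  also have "\<dots> \<triangleq> lay a g (n + b)"
    unfolding lay_def using assms by (intro tens_cong_right meq.tens_id) auto
  finally show ?thesis .
qed

lemma lay_id_tens:
  assumes "wf_term R g"
  shows "lay a (IdM n \<otimes>\<^sub>m g) b \<triangleq> lay (a + n) g b"
proof -
  have "lay a (IdM n \<otimes>\<^sub>m g) b \<triangleq> ((IdM a \<otimes>\<^sub>m IdM n) \<otimes>\<^sub>m g) \<otimes>\<^sub>m IdM b"
    unfolding lay_def using assms by (intro tens_cong_left meq.sym[OF meq.tens_assoc]) auto
  also have "\<dots> \<triangleq> lay (a + n) g b"
    unfolding lay_def using assms by (intro tens_cong_left meq.tens_id) auto
  finally show ?thesis .
qed

lemma tens_as_comp:
  assumes "wf_term R f" "wf_term R g"
  shows "f \<otimes>\<^sub>m g \<triangleq> (f \<otimes>\<^sub>m IdM (tgt g)) \<circ>\<^sub>m (IdM (src f) \<otimes>\<^sub>m g)"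
    and "f \<otimes>\<^sub>m g \<triangleq> (IdM (tgt f) \<otimes>\<^sub>m g) \<circ>\<^sub>m (f \<otimes>\<^sub>m IdM (src g))"
proof -
  have "f \<otimes>\<^sub>m g \<triangleq> (f \<circ>\<^sub>m IdM (src f)) \<otimes>\<^sub>m (IdM (tgt g) \<circ>\<^sub>m g)"
    using assms by (intro meq.cong_tens meq.sym[OF equ_id_left] meq.sym[OF equ_id_right]) auto
  also have "\<dots> \<triangleq> (f \<otimes>\<^sub>m IdM (tgt g)) \<circ>\<^sub>m (IdM (src f) \<otimes>\<^sub>m g)"
    using assms by (intro equ_interchange) auto
  finally show "f \<otimes>\<^sub>m g \<triangleq> (f \<otimes>\<^sub>m IdM (tgt g)) \<circ>\<^sub>m (IdM (src f) \<otimes>\<^sub>m g)" .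
  have "f \<otimes>\<^sub>m g \<triangleq> (IdM (tgt f) \<circ>\<^sub>m f) \<otimes>\<^sub>m (g \<circ>\<^sub>m IdM (src g))"
    using assms by (intro meq.cong_tens meq.sym[OF equ_id_left] meq.sym[OF equ_id_right]) auto
  also have "\<dots> \<triangleq> (IdM (tgt f) \<otimes>\<^sub>m g) \<circ>\<^sub>m (f \<otimes>\<^sub>m IdM (src g))"
    using assms by (intro equ_interchange) auto
  finally show "f \<otimes>\<^sub>m g \<triangleq> (IdM (tgt f) \<otimes>\<^sub>m g) \<circ>\<^sub>m (f \<otimes>\<^sub>m IdM (src g))" .
qed

lemma lay_tens:
  assumes "wf_term R f" "wf_term R g"
  shows "lay a (f \<otimes>\<^sub>m g) b \<triangleq> lay a f (tgt g + b) \<circ>\<^sub>m lay (a + src f) g b" (is ?th1)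
    and "lay a (f \<otimes>\<^sub>m g) b \<triangleq> lay (a + tgt f) g b \<circ>\<^sub>m lay a f (src g + b)" (is ?th2)
proof -
  have "lay a (f \<otimes>\<^sub>m g) b \<triangleq> lay a ((f \<otimes>\<^sub>m IdM (tgt g)) \<circ>\<^sub>m (IdM (src f) \<otimes>\<^sub>m g)) b"
    using assms by (intro lay_cong tens_as_comp)
  also have "\<dots> \<triangleq> lay a (f \<otimes>\<^sub>m IdM (tgt g)) b \<circ>\<^sub>m lay a (IdM (src f) \<otimes>\<^sub>m g) b"
    using assms by (intro lay_comp) auto
  also have "\<dots> \<triangleq> lay a f (tgt g + b) \<circ>\<^sub>m lay (a + src f) g b"
    using assms by (intro meq.cong_comp lay_tens_id lay_id_tens) auto
  finally show ?th1 .
  have "lay a (f \<otimes>\<^sub>m g) b \<triangleq> lay a ((IdM (tgt f) \<otimes>\<^sub>m g) \<circ>\<^sub>m (f \<otimes>\<^sub>m IdM (src g))) b"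
    using assms by (intro lay_cong tens_as_comp)
  also have "\<dots> \<triangleq> lay a (IdM (tgt f) \<otimes>\<^sub>m g) b \<circ>\<^sub>m lay a (f \<otimes>\<^sub>m IdM (src g)) b"
    using assms by (intro lay_comp) auto
  also have "\<dots> \<triangleq> lay (a + tgt f) g b \<circ>\<^sub>m lay a f (src g + b)"
    using assms by (intro meq.cong_comp lay_tens_id lay_id_tens) auto
  finally show ?th2 .
qed

text \<open>Two morphisms separated by \<open>m\<close> strands act on disjoint places, so
  interchange lets either go first. The offset of \<open>h\<close> then changes with the width of
  \<open>g\<close>, and the padding of \<open>g\<close> with the width of \<open>h\<close>.\<close>

lemma lay_commute:
  assumes "wf_term R g" "wf_term R h"
  shows "lay a g (m + tgt h + b) \<circ>\<^sub>m lay (a + src g + m) h b \<triangleq>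
    lay (a + tgt g + m) h b \<circ>\<^sub>m lay a g (m + src h + b)"
proof -
  have "lay a g (m + tgt h + b) \<circ>\<^sub>m lay (a + src g + m) h b \<triangleq>
      lay a g (tgt (IdM m \<otimes>\<^sub>m h) + b) \<circ>\<^sub>m lay (a + src g) (IdM m \<otimes>\<^sub>m h) b"
    using assms by (intro meq.cong_comp meq.sym[OF lay_id_tens] meq.refl) (auto intro: meq.refl)
  also have "\<dots> \<triangleq> lay a (g \<otimes>\<^sub>m (IdM m \<otimes>\<^sub>m h)) b"
    using assms by (intro meq.sym[OF lay_tens(1)]) auto
  also have "\<dots> \<triangleq> lay (a + tgt g) (IdM m \<otimes>\<^sub>m h) b \<circ>\<^sub>m lay a g (src (IdM m \<otimes>\<^sub>m h) + b)"
    using assms by (intro lay_tens(2)) auto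
  also have "\<dots> \<triangleq> lay (a + tgt g + m) h b \<circ>\<^sub>m lay a g (m + src h + b)"
    using assms by (intro meq.cong_comp lay_id_tens) (auto intro: meq.refl)
  finally show ?thesis .
qed

lemma lay_scale:
  assumes "c \<in> carrier R" "wf_term R f"
  shows "lay a (c \<odot>\<^sub>m f) b \<triangleq> c \<odot>\<^sub>m lay a f b"
  unfolding lay_def using assms
  by (intro equ_trans[OF tens_cong_left[OF meq.tens_scale_right] meq.tens_scale_left]) auto

lemma lay_add:
  assumes "wf_term R f" "wf_term R g" "src f = src g" "tgt f = tgt g"
  shows "lay a (f \<oplus>\<^sub>m g) b \<triangleq> lay a f b \<oplus>\<^sub>m lay a g b"
  unfolding lay_def using assms
  by (intro equ_trans[OF tens_cong_left[OF meq.tens_add_right] meq.tens_add_left]) (auto simp: terms_def)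

text \<open>The relations mention \<open>ZeroM\<close> only in connection with addition, so its
  behaviour under composition and padding is obtained by writing it as a multiple with scalar
  0.\<close>

lemma zero_scale: "f \<in> terms R k l \<Longrightarrow> \<zero> \<odot>\<^sub>m f \<triangleq> ZeroM k l"
proof -
  assume f: "f \<in> terms R k l"
  then have wf: "wf_term R f" by (simp add: terms_def)
  have "(\<one> \<oplus> \<ominus> \<one>) \<odot>\<^sub>m f \<triangleq> \<one> \<odot>\<^sub>m f \<oplus>\<^sub>m (\<ominus> \<one>) \<odot>\<^sub>m f"
    using wf by (intro meq.scale_add_left) auto
  also have "\<dots> \<triangleq> f \<oplus>\<^sub>m (\<ominus> \<one>) \<odot>\<^sub>m f"
    using wf by (intro meq.cong_add meq.scale_one meq.refl) auto
  also have "\<dots> \<triangleq> ZeroM k l" using f by (rule meq.add_minus)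
  finally show ?thesis by (simp add: r_neg)
qed

lemma comp_zero: "f \<in> terms R l m \<Longrightarrow> f \<circ>\<^sub>m ZeroM k l \<triangleq> ZeroM k m"
proof -
  assume f: "f \<in> terms R l m"
  have z: "ZeroM k l \<in> terms R k l" by (simp add: terms_def)
  have "f \<circ>\<^sub>m ZeroM k l \<triangleq> f \<circ>\<^sub>m (\<zero> \<odot>\<^sub>m ZeroM k l)"
    using f z by (intro comp_cong_right meq.sym[OF zero_scale]) (auto simp: terms_def)
  also have "\<dots> \<triangleq> \<zero> \<odot>\<^sub>m (f \<circ>\<^sub>m ZeroM k l)" using f z by (intro meq.comp_scale_right) auto
  also have "\<dots> \<triangleq> ZeroM k m" using f z by (intro zero_scale) (auto simp: terms_def)
  finally show ?thesis .
qed

lemma zero_comp: "f \<in> terms R k l \<Longrightarrow> ZeroM l m \<circ>\<^sub>m f \<triangleq> ZeroM k m"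
proof -
  assume f: "f \<in> terms R k l"
  have z: "ZeroM l m \<in> terms R l m" by (simp add: terms_def)
  have "ZeroM l m \<circ>\<^sub>m f \<triangleq> (\<zero> \<odot>\<^sub>m ZeroM l m) \<circ>\<^sub>m f"
    using f z by (intro comp_cong_left meq.sym[OF zero_scale]) (auto simp: terms_def)
  also have "\<dots> \<triangleq> \<zero> \<odot>\<^sub>m (ZeroM l m \<circ>\<^sub>m f)" using f z by (intro meq.comp_scale_left) auto
  also have "\<dots> \<triangleq> ZeroM k m" using f z by (intro zero_scale) (auto simp: terms_def)
  finally show ?thesis .
qed

lemma lay_zero: "lay a (ZeroM k l) b \<triangleq> ZeroM (a + k + b) (a + l + b)"
proof -
  have "lay a (ZeroM k l) b \<triangleq> lay a (\<zero> \<odot>\<^sub>m ZeroM k l) b"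
    by (intro lay_cong meq.sym[OF zero_scale]) (simp add: terms_def)
  also have "\<dots> \<triangleq> \<zero> \<odot>\<^sub>m lay a (ZeroM k l) b" by (intro lay_scale) auto
  also have "\<dots> \<triangleq> ZeroM (a + k + b) (a + l + b)" by (intro zero_scale) (simp add: terms_def)
  finally show ?thesis .
qed

text \<open>Reflection permutes the defining relations: those for caps and units go to those for
  cups and counits, the two zigzags are exchanged, and the two relations with a scalar are
  fixed.\<close>

lemma flip_equ: "f \<triangleq> g \<Longrightarrow> flip f \<triangleq> flip g"
proof (induction rule: meq.induct)
  case (trans f g h)
  then show ?case by (blast intro: meq.trans)
next
  case (cong_comp f f' g g')
  then show ?case using equ_wf by (auto intro!: meq.cong_comp)
next
  case (cong_add f f' g g')
  then show ?case using equ_wf by (auto intro!: meq.cong_add)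
next
  case (comp_assoc f m n g l h k)
  then show ?case by (auto intro!: equ_assoc' simp: terms_def)
next
  case (interchange f l m g k f' l' m' g' k')
  then show ?case by (auto intro!: equ_interchange simp: terms_def)
qed (auto intro: meq.intros simp: terms_def simp del: One_nat_def)

end

no_notation map_comp (infixl \<open>\<circ>\<^sub>m\<close> 55)

subsection \<open>Normal forms\<close>

fun shift_top :: "nat \<Rightarrow> nat \<Rightarrow> vertex \<Rightarrow> vertex" where
  "shift_top a r (Bot i) = Bot i"
| "shift_top a r (Top j) = Top (if j \<le> a then j else j + r)"

text \<open>Describes the effect of a new creating layer on top without speaking of connected
  components; \<open>stack_creator\<close> identifies it with the stacked diagram.\<close>

definition insert_top :: "nat \<Rightarrow> nat \<Rightarrow> diagram \<Rightarrow> diagram" where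
  "insert_top a r D = (`) (shift_top a r) ` D \<union> {Top ` {Suc a..a + r}}"

definition insert_bot :: "nat \<Rightarrow> nat \<Rightarrow> diagram \<Rightarrow> diagram" where
  "insert_bot a r D = flip_diagram (insert_top a r (flip_diagram D))"

lemma flip_id_diagram [simp]: "flip_diagram (id_diagram n) = id_diagram n"
  by (simp add: flip_diagram_def id_diagram_image image_image insert_commute)

datatype letter = Single | Opening | Closing | Through

abbreviation block :: "bool \<Rightarrow> letter list" where
  "block c \<equiv> (if c then [Opening, Closing] else [Single])"

text \<open>The two words describe the top and the bottom row of the diagram of a normal form: a vertex is
  isolated, matched with a later or an earlier vertex of its own row, or with a vertex of the other row.\<close>

inductive nf :: "'a mterm \<Rightarrow> letter list \<Rightarrow> letter list \<Rightarrow> diagram \<Rightarrow> bool" where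
  nf_id: "nf (IdM m) (replicate m Through) (replicate m Through) (id_diagram m)"
| nf_top: "nf z (u @ v) w D \<Longrightarrow> nf (lay (length u) (creator c) (length v) \<circ>\<^sub>m z) (u @ block c @ v) w
    (insert_top (length u) (width c) D)"
| nf_bot: "nf z w (u @ v) D \<Longrightarrow> nf (z \<circ>\<^sub>m lay (length u) (annihilator c) (length v)) w (u @ block c @ v)
    (insert_bot (length u) (width c) D)"

lemma nf_wf: "nf z w w' D \<Longrightarrow> wf_term R z \<and> src z = length w' \<and> tgt z = length w \<and> monomial z"
  by (induction rule: nf.induct) auto

lemma nf_flip: "nf z w w' D \<Longrightarrow> nf (flip z) w' w (flip_diagram D)"
proof (induction rule: nf.induct)
  case (nf_id m)
  then show ?case using nf.nf_id[of m] by simp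
next
  case (nf_top z u v w D c)
  then show ?case using nf.nf_bot[of "flip z" w u v "flip_diagram D" c] by (simp add: insert_bot_def)
next
  case (nf_bot z w u v D c)
  then show ?case using nf.nf_top[of "flip z" u v w "flip_diagram D" c] by (simp add: insert_bot_def)
qed

text \<open>Blocks cannot overlap partially: no proper nonempty end of
  \<open>[Opening, Closing]\<close> or \<open>[Single]\<close> is a beginning of either. So two
  blocks in a word coincide or are disjoint.\<close>

lemma block_eq_cases:
  assumes "u1 @ block c1 @ v1 = u @ block c @ v"
  obtains "u1 = u" "c1 = c" "v1 = v"
  | s where "u1 = u @ block c @ s" "v = s @ block c1 @ v1"
  | s where "u = u1 @ block c1 @ s" "v1 = s @ block c @ v"
  using assms
  by (cases c; cases c1) (auto simp: append_eq_append_conv2 append_eq_Cons_conv Cons_eq_append_conv)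

lemma block_not_through: "u @ block c @ v \<noteq> replicate m Through"
proof
  assume "u @ block c @ v = replicate m Through"
  then have "set (block c) \<subseteq> {Through}"
    by (metis Un_subset_iff set_append set_replicate_conv_if subset_insertI2 subset_refl empty_subsetI)
  then show False by (auto split: if_splits)
qed

lemma length_block [simp]: "length (block c) = width c"
  by simp

context par_category
begin

text \<open>Whichever block of the top word is chosen, it can be taken as the one inserted last, by
  commuting its layer upwards. It may have been inserted at any stage, hence the induction over the
  construction. The diagram \<open>D'\<close> is left open because only the words are
  tracked.\<close>

lemma nf_peel_top:
  assumes "nf z W w D" "W = u @ block c @ v"
  shows "\<exists>z' D'. nf z' (u @ v) w D' \<and> z \<triangleq> lay (length u) (creator c) (length v) \<circ>\<^sub>m z'"
  using assms
proof (induction arbitrary: u v rule: nf.induct)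
  case (nf_id m)
  then show ?case using block_not_through by metis
next
  case (nf_top z u1 v1 w D c1)
  note wf = nf_wf[OF nf_top.hyps, of R]
  from nf_top.prems show ?case
  proof (cases rule: block_eq_cases)
    case 1
    have "lay (length u1) (creator c1) (length v1) \<circ>\<^sub>m z \<triangleq> lay (length u) (creator c) (length v) \<circ>\<^sub>m z"
      unfolding 1 using wf 1 by (intro meq.refl) simp
    then show ?thesis using nf_top.hyps unfolding 1 by blast
  next
    \<comment> \<open>The chosen block lies to the left of the last inserted one; it is peeled off
      the smaller normal form and commuted past the last layer. In the case after this one it lies
      to the right.\<close>
    case (2 s)
    with nf_top.IH[of u "s @ v1"] obtain z' D' where z': "nf z' (u @ s @ v1) w D'"
      "z \<triangleq> lay (length u) (creator c) (length s + length v1) \<circ>\<^sub>m z'" by auto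
    note wf' = nf_wf[OF z'(1), of R]
    let ?z = "lay (length (u @ s)) (creator c1) (length v1) \<circ>\<^sub>m z'"
    have nf: "nf ?z (u @ v) w (insert_top (length (u @ s)) (width c1) D')"
      using nf.nf_top[of z' "u @ s" v1 w D' c1] z'(1) 2 by simp
    let ?L = "lay (length u1) (creator c1) (length v1)" and ?L' = "lay (length u) (creator c) (length s + length v1)"
    have commute: "?L \<circ>\<^sub>m ?L' \<triangleq>
        lay (length u) (creator c) (length v) \<circ>\<^sub>m lay (length (u @ s)) (creator c1) (length v1)"
      using meq.sym[OF lay_commute[of "creator c" "creator c1" "length u" "length s" "length v1"]]
      by (simp add: 2 add_ac del: if_split)
    have "?L \<circ>\<^sub>m z \<triangleq> ?L \<circ>\<^sub>m (?L' \<circ>\<^sub>m z')"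
      using z'(2) wf by (intro comp_cong_right) auto
    also have "\<dots> \<triangleq> (?L \<circ>\<^sub>m ?L') \<circ>\<^sub>m z'"
      using wf' 2 by (intro equ_assoc') auto
    also have "\<dots> \<triangleq> (lay (length u) (creator c) (length v) \<circ>\<^sub>m lay (length (u @ s)) (creator c1) (length v1)) \<circ>\<^sub>m z'"
      using wf' 2 by (intro comp_cong_left commute) auto
    also have "\<dots> \<triangleq> lay (length u) (creator c) (length v) \<circ>\<^sub>m ?z"
      using wf' 2 by (intro equ_assoc) auto
    finally show ?thesis using nf by blast
  next
    case (3 s)
    with nf_top.IH[of "u1 @ s" v] obtain z' D' where z': "nf z' (u1 @ s @ v) w D'"
      "z \<triangleq> lay (length u1 + length s) (creator c) (length v) \<circ>\<^sub>m z'" by auto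
    note wf' = nf_wf[OF z'(1), of R]
    let ?z = "lay (length u1) (creator c1) (length (s @ v)) \<circ>\<^sub>m z'"
    have nf: "nf ?z (u @ v) w (insert_top (length u1) (width c1) D')"
      using nf.nf_top[of z' u1 "s @ v" w D' c1] z'(1) 3 by simp
    let ?L = "lay (length u1) (creator c1) (length v1)" and ?L' = "lay (length u1 + length s) (creator c) (length v)"
    have commute: "?L \<circ>\<^sub>m ?L' \<triangleq>
        lay (length u) (creator c) (length v) \<circ>\<^sub>m lay (length u1) (creator c1) (length (s @ v))"
      using lay_commute[of "creator c1" "creator c" "length u1" "length s" "length v"]
      by (simp add: 3 add_ac del: if_split)
    have "?L \<circ>\<^sub>m z \<triangleq> ?L \<circ>\<^sub>m (?L' \<circ>\<^sub>m z')"
      using z'(2) wf by (intro comp_cong_right) auto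
    also have "\<dots> \<triangleq> (?L \<circ>\<^sub>m ?L') \<circ>\<^sub>m z'"
      using wf' 3 by (intro equ_assoc') auto
    also have "\<dots> \<triangleq> (lay (length u) (creator c) (length v) \<circ>\<^sub>m lay (length u1) (creator c1) (length (s @ v))) \<circ>\<^sub>m z'"
      using wf' 3 by (intro comp_cong_left commute) auto
    also have "\<dots> \<triangleq> lay (length u) (creator c) (length v) \<circ>\<^sub>m ?z"
      using wf' 3 by (intro equ_assoc) auto
    finally show ?thesis using nf by blast
  qed
next
  \<comment> \<open>A layer at the bottom does not touch the top word, so associativity
    suffices.\<close>
  case (nf_bot z W u1 v1 D c1)
  from nf_bot.IH[OF nf_bot.prems] obtain z' D' where z': "nf z' (u @ v) (u1 @ v1) D'"
    "z \<triangleq> lay (length u) (creator c) (length v) \<circ>\<^sub>m z'" by auto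
  note wf = nf_wf[OF nf_bot.hyps, of R] and wf' = nf_wf[OF z'(1), of R]
  let ?B = "lay (length u1) (annihilator c1) (length v1)"
  have "z \<circ>\<^sub>m ?B \<triangleq> (lay (length u) (creator c) (length v) \<circ>\<^sub>m z') \<circ>\<^sub>m ?B"
    using z'(2) wf by (intro comp_cong_left) auto
  also have "\<dots> \<triangleq> lay (length u) (creator c) (length v) \<circ>\<^sub>m (z' \<circ>\<^sub>m ?B)"
    using wf' by (intro equ_assoc) auto
  finally show ?case using nf.nf_bot[OF z'(1)] by blast
qed

lemma nf_peel_bot:
  assumes "nf z w (u @ block c @ v) D"
  shows "\<exists>z' D'. nf z' w (u @ v) D' \<and> z \<triangleq> z' \<circ>\<^sub>m lay (length u) (annihilator c) (length v)"
proof -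
  from nf_peel_top[OF nf_flip[OF assms] HOL.refl] obtain z' D' where z': "nf z' (u @ v) w D'"
    "flip z \<triangleq> lay (length u) (creator c) (length v) \<circ>\<^sub>m z'" by blast
  then show ?thesis using flip_equ[OF z'(2)] nf_flip[OF z'(1)] by auto
qed

text \<open>Induction over one normal form, whose outermost layer is peeled off the other one. The
  two words alone determine the morphism; diagrams enter later, when words are read off from
  them.\<close>

theorem nf_unique: "nf z w w' D \<Longrightarrow> nf z2 w w' D2 \<Longrightarrow> z \<triangleq> z2"
proof (induction arbitrary: z2 D2 rule: nf.induct)
  case (nf_id m)
  then show ?case
    using not_sym[OF block_not_through[of _ True]] not_sym[OF block_not_through[of _ False]]
    by (cases rule: nf.cases) (auto intro!: meq.refl)
next
  case (nf_top z u v w D c)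
  from nf_peel_top[OF nf_top.prems HOL.refl] obtain z' D' where z': "nf z' (u @ v) w D'"
    "z2 \<triangleq> lay (length u) (creator c) (length v) \<circ>\<^sub>m z'" by blast
  have "lay (length u) (creator c) (length v) \<circ>\<^sub>m z \<triangleq> lay (length u) (creator c) (length v) \<circ>\<^sub>m z'"
    using nf_top.IH[OF z'(1)] nf_wf[OF nf_top.hyps, of R] by (intro comp_cong_right) auto
  then show ?case using z'(2) meq.sym meq.trans by metis
next
  case (nf_bot z w u v D c)
  from nf_peel_bot[OF nf_bot.prems] obtain z' D' where z': "nf z' w (u @ v) D'"
    "z2 \<triangleq> z' \<circ>\<^sub>m lay (length u) (annihilator c) (length v)" by blast
  have "z \<circ>\<^sub>m lay (length u) (annihilator c) (length v) \<triangleq> z' \<circ>\<^sub>m lay (length u) (annihilator c) (length v)"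
    using nf_bot.IH[OF z'(1)] nf_wf[OF nf_bot.hyps, of R] by (intro comp_cong_left) auto
  then show ?case using z'(2) meq.sym meq.trans by metis
qed

subsection \<open>The normal forms span\<close>

text \<open>Linear combinations of normal forms up to equality of morphisms. The inductive form lets
  the expansion of a morphism be proved by induction over the combination.\<close>

inductive span :: "nat \<Rightarrow> nat \<Rightarrow> 'a mterm \<Rightarrow> bool" where
  span_zero: "span k l (ZeroM k l)"
| span_nf: "nf z w w' D \<Longrightarrow> span (length w') (length w) z"
| span_add: "span k l f \<Longrightarrow> span k l g \<Longrightarrow> span k l (f \<oplus>\<^sub>m g)"
| span_scale: "c \<in> carrier R \<Longrightarrow> span k l f \<Longrightarrow> span k l (c \<odot>\<^sub>m f)"
| span_equ: "span k l f \<Longrightarrow> g \<triangleq> f \<Longrightarrow> span k l g"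

lemma span_wf: "span k l f \<Longrightarrow> wf_term R f \<and> src f = k \<and> tgt f = l"
  by (induction rule: span.induct) (auto dest: nf_wf[of _ _ _ _ R] equ_wf)

lemma span_flip: "span k l f \<Longrightarrow> span l k (flip f)"
proof (induction rule: span.induct)
  case (span_nf z w w' D)
  then show ?case using span.span_nf[OF nf_flip] by auto
next
  case (span_equ k l f g)
  then show ?case using flip_equ by (blast intro: span.span_equ)
qed (auto intro: span.intros)

text \<open>Linearity of postcomposition reduces the claim to normal forms.\<close>

lemma span_comp_left:
  assumes L: "L \<in> terms R l l'" and nf: "\<And>z w w' D. nf z w w' D \<Longrightarrow> length w = l \<Longrightarrow> span (length w') l' (L \<circ>\<^sub>m z)"
    and "span k l f"
  shows "span k l' (L \<circ>\<^sub>m f)"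
  using assms(3,1,2)
proof (induction rule: span.induct)
  case (span_zero k l)
  then show ?case using comp_zero span.span_zero span.span_equ by blast
next
  case (span_add k l f g)
  have "L \<circ>\<^sub>m (f \<oplus>\<^sub>m g) \<triangleq> L \<circ>\<^sub>m f \<oplus>\<^sub>m L \<circ>\<^sub>m g"
    using span_add span_wf by (intro meq.comp_add_right) (auto simp: terms_def)
  then show ?case using span_add by (blast intro: span.intros)
next
  case (span_scale c k l f)
  have "L \<circ>\<^sub>m (c \<odot>\<^sub>m f) \<triangleq> c \<odot>\<^sub>m (L \<circ>\<^sub>m f)"
    using span_scale span_wf by (intro meq.comp_scale_right) (auto simp: terms_def)
  then show ?case using span_scale by (blast intro: span.intros)
next
  case (span_equ k l f g)
  have "L \<circ>\<^sub>m g \<triangleq> L \<circ>\<^sub>m f"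
    using span_equ span_wf equ_wf by (intro comp_cong_right) (auto simp: terms_def)
  then show ?case using span_equ by (blast intro: span.intros)
qed auto

lemma span_creator:
  assumes "span k (a + b) f" shows "span k (a + width c + b) (lay a (creator c) b \<circ>\<^sub>m f)"
proof (rule span_comp_left[OF _ _ assms])
  show "lay a (creator c) b \<in> terms R (a + b) (a + width c + b)" by (simp add: terms_def)
  fix z :: "'a mterm" and w w' D assume nf: "nf z w w' D" and len: "length w = a + b"
  then have "nf z (take a w @ drop a w) w' D" by simp
  from span_nf[OF nf_top[OF this, of c]] len
  show "span (length w') (a + width c + b) (lay a (creator c) b \<circ>\<^sub>m z)" by (simp add: add_ac del: if_split)
qed

lemma span_bottom:
  assumes "span (a + b) l f" shows "span (a + width c + b) l (f \<circ>\<^sub>m lay a (annihilator c) b)"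
  using span_flip[OF span_creator[OF span_flip[OF assms], of c]] by (simp del: if_split)

text \<open>Applies a relation inside a larger composite. The layers \<open>A\<close> and
  \<open>B\<close> are given up to equality because in the relations a factor is padded by an
  identity strand, while in the composite that strand is counted in an offset.\<close>

lemma equ_context:
  assumes "u \<circ>\<^sub>m v \<triangleq> w" "A \<triangleq> lay a u b" "B \<triangleq> lay a v b" "src u = tgt v" "wf_term R z" "tgt z = a + src v + b"
  shows "A \<circ>\<^sub>m (B \<circ>\<^sub>m z) \<triangleq> lay a w b \<circ>\<^sub>m z"
proof -
  have wf: "wf_term R A" "wf_term R B" "src A = tgt B" "src B = tgt z" "wf_term R u" "wf_term R v" "src w = src v"
    using assms(2-6) equ_wf[OF assms(1)] equ_wf[OF assms(2)] equ_wf[OF assms(3)] by auto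
  have "A \<circ>\<^sub>m (B \<circ>\<^sub>m z) \<triangleq> (A \<circ>\<^sub>m B) \<circ>\<^sub>m z" using wf assms by (intro equ_assoc') auto
  also have "\<dots> \<triangleq> (lay a u b \<circ>\<^sub>m lay a v b) \<circ>\<^sub>m z"
    using wf assms by (intro comp_cong_left meq.cong_comp) auto
  also have "\<dots> \<triangleq> lay a (u \<circ>\<^sub>m v) b \<circ>\<^sub>m z"
    using wf assms by (intro comp_cong_left meq.sym[OF lay_comp]) auto
  also have "\<dots> \<triangleq> lay a w b \<circ>\<^sub>m z"
    using wf assms by (intro comp_cong_left lay_cong) auto
  finally show ?thesis .
qed

lemma equ_context_id:
  assumes "u \<circ>\<^sub>m v \<triangleq> IdM n" "A \<triangleq> lay a u b" "B \<triangleq> lay a v b" "src u = tgt v" "wf_term R z" "tgt z = a + n + b"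
  shows "A \<circ>\<^sub>m (B \<circ>\<^sub>m z) \<triangleq> z"
proof -
  have "src v = n" using equ_wf[OF assms(1)] by simp
  then have "A \<circ>\<^sub>m (B \<circ>\<^sub>m z) \<triangleq> lay a (IdM n) b \<circ>\<^sub>m z" using equ_context[OF assms(1-5)] assms(6) by simp
  also have "\<dots> \<triangleq> IdM (a + n + b) \<circ>\<^sub>m z" using assms by (intro comp_cong_left lay_id) auto
  also have "\<dots> \<triangleq> z" using assms by (intro equ_id_left) auto
  finally show ?thesis .
qed

lemma equ_context_loop:
  assumes "u \<circ>\<^sub>m v \<triangleq> t \<odot>\<^sub>m IdM 0" "src u = tgt v" "wf_term R z" "tgt z = a + b"
  shows "lay a u b \<circ>\<^sub>m (lay a v b \<circ>\<^sub>m z) \<triangleq> t \<odot>\<^sub>m z"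
proof -
  have wf: "wf_term R u" "wf_term R v" "src v = 0" using equ_wf[OF assms(1)] by auto
  have "lay a u b \<circ>\<^sub>m (lay a v b \<circ>\<^sub>m z) \<triangleq> lay a (t \<odot>\<^sub>m IdM 0) b \<circ>\<^sub>m z"
    using assms wf by (intro equ_context) (auto intro: meq.refl)
  also have "\<dots> \<triangleq> (t \<odot>\<^sub>m lay a (IdM 0) b) \<circ>\<^sub>m z" using assms by (intro comp_cong_left lay_scale) auto
  also have "\<dots> \<triangleq> t \<odot>\<^sub>m (lay a (IdM 0) b \<circ>\<^sub>m z)" using assms by (intro meq.comp_scale_left) (auto simp: terms_def)
  also have "\<dots> \<triangleq> t \<odot>\<^sub>m (IdM (a + 0 + b) \<circ>\<^sub>m z)"
    using assms by (intro meq.cong_scale comp_cong_left lay_id) auto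
  also have "\<dots> \<triangleq> t \<odot>\<^sub>m z" using assms by (intro meq.cong_scale equ_id_left) auto
  finally show ?thesis .
qed

lemma lay_pad_left: "wf_term R g \<Longrightarrow> lay (Suc a) g b \<triangleq> lay a (IdM 1 \<otimes>\<^sub>m g) b"
  using meq.sym[OF lay_id_tens[of g a 1 b]] by simp

lemma lay_pad_right: "wf_term R g \<Longrightarrow> lay a g (Suc b) \<triangleq> lay a (g \<otimes>\<^sub>m IdM 1) b"
  using meq.sym[OF lay_tens_id[of g a 1 b]] by simp

text \<open>Overlapping blocks of width at most 2 have few relative positions, and each is one
  defining relation: equal blocks give the scalar \<open>t\<close>, a cap shifted against a cup
  straightens, a counit on one leg of a cup leaves a unit, a unit under one leg of a cap leaves a
  counit. Only in the last case does an annihilator remain, and it is a counit.\<close>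

lemma annihilator_creator_overlap:
  assumes z: "wf_term R z" "tgt z = p + q"
    and len: "a + width c + b = p + width c1 + q" and overlap: "a < p + width c1" "p < a + width c"
  obtains "lay a (annihilator c) b \<circ>\<^sub>m (lay p (creator c1) q \<circ>\<^sub>m z) \<triangleq> z" "a + b = p + q"
  | "lay a (annihilator c) b \<circ>\<^sub>m (lay p (creator c1) q \<circ>\<^sub>m z) \<triangleq> t \<odot>\<^sub>m z" "a + b = p + q"
  | "\<not> c" "c1" "lay a (annihilator c) b \<circ>\<^sub>m (lay p (creator c1) q \<circ>\<^sub>m z) \<triangleq> lay p (creator False) q \<circ>\<^sub>m z"
      "a + b = p + width False + q"
  | "c" "\<not> c1" "lay a (annihilator c) b \<circ>\<^sub>m (lay p (creator c1) q \<circ>\<^sub>m z) \<triangleq> lay a (annihilator False) b \<circ>\<^sub>m z"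
      "a + width False + b = p + q"
proof (cases c; cases c1)
  assume c: "\<not> c" "\<not> c1"
  then have "a = p" "b = q" using len overlap by auto
  then show thesis using that(2) equ_context_loop[OF meq.eps_eta] z c by simp
next
  assume c: "\<not> c" "c1"
  then consider "a = p" "b = Suc q" | "a = Suc p" "b = q" using len overlap by force
  then show thesis
  proof cases
    case 1
    have "lay p Eps (Suc q) \<circ>\<^sub>m (lay p Cgen q \<circ>\<^sub>m z) \<triangleq> lay p Eta q \<circ>\<^sub>m z"
      using z by (intro equ_context[OF meq.eps_c_left lay_pad_right]) (auto intro: meq.refl)
    then show thesis using that(3) c 1 len by simp
  next
    case 2
    have "lay (Suc p) Eps q \<circ>\<^sub>m (lay p Cgen q \<circ>\<^sub>m z) \<triangleq> lay p Eta q \<circ>\<^sub>m z"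
      using z by (intro equ_context[OF meq.eps_c_right lay_pad_left]) (auto intro: meq.refl)
    then show thesis using that(3) c 2 len by simp
  qed
next
  assume c: "c" "\<not> c1"
  then consider "a = p" "q = Suc b" | "p = Suc a" "b = q" using len overlap by force
  then show thesis
  proof cases
    case 1
    have "lay a Dgen b \<circ>\<^sub>m (lay a Eta (Suc b) \<circ>\<^sub>m z) \<triangleq> lay a Eps b \<circ>\<^sub>m z"
      using z 1 by (intro equ_context[OF meq.d_eta_left _ lay_pad_right]) (auto intro: meq.refl)
    then show thesis using that(4) c 1 len by simp
  next
    case 2
    have "lay a Dgen b \<circ>\<^sub>m (lay (Suc a) Eta b \<circ>\<^sub>m z) \<triangleq> lay a Eps b \<circ>\<^sub>m z"
      using z 2 by (intro equ_context[OF meq.d_eta_right _ lay_pad_left]) (auto intro: meq.refl)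
    then show thesis using that(4) c 2 len by simp
  qed
next
  assume c: "c" "c1"
  then consider "a = p" "b = q" | "p = Suc a" "b = Suc q" | "a = Suc p" "q = Suc b" using len overlap by force
  then show thesis
  proof cases
    case 1
    then show thesis using that(2) equ_context_loop[OF meq.d_c] z c by simp
  next
    case 2
    have "lay a Dgen (Suc q) \<circ>\<^sub>m (lay (Suc a) Cgen q \<circ>\<^sub>m z) \<triangleq> z"
      using z 2 by (intro equ_context_id[OF meq.zigzag_left lay_pad_right lay_pad_left]) auto
    then show thesis using that(1) c 2 len by simp
  next
    case 3
    have "lay (Suc p) Dgen b \<circ>\<^sub>m (lay p Cgen (Suc b) \<circ>\<^sub>m z) \<triangleq> z"
      using z 3 by (intro equ_context_id[OF meq.zigzag_right lay_pad_left lay_pad_right]) auto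
    then show thesis using that(1) c 3 len by simp
  qed
qed

text \<open>Induction over the construction of \<open>z\<close>. An annihilator disjoint from the
  topmost creator slides below it; one that overlaps it is absorbed or becomes a counit; at an
  identity it becomes a bottom layer itself. Position and kind are generalised, since sliding
  changes the offsets and a cap may turn into a counit.\<close>

lemma span_annihilator_nf:
  assumes "nf z w w' D" "length w = a + width c + b"
  shows "span (length w') (a + b) (lay a (annihilator c) b \<circ>\<^sub>m z)"
  using assms
proof (induction arbitrary: a b c rule: nf.induct)
  case (nf_id m)
  let ?A = "lay a (annihilator c) b"
  have "nf (IdM (a + b)) (replicate (a + b) Through) (replicate a Through @ replicate b Through) (id_diagram (a + b))"
    using nf.nf_id[of "a + b"] by (simp add: replicate_add)
  from nf.nf_bot[OF this, of c] have "span m (a + b) (IdM (a + b) \<circ>\<^sub>m ?A)"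
    using span_nf nf_id by fastforce
  moreover have "?A \<circ>\<^sub>m IdM m \<triangleq> ?A" using nf_id by (intro equ_id_right) auto
  moreover have "?A \<triangleq> IdM (a + b) \<circ>\<^sub>m ?A" by (intro meq.sym[OF equ_id_left]) auto
  ultimately show ?case by (auto intro: span_equ)
next
  case (nf_top z u v w' D c1)
  let ?A = "lay a (annihilator c) b" and ?L = "lay (length u) (creator c1) (length v)"
  define p q where "p = length u" and "q = length v"
  have wf: "wf_term R z" "tgt z = p + q" "src z = length w'"
    using nf_wf[OF nf_top.hyps, of R] by (auto simp: p_def q_def)
  have sz: "span (length w') (p + q) z" using span_nf[OF nf_top.hyps] by (simp add: p_def q_def)
  have len: "a + width c + b = p + width c1 + q"
    using nf_top.prems by (simp add: p_def q_def del: if_split)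
  have IH: "span (length w') (a + b) (lay a (annihilator c) b \<circ>\<^sub>m z)" if "p + q = a + width c + b" for a b c
    using nf_top.IH that by (simp add: p_def q_def del: if_split)
  consider (left) "a + width c \<le> p" | (right) "p + width c1 \<le> a" | (overlap) "a < p + width c1" "p < a + width c"
    by linarith
  then have "span (length w') (a + b) (lay a (annihilator c) b \<circ>\<^sub>m (lay p (creator c1) q \<circ>\<^sub>m z))"
  proof cases
    case left
    define m where "m = p - (a + width c)"
    have p: "p = a + width c + m" and b: "b = m + width c1 + q" using left len by (auto simp: m_def)
    have "lay a (annihilator c) b \<circ>\<^sub>m (lay p (creator c1) q \<circ>\<^sub>m z) \<triangleq>
        (lay a (annihilator c) b \<circ>\<^sub>m lay p (creator c1) q) \<circ>\<^sub>m z"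
      using wf p b by (intro equ_assoc') (auto simp del: if_split)
    also have "\<dots> \<triangleq> (lay (a + m) (creator c1) q \<circ>\<^sub>m lay a (annihilator c) (m + q)) \<circ>\<^sub>m z"
      using lay_commute[of "annihilator c" "creator c1" a m q] wf p b
      by (intro comp_cong_left) (auto simp del: if_split)
    also have "\<dots> \<triangleq> lay (a + m) (creator c1) q \<circ>\<^sub>m (lay a (annihilator c) (m + q) \<circ>\<^sub>m z)"
      using wf p b by (intro equ_assoc) (auto simp del: if_split)
    finally show ?thesis
      by (rule span_equ[rotated]) (use span_creator[of "length w'" "a + m" q "lay a (annihilator c) (m + q) \<circ>\<^sub>m z" c1] IH[of a c "m + q"] p b
        in \<open>auto simp: add_ac simp del: if_split\<close>)
  next
    case right
    define m where "m = a - (p + width c1)"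
    have a: "a = p + width c1 + m" and q: "q = m + width c + b" using right len by (auto simp: m_def)
    have "lay a (annihilator c) b \<circ>\<^sub>m (lay p (creator c1) q \<circ>\<^sub>m z) \<triangleq>
        (lay a (annihilator c) b \<circ>\<^sub>m lay p (creator c1) q) \<circ>\<^sub>m z"
      using wf a q by (intro equ_assoc') (auto simp del: if_split)
    also have "\<dots> \<triangleq> (lay p (creator c1) (m + b) \<circ>\<^sub>m lay (p + m) (annihilator c) b) \<circ>\<^sub>m z"
      using meq.sym[OF lay_commute[of "creator c1" "annihilator c" p m b]] wf a q
      by (intro comp_cong_left) (auto simp del: if_split)
    also have "\<dots> \<triangleq> lay p (creator c1) (m + b) \<circ>\<^sub>m (lay (p + m) (annihilator c) b \<circ>\<^sub>m z)"
      using wf a q by (intro equ_assoc) (auto simp del: if_split)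
    finally show ?thesis
      by (rule span_equ[rotated]) (use span_creator[of "length w'" p "m + b" "lay (p + m) (annihilator c) b \<circ>\<^sub>m z" c1] IH[of "p + m" c b] a q
        in \<open>auto simp: add_ac simp del: if_split\<close>)
  next
    case overlap
    from wf(1,2) len overlap show ?thesis
    proof (cases rule: annihilator_creator_overlap)
      case 1
      then show ?thesis using sz by (auto intro: span_equ)
    next
      case 2
      show ?thesis unfolding 2(2) by (rule span_equ[OF span_scale[OF t_closed sz] 2(1)])
    next
      case 3
      show ?thesis unfolding 3(4) using span_equ[OF span_creator[OF sz] 3(3)] .
    next
      \<comment> \<open>The cap has become a counit, so the induction hypothesis is used with
        \<open>c = False\<close>.\<close>
      case 4
      then have "span (length w') (a + b) (lay a (annihilator False) b \<circ>\<^sub>m z)" by (intro IH) simp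
      then show ?thesis using 4(3) by (rule span_equ)
    qed
  qed
  then show ?case by (simp add: p_def q_def)
next
  case (nf_bot z w u v D c1)
  let ?A = "lay a (annihilator c) b" and ?B = "lay (length u) (annihilator c1) (length v)"
  have wf: "wf_term R z" "tgt z = a + width c + b" "src z = length u + length v"
    using nf_wf[OF nf_bot.hyps, of R] nf_bot.prems by auto
  have "?A \<circ>\<^sub>m (z \<circ>\<^sub>m ?B) \<triangleq> (?A \<circ>\<^sub>m z) \<circ>\<^sub>m ?B"
    using wf by (intro equ_assoc') (auto simp del: if_split)
  then show ?case
    by (rule span_equ[rotated])
      (use span_bottom[of "length u" "length v" "a + b" "?A \<circ>\<^sub>m z" c1] nf_bot.IH[OF nf_bot.prems]
        in \<open>simp add: add_ac del: if_split\<close>)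
qed

lemma span_annihilator:
  assumes "span k (a + width c + b) f" shows "span k (a + b) (lay a (annihilator c) b \<circ>\<^sub>m f)"
proof (rule span_comp_left[OF _ _ assms])
  show "lay a (annihilator c) b \<in> terms R (a + width c + b) (a + b)" by (simp add: terms_def)
qed (rule span_annihilator_nf)

text \<open>The padding and the morphism \<open>x\<close> underneath are arbitrary because
  composites and tensor products are handled as two successive layers: the lower one changes
  \<open>x\<close>, and for tensor products both get another padding.\<close>

lemma span_lay:
  "wf_term R f \<Longrightarrow> span k (a + src f + b) x \<Longrightarrow> span k (a + tgt f + b) (lay a f b \<circ>\<^sub>m x)"
proof (induction f arbitrary: a b x)
  case (IdM n)
  note wf = span_wf[OF IdM.prems(2)]
  have "lay a (IdM n) b \<circ>\<^sub>m x \<triangleq> IdM (a + n + b) \<circ>\<^sub>m x" using wf by (intro comp_cong_left lay_id) auto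
  also have "\<dots> \<triangleq> x" using wf by (intro equ_id_left) auto
  finally show ?case by (rule span_equ[rotated]) (use IdM.prems in auto)
next
  case Dgen
  then show ?case using span_annihilator[of k a True b x] by simp
next
  case Cgen
  then show ?case using span_creator[of k a b x True] by simp
next
  case Eta
  then show ?case using span_creator[of k a b x False] by simp
next
  case Eps
  then show ?case using span_annihilator[of k a False b x] by simp
next
  case (CompM f g)
  note wf = span_wf[OF CompM.prems(2)]
  have "lay a (f \<circ>\<^sub>m g) b \<circ>\<^sub>m x \<triangleq> (lay a f b \<circ>\<^sub>m lay a g b) \<circ>\<^sub>m x"
    using wf CompM.prems by (intro comp_cong_left lay_comp) auto
  also have "\<dots> \<triangleq> lay a f b \<circ>\<^sub>m (lay a g b \<circ>\<^sub>m x)"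
    using wf CompM.prems by (intro equ_assoc) auto
  finally show ?case by (rule span_equ[rotated]) (use CompM in \<open>auto intro: CompM.IH\<close>)
next
  case (TensM f g)
  note wf = span_wf[OF TensM.prems(2)]
  have "lay a (f \<otimes>\<^sub>m g) b \<circ>\<^sub>m x \<triangleq> (lay a f (tgt g + b) \<circ>\<^sub>m lay (a + src f) g b) \<circ>\<^sub>m x"
    using wf TensM.prems by (intro comp_cong_left lay_tens) auto
  also have "\<dots> \<triangleq> lay a f (tgt g + b) \<circ>\<^sub>m (lay (a + src f) g b \<circ>\<^sub>m x)"
    using wf TensM.prems by (intro equ_assoc) auto
  finally show ?case
    by (rule span_equ[rotated])
      (use TensM.IH(1)[of a "tgt g + b" "lay (a + src f) g b \<circ>\<^sub>m x"] TensM.IH(2)[of "a + src f" b x] TensM.prems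
        in \<open>auto simp: add_ac\<close>)
next
  case (ZeroM m n)
  note wf = span_wf[OF ZeroM.prems(2)]
  have "lay a (ZeroM m n) b \<circ>\<^sub>m x \<triangleq> ZeroM (a + m + b) (a + n + b) \<circ>\<^sub>m x"
    using wf by (intro comp_cong_left lay_zero) auto
  also have "\<dots> \<triangleq> ZeroM k (a + n + b)" using wf by (intro zero_comp) (auto simp: terms_def)
  finally show ?case using span_equ[OF span_zero] by simp
next
  case (AddM f g)
  note wf = span_wf[OF AddM.prems(2)]
  have "lay a (f \<oplus>\<^sub>m g) b \<circ>\<^sub>m x \<triangleq> (lay a f b \<oplus>\<^sub>m lay a g b) \<circ>\<^sub>m x"
    using wf AddM.prems by (intro comp_cong_left lay_add) auto
  also have "\<dots> \<triangleq> lay a f b \<circ>\<^sub>m x \<oplus>\<^sub>m lay a g b \<circ>\<^sub>m x"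
    using wf AddM.prems by (intro meq.comp_add_left) (auto simp: terms_def)
  finally show ?case by (rule span_equ[rotated]) (use AddM in \<open>auto intro!: span_add\<close>)
next
  case (ScaleM c f)
  note wf = span_wf[OF ScaleM.prems(2)]
  have "lay a (c \<odot>\<^sub>m f) b \<circ>\<^sub>m x \<triangleq> (c \<odot>\<^sub>m lay a f b) \<circ>\<^sub>m x"
    using wf ScaleM.prems by (intro comp_cong_left lay_scale) auto
  also have "\<dots> \<triangleq> c \<odot>\<^sub>m (lay a f b \<circ>\<^sub>m x)"
    using wf ScaleM.prems by (intro meq.comp_scale_left) (auto simp: terms_def)
  finally show ?case by (rule span_equ[rotated]) (use ScaleM in \<open>auto intro!: span_scale\<close>)
qed

text \<open>A term equals itself applied to an identity, and an identity is a normal form.\<close>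

theorem span_terms:
  assumes "f \<in> terms R k l" shows "span k l f"
proof -
  have wf: "wf_term R f" "src f = k" "tgt f = l" using assms by (auto simp: terms_def)
  have "span k k (IdM k)" using span_nf[OF nf_id[of k]] by simp
  then have "span k l (lay 0 f 0 \<circ>\<^sub>m IdM k)" using span_lay[OF wf(1), of k 0 0 "IdM k"] wf by simp
  moreover have "lay 0 f 0 \<circ>\<^sub>m IdM k \<triangleq> lay 0 f 0" using wf by (intro equ_id_right) auto
  moreover have "lay 0 f 0 \<triangleq> f"
    unfolding lay_def using wf by (intro equ_trans[OF meq.tens_unit_right meq.tens_unit_left]) auto
  ultimately show ?thesis by (blast intro: span_equ meq.sym)
qed

end

section \<open>Non-crossing matchings and normal forms\<close>

subsection \<open>Non-crossing matchings\<close>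

text \<open>Runs around the boundary of the rectangle, along the top row from right to left and then
  along the bottom row from left to right, with the cut on the right-hand side. Crossings then
  become interlacing pairs in a linear order.\<close>

fun pos :: "vertex \<Rightarrow> int" where
  "pos (Bot i) = int i"
| "pos (Top j) = - int j"

definition noncrossing :: "diagram \<Rightarrow> bool" where
  "noncrossing D \<longleftrightarrow>
    \<not> (\<exists>a b c d. {a, c} \<in> D \<and> {b, d} \<in> D \<and> pos a < pos b \<and> pos b < pos c \<and> pos c < pos d)"

definition matchings :: "nat \<Rightarrow> nat \<Rightarrow> diagram set" where
  "matchings k l = {D \<in> partitions k l. noncrossing D \<and> (\<forall>B\<in>D. card B \<le> 2)}"

lemma noncrossingD:
  "noncrossing D \<Longrightarrow> {a, c} \<in> D \<Longrightarrow> {b, d} \<in> D \<Longrightarrow> pos a < pos b \<Longrightarrow> pos b < pos c \<Longrightarrow> pos c < pos d \<Longrightarrow> False"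
  unfolding noncrossing_def by blast

lemma pos_flip_vertex [simp]: "pos (flip_vertex v) = - pos v"
  by (cases v) auto

lemma flip_diagram_mem: "flip_vertex ` B \<in> flip_diagram D \<longleftrightarrow> B \<in> D"
  unfolding flip_diagram_def using inj_flip_vertex[of UNIV] by (auto simp: inj_image_eq_iff)

lemma flip_diagram_pair: "{u, v} \<in> flip_diagram D \<longleftrightarrow> {flip_vertex u, flip_vertex v} \<in> D"
  using flip_diagram_mem[of "{flip_vertex u, flip_vertex v}" D] by simp

lemma flip_matchings: "D \<in> matchings k l \<Longrightarrow> flip_diagram D \<in> matchings l k"
proof -
  assume D: "D \<in> matchings k l"
  have "noncrossing (flip_diagram D)" unfolding noncrossing_def
  proof clarify
    fix a b c d
    assume "{a, c} \<in> flip_diagram D" "{b, d} \<in> flip_diagram D" "pos a < pos b" "pos b < pos c" "pos c < pos d"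
    then have "{flip_vertex d, flip_vertex b} \<in> D" "{flip_vertex c, flip_vertex a} \<in> D"
      by (simp_all add: flip_diagram_pair insert_commute)
    from noncrossingD[OF _ this] D \<open>pos a < pos b\<close> \<open>pos b < pos c\<close> \<open>pos c < pos d\<close>
    show False by (simp add: matchings_def)
  qed
  then show ?thesis
    using D flip_diagram_closed by (auto simp: matchings_def flip_diagram_def card_image inj_flip_vertex)
qed

section \<open>Inserting a block into the top row of a matching\<close>

lemma inj_shift_top: "inj (shift_top a r)"
proof (rule injI)
  show "u = v" if "shift_top a r u = shift_top a r v" for u v
    using that by (cases u; cases v) (auto split: if_splits)
qed

lemma pos_shift_top: "pos (shift_top a r u) < pos (shift_top a r v) \<longleftrightarrow> pos u < pos v"
  by (cases u; cases v) auto

lemma range_shift_top: "v \<in> range (shift_top a r) \<longleftrightarrow> v \<notin> Top ` {Suc a..a + r}"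
proof (cases v)
  case (Bot i)
  then show ?thesis by (auto intro: range_eqI[of _ _ "Bot i"])
next
  case (Top j)
  have "Top j \<notin> range (shift_top a r)" if "Suc a \<le> j" "j \<le> a + r"
  proof
    assume "Top j \<in> range (shift_top a r)"
    then obtain u where "Top j = shift_top a r u" by blast
    with that show False by (cases u) (auto split: if_splits)
  qed
  moreover have "Top j \<in> range (shift_top a r)" if "j \<le> a"
    using that by (intro range_eqI[of _ _ "Top j"]) auto
  moreover have "Top j \<in> range (shift_top a r)" if "j > a + r"
    using that by (intro range_eqI[of _ _ "Top (j - r)"]) auto
  ultimately show ?thesis using Top by fastforce
qed

lemma shift_top_vimage: "a + r \<le> l \<Longrightarrow> shift_top a r -` vertices k l = vertices k (l - r)"
proof (rule Set.set_eqI)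
  show "v \<in> shift_top a r -` vertices k l \<longleftrightarrow> v \<in> vertices k (l - r)" if "a + r \<le> l" for v
    using that by (cases v) auto
qed

lemma insert_top_shift_mem:
  "shift_top a r ` B \<in> insert_top a r D \<longleftrightarrow> B \<in> D" if "B \<noteq> {}"
proof -
  have "shift_top a r ` B \<noteq> Top ` {Suc a..a + r}"
    using that range_shift_top[of _ a r] by blast
  then show ?thesis unfolding insert_top_def using inj_shift_top by (auto simp: inj_image_eq_iff)
qed

lemma insert_top_pairD:
  assumes "{shift_top a r u, v} \<in> insert_top a r D"
  obtains w where "v = shift_top a r w" "{u, w} \<in> D"
proof -
  have "shift_top a r u \<notin> Top ` {Suc a..a + r}" using range_shift_top[of _ a r] by blast
  then have "{shift_top a r u, v} \<noteq> Top ` {Suc a..a + r}" by blast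
  then obtain B where B: "B \<in> D" "{shift_top a r u, v} = shift_top a r ` B"
    using assms unfolding insert_top_def by auto
  then obtain w where w: "v = shift_top a r w" by blast
  have "shift_top a r ` B = shift_top a r ` {u, w}" using B(2) w by simp
  then have "B = {u, w}" using inj_shift_top by (metis inj_image_eq_iff)
  with that B(1) w show thesis by blast
qed

lemma insert_top_pair:
  "{shift_top a r u, shift_top a r w} \<in> insert_top a r D \<longleftrightarrow> {u, w} \<in> D"
  using insert_top_shift_mem[of "{u, w}" a r D] by simp

lemma insert_top_closed:
  assumes D: "D \<in> partitions k l" and a: "a \<le> l" "0 < r"
  shows "insert_top a r D \<in> partitions k (l + r)"
proof -
  have P: "partition_on (shift_top a r ` vertices k l) ((`) (shift_top a r) ` D)"
    using D by (auto simp: partitions_def intro!: partition_on_image_inj inj_on_subset[OF inj_shift_top])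
  have "shift_top a r -` vertices k (l + r) = vertices k l" using shift_top_vimage[of a r "l + r" k] a by simp
  then have "shift_top a r ` vertices k l = vertices k (l + r) \<inter> range (shift_top a r)"
    using image_vimage_eq[of "shift_top a r" "vertices k (l + r)"] by simp
  moreover have "Top ` {Suc a..a + r} \<subseteq> vertices k (l + r)"
    using a by auto
  moreover have "range (shift_top a r) = - Top ` {Suc a..a + r}"
    using range_shift_top[of _ a r] by (intro Set.set_eqI) simp
  ultimately have "vertices k (l + r) = shift_top a r ` vertices k l \<union> Top ` {Suc a..a + r}"
    "shift_top a r ` vertices k l \<inter> Top ` {Suc a..a + r} = {}"
    by auto
  moreover have "Top ` {Suc a..a + r} \<noteq> {}" using a by simp
  ultimately show ?thesis
    using P disjoint_union[of "(`) (shift_top a r) ` D" "{Top ` {Suc a..a + r}}"]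
    unfolding partitions_def insert_top_def partition_on_def by auto
qed

lemma insert_top_new_pair:
  assumes "{u, v} \<in> insert_top a r D" "u \<notin> range (shift_top a r)"
  shows "{u, v} = Top ` {Suc a..a + r}"
  using assms unfolding insert_top_def by blast

text \<open>\<open>shift_top\<close> preserves the order given by \<open>pos\<close>, so old pairs
  cross only if they did before. A new pair occupies neighbouring positions, and nothing can lie
  between its ends.\<close>

lemma insert_top_matchings:
  assumes D: "D \<in> matchings k l" and a: "a \<le> l"
  shows "insert_top a (width c) D \<in> matchings k (l + width c)"
proof -
  let ?s = "shift_top a (width c)" and ?N = "Top ` {Suc a..a + width c}"
  have part: "insert_top a (width c) D \<in> partitions k (l + width c)"
    using D a by (intro insert_top_closed) (auto simp: matchings_def)
  have adjacent: False if "u \<in> ?N" "v \<in> ?N" "pos u < pos w" "pos w < pos v" for u v w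
    using that by (cases w) (auto split: if_splits)
  have "noncrossing (insert_top a (width c) D)" unfolding noncrossing_def
  proof clarify
    fix u v w x
    assume uw: "{u, w} \<in> insert_top a (width c) D" and vx: "{v, x} \<in> insert_top a (width c) D"
      and p: "pos u < pos v" "pos v < pos w" "pos w < pos x"
    show False
    proof (cases "u \<in> range ?s \<and> v \<in> range ?s")
      case True
      then obtain u' v' where u: "u = ?s u'" and v: "v = ?s v'" by blast
      from uw obtain w' where w: "w = ?s w'" "{u', w'} \<in> D" unfolding u by (rule insert_top_pairD)
      from vx obtain x' where x: "x = ?s x'" "{v', x'} \<in> D" unfolding v by (rule insert_top_pairD)
      have "noncrossing D" using D by (simp add: matchings_def)
      from noncrossingD[OF this w(2) x(2)] p show False unfolding u v w x pos_shift_top by blast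
    next
      case False
      then have "{u, w} = ?N \<or> {v, x} = ?N" using insert_top_new_pair uw vx by blast
      then show False
      proof
        assume "{u, w} = ?N"
        then have "u \<in> ?N" "w \<in> ?N" by blast+
        then show False using adjacent p by blast
      next
        assume "{v, x} = ?N"
        then have "v \<in> ?N" "x \<in> ?N" by blast+
        then show False using adjacent p by blast
      qed
    qed
  qed
  moreover have "card B \<le> 2" if "B \<in> insert_top a (width c) D" for B
  proof -
    have "card (?s ` C) \<le> 2" if "C \<in> D" for C
      using that D inj_on_subset[OF inj_shift_top] by (subst card_image) (auto simp: matchings_def)
    moreover have "card ?N \<le> 2" by (subst card_image) (auto simp: inj_on_def)
    ultimately show ?thesis using that unfolding insert_top_def by blast
  qed
  ultimately show ?thesis using part by (simp add: matchings_def)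
qed

lemma insert_bot_matchings:
  assumes "D \<in> matchings k l" "a \<le> k"
  shows "insert_bot a (width c) D \<in> matchings (k + width c) l"
  unfolding insert_bot_def by (intro flip_matchings insert_top_matchings assms)

lemma id_diagram_matchings: "id_diagram m \<in> matchings m m"
proof -
  have "noncrossing (id_diagram m)" unfolding noncrossing_def
  proof clarify
    fix a b c d assume "{a, c} \<in> id_diagram m" "{b, d} \<in> id_diagram m"
      "pos a < pos b" "pos b < pos c" "pos c < pos d"
    then show False by (auto simp: id_diagram_image doubleton_eq_iff)
  qed
  moreover have "card B \<le> 2" if "B \<in> id_diagram m" for B
    using that by (auto simp: id_diagram_image)
  ultimately show ?thesis by (simp add: matchings_def)
qed

subsection \<open>Reading the words off the diagram\<close>

text \<open>\<open>X\<close> is \<open>Bot\<close> or \<open>Top\<close>, so that one definition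
  reads both rows. In either row the opening letter is at the smaller index, although
  \<open>pos\<close> runs backwards along the top.\<close>

definition letter_at :: "(nat \<Rightarrow> vertex) \<Rightarrow> diagram \<Rightarrow> nat \<Rightarrow> letter" where
  "letter_at X D j = (if {X j} \<in> D then Single else if \<exists>j'>j. {X j, X j'} \<in> D then Opening
     else if \<exists>j'<j. {X j, X j'} \<in> D then Closing else Through)"

definition word :: "(nat \<Rightarrow> vertex) \<Rightarrow> diagram \<Rightarrow> nat \<Rightarrow> letter list" where
  "word X D n = map (letter_at X D) [1..<Suc n]"

lemma length_word [simp]: "length (word X D n) = n"
  by (simp add: word_def)

lemma letter_at_flip: "letter_at Top (flip_diagram D) = letter_at Bot D" "letter_at Bot (flip_diagram D) = letter_at Top D"
  using flip_diagram_pair[of "Top _" "Top _"] flip_diagram_pair[of "Bot _" "Bot _"]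
    flip_diagram_mem[of "{Bot _}"] flip_diagram_mem[of "{Top _}"]
  by (auto simp: letter_at_def fun_eq_iff)

lemma word_flip: "word Top (flip_diagram D) = word Bot D" "word Bot (flip_diagram D) = word Top D"
  by (simp_all add: word_def letter_at_flip fun_eq_iff)

lemma letter_at_insert_top_Bot: "letter_at Bot (insert_top a r D) j = letter_at Bot D j"
proof -
  have "{Bot j} \<in> insert_top a r D \<longleftrightarrow> {Bot j} \<in> D"
    using insert_top_shift_mem[of "{Bot j}" a r D] by simp
  moreover have "{Bot j, Bot j'} \<in> insert_top a r D \<longleftrightarrow> {Bot j, Bot j'} \<in> D" for j'
    using insert_top_pair[of a r "Bot j" "Bot j'" D] by simp
  ultimately show ?thesis unfolding letter_at_def by (simp only:)
qed

lemma letter_at_insert_top_Top: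
  "letter_at Top (insert_top a r D) (if j \<le> a then j else j + r) = letter_at Top D j"
proof -
  let ?f = "\<lambda>j. if j \<le> a then j else j + r"
  have single: "{Top (?f j)} \<in> insert_top a r D \<longleftrightarrow> {Top j} \<in> D"
    using insert_top_shift_mem[of "{Top j}" a r D] by simp
  have pair: "{Top (?f j), Top j'} \<in> insert_top a r D \<longleftrightarrow> (\<exists>i. j' = ?f i \<and> {Top j, Top i} \<in> D)" for j'
  proof
    assume "{Top (?f j), Top j'} \<in> insert_top a r D"
    then have "{shift_top a r (Top j), Top j'} \<in> insert_top a r D" by simp
    then obtain w where w: "Top j' = shift_top a r w" "{Top j, w} \<in> D" by (rule insert_top_pairD)
    then show "\<exists>i. j' = ?f i \<and> {Top j, Top i} \<in> D" by (cases w) auto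
  next
    assume "\<exists>i. j' = ?f i \<and> {Top j, Top i} \<in> D"
    then obtain i where "j' = ?f i" "{Top j, Top i} \<in> D" by blast
    then show "{Top (?f j), Top j'} \<in> insert_top a r D" using insert_top_pair[of a r "Top j" "Top i" D] by simp
  qed
  have mono: "?f i < ?f j \<longleftrightarrow> i < j" for i j by auto
  have up: "(\<exists>j'>?f j. {Top (?f j), Top j'} \<in> insert_top a r D) \<longleftrightarrow> (\<exists>j'>j. {Top j, Top j'} \<in> D)"
    unfolding pair using mono by blast
  have down: "(\<exists>j'<?f j. {Top (?f j), Top j'} \<in> insert_top a r D) \<longleftrightarrow> (\<exists>j'<j. {Top j, Top j'} \<in> D)"
    unfolding pair using mono by blast
  show ?thesis unfolding letter_at_def single up down ..
qed

lemma word_insert_top: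
  assumes "length u + length v = l" "word Top D l = u @ v"
  shows "word Top (insert_top (length u) (width c) D) (l + width c) = u @ block c @ v"
proof (rule nth_equalityI)
  let ?a = "length u" and ?D = "insert_top (length u) (width c) D"
  fix i assume "i < length (word Top ?D (l + width c))"
  then have i: "i < l + width c" by simp
  then have nth: "word Top ?D (l + width c) ! i = letter_at Top ?D (Suc i)"
    by (simp add: word_def del: upt_Suc)
  have old: "letter_at Top D (Suc j) = (u @ v) ! j" if "j < l" for j
    unfolding assms(2)[symmetric] using that by (simp add: word_def del: upt_Suc)
  consider "i < ?a" | "?a + width c \<le> i" | "?a \<le> i" "i < ?a + width c" by linarith
  then show "word Top ?D (l + width c) ! i = (u @ block c @ v) ! i"
  proof cases
    case 1
    then show ?thesis unfolding nth
      using letter_at_insert_top_Top[of ?a "width c" D "Suc i"] old[of i] assms(1)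
      by (simp add: nth_append)
  next
    case 2
    define j where "j = i - width c"
    have j: "i = j + width c" "?a \<le> j" "j < l" using 2 i by (auto simp: j_def)
    have "letter_at Top ?D (Suc i) = letter_at Top D (Suc j)"
      using letter_at_insert_top_Top[of ?a "width c" D "Suc j"] j by simp
    moreover obtain m where "j = ?a + m" using j(2) le_Suc_ex by blast
    ultimately show ?thesis unfolding nth using old[of j] j by (cases c) (simp_all add: nth_append)
  next
    case 3
    have new: "Top ` {Suc ?a..?a + width c} \<in> ?D" by (simp add: insert_top_def)
    have not_range: "Top (Suc i) \<notin> range (shift_top ?a (width c))"
      using 3 range_shift_top[of "Top (Suc i)" ?a "width c"] by auto
    then have only: "{Top (Suc i), w} = Top ` {Suc ?a..?a + width c}" if "{Top (Suc i), w} \<in> ?D" for w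
      using insert_top_new_pair that by blast
    show ?thesis
    proof (cases c)
      case False
      then have "i = ?a" using 3 by simp
      then show ?thesis unfolding nth using new False by (simp add: letter_at_def)
    next
      case True
      have "{Suc ?a..?a + 2} = {Suc ?a, Suc (Suc ?a)}" by auto
      then have N: "Top ` {Suc ?a..?a + width c} = {Top (Suc ?a), Top (Suc (Suc ?a))}" using True by simp
      have single: "{Top (Suc i)} \<notin> ?D" using only[of "Top (Suc i)"] unfolding N by auto
      have pair: "{Top (Suc i), Top j} \<in> ?D \<longleftrightarrow> {Top (Suc i), Top j} = {Top (Suc ?a), Top (Suc (Suc ?a))}" for j
        using only[of "Top j"] new unfolding N by metis
      have "i = ?a \<or> i = Suc ?a" using 3 True by auto
      then show ?thesis unfolding nth letter_at_def pair using single True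
        by (elim disjE) (simp_all add: doubleton_eq_iff nth_append)
    qed
  qed
qed (use assms(1) in simp)

lemma word_insert_top_Bot: "word Bot (insert_top a r D) k = word Bot D k"
  by (simp add: word_def letter_at_insert_top_Bot)

text \<open>The words of a normal form can be recovered from its diagram. Together with
  \<open>nf_unique\<close> this makes normal forms with the same diagram equal as morphisms.\<close>

lemma nf_diagram:
  "nf z w w' D \<Longrightarrow> D \<in> matchings (length w') (length w) \<and> w = word Top D (length w) \<and> w' = word Bot D (length w')"
proof (induction rule: nf.induct)
  case (nf_id m)
  have "letter_at Top (id_diagram m) = (\<lambda>_. Through)" "letter_at Bot (id_diagram m) = (\<lambda>_. Through)"
    by (auto simp: letter_at_def id_diagram_image fun_eq_iff doubleton_eq_iff)
  then show ?case using id_diagram_matchings by (simp add: word_def map_replicate_const)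
next
  case (nf_top z u v w D c)
  then show ?case
    using insert_top_matchings[of D "length w" "length u + length v" "length u" c]
      word_insert_top[of u v "length u + length v" D c]
    by (simp add: word_insert_top_Bot add_ac del: if_split)
next
  case (nf_bot z w u v D c)
  then show ?case
    using insert_bot_matchings[of D "length u + length v" "length w" "length u" c]
      word_insert_top[of u v "length u + length v" "flip_diagram D" c]
    by (simp add: word_flip insert_bot_def word_insert_top_Bot add_ac del: if_split flip: word_flip(2))
qed

subsection \<open>Every non-crossing matching has a normal form\<close>

text \<open>The block at the removed positions has empty preimage under \<open>shift_top\<close>,
  which is why the empty set is discarded.\<close>

definition remove_top :: "nat \<Rightarrow> nat \<Rightarrow> diagram \<Rightarrow> diagram" where
  "remove_top a r D = (-`) (shift_top a r) ` D - {{}}"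

lemma insert_remove_top:
  assumes D: "D \<in> partitions k l" and N: "Top ` {Suc a..a + r} \<in> D"
  shows "insert_top a r (remove_top a r D) = D"
proof -
  let ?s = "shift_top a r" and ?N = "Top ` {Suc a..a + r}"
  have disj: "B \<inter> ?N = {}" "B \<noteq> {}" if "B \<in> D" "B \<noteq> ?N" for B
    using D N that unfolding partitions_def partition_on_def disjoint_def by auto
  have range: "range ?s = - ?N" using range_shift_top[of _ a r] by (intro Set.set_eqI) simp
  have old: "?s ` (?s -` B) = B" if "B \<in> D" "B \<noteq> ?N" for B
    using disj[OF that] unfolding image_vimage_eq range by blast
  have N': "?s -` ?N = {}" using range by blast
  have "(`) ?s ` remove_top a r D = D - {?N}"
  proof
    show "(`) ?s ` remove_top a r D \<subseteq> D - {?N}"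
    proof
      fix C assume "C \<in> (`) ?s ` remove_top a r D"
      then obtain B where B: "B \<in> D" "?s -` B \<noteq> {}" "C = ?s ` (?s -` B)" by (auto simp: remove_top_def)
      then have "B \<noteq> ?N" using N' by blast
      then show "C \<in> D - {?N}" using old B by auto
    qed
    show "D - {?N} \<subseteq> (`) ?s ` remove_top a r D"
    proof
      fix B assume B: "B \<in> D - {?N}"
      then have e: "?s ` (?s -` B) = B" and "B \<noteq> {}" using old[of B] disj(2)[of B] by blast+
      then have "?s -` B \<noteq> {}" by (metis image_empty)
      then have "?s -` B \<in> remove_top a r D" unfolding remove_top_def using B by blast
      then show "B \<in> (`) ?s ` remove_top a r D" using e by (metis imageI)
    qed
  qed
  then show ?thesis using insert_Diff[OF N] by (simp add: insert_top_def)
qed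

lemma remove_top_matchings:
  assumes D: "D \<in> matchings k l" and N: "Top ` {Suc a..a + r} \<in> D" and a: "a + r \<le> l"
  shows "remove_top a r D \<in> matchings k (l - r)"
proof -
  have P: "D \<in> partitions k l" and nc: "noncrossing D" and card: "\<And>B. B \<in> D \<Longrightarrow> card B \<le> 2"
    using D by (auto simp: matchings_def)
  have ins: "insert_top a r (remove_top a r D) = D" using P N by (rule insert_remove_top)
  have "remove_top a r D \<in> partitions k (l - r)"
    using P partition_on_vimage[of "vertices k l" D "shift_top a r"] shift_top_vimage[OF a, of k]
    by (simp add: partitions_def remove_top_def)
  moreover have "noncrossing (remove_top a r D)" unfolding noncrossing_def
  proof clarify
    fix u v w x assume "{u, w} \<in> remove_top a r D" "{v, x} \<in> remove_top a r D"
      and p: "pos u < pos v" "pos v < pos w" "pos w < pos x"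
    then have "{shift_top a r u, shift_top a r w} \<in> D" "{shift_top a r v, shift_top a r x} \<in> D"
      using insert_top_pair[of a r _ _ "remove_top a r D"] unfolding ins by simp_all
    from noncrossingD[OF nc this] p show False by (simp add: pos_shift_top)
  qed
  moreover have "card B \<le> 2" if "B \<in> remove_top a r D" for B
  proof -
    have "B \<noteq> {}" using that by (simp add: remove_top_def)
    then have "card (shift_top a r ` B) \<le> 2" using insert_top_shift_mem[of B a r "remove_top a r D"] that card
      unfolding ins by simp
    then show ?thesis using card_image[OF inj_on_subset[OF inj_shift_top]] by (metis subset_UNIV)
  qed
  ultimately show ?thesis by (simp add: matchings_def)
qed

lemma partitions_disjoint:
  "D \<in> partitions k l \<Longrightarrow> B \<in> D \<Longrightarrow> C \<in> D \<Longrightarrow> v \<in> B \<Longrightarrow> v \<in> C \<Longrightarrow> B = C"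
  unfolding partitions_def partition_on_def disjoint_def by auto

lemma partitions_block:
  "D \<in> partitions k l \<Longrightarrow> v \<in> vertices k l \<Longrightarrow> \<exists>B\<in>D. v \<in> B"
  unfolding partitions_def partition_on_def by auto

lemma partitions_vertices:
  "D \<in> partitions k l \<Longrightarrow> B \<in> D \<Longrightarrow> v \<in> B \<Longrightarrow> v \<in> vertices k l"
  unfolding partitions_def partition_on_def by auto

lemma matchings_cases:
  assumes D: "D \<in> matchings k l" and v: "v \<in> vertices k l"
  obtains "{v} \<in> D" | w where "w \<noteq> v" "{v, w} \<in> D"
proof -
  have P: "D \<in> partitions k l" using D by (simp add: matchings_def)
  obtain B where B: "B \<in> D" "v \<in> B" using partitions_block[OF P v] by blast
  show thesis
  proof (cases "B = {v}")
    case True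
    then show thesis using that B by blast
  next
    case False
    then obtain w where w: "w \<in> B" "w \<noteq> v" using B by blast
    have "finite B" using finite_subset[of B "vertices k l"] partitions_vertices[OF P B(1)] by auto
    moreover have "card B \<le> 2" using D B by (simp add: matchings_def)
    ultimately have "{v, w} = B" using w B by (intro card_seteq) auto
    then show thesis using that w B by blast
  qed
qed

text \<open>An innermost arc of the top row encloses an isolated vertex or nothing at all.\<close>

lemma removable_block:
  assumes D: "D \<in> matchings k l" and row: "\<exists>B\<in>D. B \<subseteq> range Top"
  shows "\<exists>a c. a + width c \<le> l \<and> Top ` {Suc a..a + width c} \<in> D"
proof (cases "\<exists>j. {Top j} \<in> D")
  case True
  then obtain j where j: "{Top j} \<in> D" by blast
  then have "1 \<le> j" "j \<le> l" using D partitions_vertices[of D k l "{Top j}" "Top j"] by (auto simp: matchings_def)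
  then have "j - 1 + width False \<le> l \<and> Top ` {Suc (j - 1)..j - 1 + width False} \<in> D" using j by simp
  then show ?thesis by blast
next
  case False
  have P: "D \<in> partitions k l" and nc: "noncrossing D" using D by (auto simp: matchings_def)
  obtain B v where B: "B \<in> D" "B \<subseteq> range Top" "v \<in> B"
    using row P unfolding partitions_def partition_on_def by (metis (no_types, lifting) ex_in_conv mem_Collect_eq)
  then obtain j where j: "v = Top j" by blast
  have "\<exists>i j. i < j \<and> {Top i, Top j} \<in> D"
  proof (cases rule: matchings_cases[OF D partitions_vertices[OF P B(1,3)]])
    case 1
    then show ?thesis using False j by blast
  next
    case (2 w)
    then have "{v, w} = B" using partitions_disjoint[OF P _ B(1) _ B(3)] by blast
    then obtain i where "w = Top i" using B by blast
    then show ?thesis using 2 j by (metis insert_commute linorder_neqE_nat)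
  qed
  then obtain n where "\<exists>i. {Top i, Top (i + Suc n)} \<in> D" by (metis less_iff_Suc_add add_Suc_right)
  \<comment> \<open>An arc of minimal span; \<open>n\<close> counts the vertices strictly between
    its ends.\<close>
  from exists_least_iff[THEN iffD1, OF exI[of "\<lambda>n. \<exists>i. {Top i, Top (i + Suc n)} \<in> D", OF this]]
  obtain n i where ni: "{Top i, Top (i + Suc n)} \<in> D"
    and min: "\<And>m j. m < n \<Longrightarrow> {Top j, Top (j + Suc m)} \<notin> D" by blast
  have i: "1 \<le> i" "i + Suc n \<le> l"
    using partitions_vertices[OF P ni, of "Top i"] partitions_vertices[OF P ni, of "Top (i + Suc n)"] by auto
  have "n = 0"
  proof (rule ccontr)
    assume n: "n \<noteq> 0"
    \<comment> \<open>The first vertex under the arc. It is not isolated, so it has a partner: one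
      outside would give a crossing with the arc, one inside a shorter arc.\<close>
    let ?v = "Top (Suc i)"
    have "?v \<in> vertices k l" using i by simp
    from D this show False
    proof (cases rule: matchings_cases)
      case 1
      then show ?thesis using False by blast
    next
      case w: (2 w)
      have ne: "w \<noteq> Top i" "w \<noteq> Top (i + Suc n)"
        using partitions_disjoint[OF P w(2) ni, of w] n by (auto simp: doubleton_eq_iff)
      have crossing: "pos (Top (i + Suc n)) < pos ?v" "pos ?v < pos (Top i)" using n by auto
      show ?thesis
      proof (cases w)
        case (Bot b)
        have "b \<ge> 1" using partitions_vertices[OF P w(2), of w] Bot by simp
        then show ?thesis
          using noncrossingD[OF nc _ w(2), of "Top (i + Suc n)" "Top i"] ni crossing Bot i by (simp add: insert_commute)
      next
        case (Top j)
        consider "j < i" | "Suc i < j" "j < i + Suc n" | "i + Suc n < j" using Top ne w(1) by fastforce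
        then show ?thesis
        proof cases
          case 1
          then show ?thesis
            using noncrossingD[OF nc _ w(2), of "Top (i + Suc n)" "Top i"] ni crossing Top by (simp add: insert_commute)
        next
          case between: 2
          define m where "m = j - Suc (Suc i)"
          have "m < n" "j = Suc i + Suc m" using between by (auto simp: m_def)
          then show ?thesis using min[of m "Suc i"] w(2) Top by simp
        next
          case 3
          have "{w, ?v} \<in> D" "{Top (i + Suc n), Top i} \<in> D" using w(2) ni by (simp_all add: insert_commute)
          from noncrossingD[OF nc this] 3 crossing Top show ?thesis by simp
        qed
      qed
    qed
  qed
  moreover have "{Suc (i - 1)..i - 1 + 2} = {i, Suc i}" using i by auto
  ultimately have "i - 1 + width True \<le> l \<and> Top ` {Suc (i - 1)..i - 1 + width True} \<in> D" using ni i by simp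
  then show ?thesis by blast
qed

text \<open>Every block joins the two rows, which gives a bijection \<open>f\<close> from the bottom
  row to the top row. A descent of \<open>f\<close> would be a crossing, so \<open>f\<close> is
  increasing and therefore the identity.\<close>

lemma no_row_block_imp_id:
  assumes D: "D \<in> matchings k l"
    and row: "\<And>B. B \<in> D \<Longrightarrow> \<not> B \<subseteq> range Top" "\<And>B. B \<in> D \<Longrightarrow> \<not> B \<subseteq> range Bot"
  shows "k = l \<and> D = id_diagram k"
proof -
  have P: "D \<in> partitions k l" and nc: "noncrossing D" using D by (auto simp: matchings_def)
  have bot: "\<exists>j\<in>{1..l}. {Bot i, Top j} \<in> D" if "i \<in> {1..k}" for i
  proof -
    have "Bot i \<in> vertices k l" using that by simp
    from D this show ?thesis
    proof (cases rule: matchings_cases)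
      case 1
      then show ?thesis using row(2) by blast
    next
      case (2 w)
      then have "\<not> {Bot i, w} \<subseteq> range Bot" using row(2) by blast
      then obtain j where j: "w = Top j" by (cases w) auto
      then have "j \<in> {1..l}" using partitions_vertices[OF P 2(2), of w] by simp
      then show ?thesis using 2 j by blast
    qed
  qed
  have top: "\<exists>i\<in>{1..k}. {Bot i, Top j} \<in> D" if "j \<in> {1..l}" for j
  proof -
    have "Top j \<in> vertices k l" using that by simp
    from D this show ?thesis
    proof (cases rule: matchings_cases)
      case 1
      then show ?thesis using row(1) by blast
    next
      case (2 w)
      then have "\<not> {Top j, w} \<subseteq> range Top" using row(1) by blast
      then obtain i where i: "w = Bot i" by (cases w) auto
      then have "i \<in> {1..k}" using partitions_vertices[OF P 2(2), of w] by simp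
      then show ?thesis using 2 i by (auto simp: insert_commute)
    qed
  qed
  from bot obtain f where f: "\<And>i. i \<in> {1..k} \<Longrightarrow> f i \<in> {1..l} \<and> {Bot i, Top (f i)} \<in> D" by metis
  have unique: "j = f i" if "i \<in> {1..k}" "{Bot i, Top j} \<in> D" for i j
    using partitions_disjoint[OF P that(2), of _ "Bot i"] f[OF that(1)] by (auto simp: doubleton_eq_iff)
  have surj: "f ` {1..k} = {1..l}"
  proof
    show "f ` {1..k} \<subseteq> {1..l}" using f by blast
    show "{1..l} \<subseteq> f ` {1..k}"
    proof
      fix j assume "j \<in> {1..l}"
      from top[OF this] obtain i where i: "i \<in> {1..k}" "{Bot i, Top j} \<in> D" by blast
      from unique[OF this] show "j \<in> f ` {1..k}" using i(1) by (rule image_eqI)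
    qed
  qed
  have inj: "inj_on f {1..k}"
  proof (rule inj_onI)
    fix i i' assume i: "i \<in> {1..k}" "i' \<in> {1..k}" "f i = f i'"
    then have "{Bot i, Top (f i)} \<in> D" "{Bot i', Top (f i)} \<in> D" using f[of i] f[of i'] by auto
    from partitions_disjoint[OF P this, of "Top (f i)"] show "i = i'" by (auto simp: doubleton_eq_iff)
  qed
  have mono: "f i < f i'" if i: "i \<in> {1..k}" "i' \<in> {1..k}" "i < i'" for i i'
  proof (rule ccontr)
    assume "\<not> f i < f i'"
    moreover have "f i \<noteq> f i'" using inj i by (auto dest: inj_onD)
    ultimately have "f i' < f i" by simp
    moreover have "{Top (f i), Bot i} \<in> D" "{Top (f i'), Bot i'} \<in> D" using f i by (auto simp: insert_commute)
    moreover have "0 < f i'" "0 < i" using f[of i'] i by auto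
    ultimately show False using noncrossingD[OF nc, of "Top (f i)" "Bot i" "Top (f i')" "Bot i'"] i by simp
  qed
  have fi: "f i = i" if i: "i \<in> {1..k}" for i
  proof -
    \<comment> \<open>An increasing surjection maps the initial segment up to \<open>i\<close> onto
      the one up to \<open>f i\<close>; comparing sizes gives \<open>f i = i\<close>.\<close>
    have "f ` {1..i} = {1..f i}"
    proof
      show "f ` {1..i} \<subseteq> {1..f i}"
      proof
        fix y assume "y \<in> f ` {1..i}"
        then obtain x where x: "x \<in> {1..i}" "y = f x" by blast
        moreover have "f x \<le> f i" using x i mono[of x i] by (cases "x = i") auto
        ultimately show "y \<in> {1..f i}" using f[of x] i by auto
      qed
      show "{1..f i} \<subseteq> f ` {1..i}"
      proof
        fix y assume y: "y \<in> {1..f i}"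
        then have "y \<in> {1..l}" using f[OF i] by auto
        then obtain x where x: "x \<in> {1..k}" "y = f x" using surj by blast
        have "x \<le> i" using mono[of i x] i x y by force
        then show "y \<in> f ` {1..i}" using x by auto
      qed
    qed
    then have "card (f ` {1..i}) = f i" by simp
    moreover have "card (f ` {1..i}) = i" using card_image[OF inj_on_subset[OF inj]] i by simp
    ultimately show ?thesis by simp
  qed
  have "card (f ` {1..k}) = k" using card_image[OF inj] by simp
  then have kl: "k = l" using surj by simp
  have "id_diagram k \<subseteq> D" using f fi by (auto simp: id_diagram_image)
  moreover have "D \<subseteq> id_diagram k"
  proof
    fix B assume B: "B \<in> D"
    then obtain v where v: "v \<in> B" using P unfolding partitions_def partition_on_def by (metis ex_in_conv mem_Collect_eq)
    then have "v \<in> vertices k l" using partitions_vertices[OF P B] by blast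
    then obtain C where C: "C \<in> id_diagram k" "v \<in> C"
      using partitions_block[OF id_diagram_closed[of k], of v] kl by blast
    then have "C = B" using partitions_disjoint[OF P _ B _ v] \<open>id_diagram k \<subseteq> D\<close> by blast
    then show "B \<in> id_diagram k" using C by simp
  qed
  ultimately show ?thesis using kl by blast
qed

text \<open>Removes one block from the top row, and is applied to the given diagram or to its
  reflection. The hypothesis keeps \<open>k\<close> and lowers \<open>l\<close>, so the sum of the
  two decreases in both uses.\<close>

lemma nf_exists_step:
  assumes D: "D \<in> matchings k l" and row: "\<exists>B\<in>D. B \<subseteq> range Top"
    and IH: "\<And>l' D. l' < l \<Longrightarrow> D \<in> matchings k l' \<Longrightarrow> \<exists>z w w'. nf (z :: 'a mterm) w w' D"
  shows "\<exists>z w w'. nf (z :: 'a mterm) w w' D"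
proof -
  from removable_block[OF D row] obtain a c where a: "a + width c \<le> l" and N: "Top ` {Suc a..a + width c} \<in> D"
    by blast
  let ?D = "remove_top a (width c) D"
  have D': "?D \<in> matchings k (l - width c)" using D N a by (rule remove_top_matchings)
  have "l - width c < l" using a by (cases c) auto
  from IH[OF this D'] obtain z :: "'a mterm" and w w' where nf: "nf z w w' ?D" by blast
  \<comment> \<open>The normal form comes without a prescribed type; the number of its top vertices
    is read off from the vertex set of the diagram.\<close>
  have "length w = l - width c"
  proof (rule ccontr)
    assume ne: "length w \<noteq> l - width c"
    have "partition_on (vertices (length w') (length w)) ?D" "partition_on (vertices k (l - width c)) ?D"
      using nf_diagram[OF nf] D' by (auto simp: matchings_def partitions_def)
    then have V: "vertices (length w') (length w) = vertices k (l - width c)" by (metis partition_onD1)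
    have "Top (max (length w) (l - width c)) \<in> vertices (length w') (length w) \<longleftrightarrow>
      Top (max (length w) (l - width c)) \<in> vertices k (l - width c)" unfolding V ..
    with ne show False unfolding in_vertices by (cases "length w < l - width c") auto
  qed
  then have "nf z (take a w @ drop a w) w' ?D" "length (take a w) = a" using nf a by auto
  from nf_top[OF this(1), of c] this(2) insert_remove_top[OF _ N, of k l] D show ?thesis
    by (auto simp: matchings_def)
qed

theorem nf_exists:
  "D \<in> matchings k l \<Longrightarrow> \<exists>z w w'. nf (z :: 'a mterm) w w' D"
proof (induction "k + l" arbitrary: k l D rule: less_induct)
  case less
  show ?case
  proof (cases "\<exists>B\<in>D. B \<subseteq> range Top")
    case True
    with less.prems show ?thesis by (rule nf_exists_step) (rule less.hyps, auto)
  next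
    case no_top: False
    show ?thesis
    proof (cases "\<exists>B\<in>D. B \<subseteq> range Bot")
      case True
      then obtain B where B: "B \<in> D" "B \<subseteq> range Bot" by blast
      then have "flip_vertex ` B \<in> flip_diagram D" "flip_vertex ` B \<subseteq> range Top"
        by (auto simp: flip_diagram_mem)
      then have "\<exists>B\<in>flip_diagram D. B \<subseteq> range Top" by blast
      with flip_matchings[OF less.prems] have "\<exists>z w w'. nf (z :: 'a mterm) w w' (flip_diagram D)"
        by (rule nf_exists_step) (rule less.hyps, auto)
      then show ?thesis using nf_flip by fastforce
    next
      case False
      with no_top no_row_block_imp_id[OF less.prems] have "D = id_diagram k" by blast
      then show ?thesis using nf_id by blast
    qed
  qed
qed

section \<open>The morphism module and its basis\<close>

subsection \<open>The diagram of a normal form is its image in the partition category\<close>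

definition layer :: "nat \<Rightarrow> diagram \<Rightarrow> nat \<Rightarrow> nat \<Rightarrow> nat \<Rightarrow> diagram" where
  "layer a G p q b = juxtapose (a + p) (a + q) (juxtapose a a (id_diagram a) G) (id_diagram b)"

abbreviation creator_diagram :: "bool \<Rightarrow> diagram" where
  "creator_diagram c \<equiv> (if c then cup_diagram else unit_diagram)"

lemma creator_diagram_closed: "creator_diagram c \<in> partitions 0 (width c)"
  using generator_closed by simp

lemma layer_closed: "G \<in> partitions p q \<Longrightarrow> layer a G p q b \<in> partitions (a + p + b) (a + q + b)"
  unfolding layer_def by (intro juxtapose_closed id_diagram_closed)

lemma sat_layer:
  assumes G: "G \<in> partitions p q" and x: "x1 \<in> bools a" "x \<in> bools p" "x2 \<in> bools b"
    and y: "y1 \<in> bools a" "y \<in> bools q" "y2 \<in> bools b"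
  shows "sat (layer a G p q b) (x1 @ x @ x2) (y1 @ y @ y2) \<longleftrightarrow> x1 = y1 \<and> sat G x y \<and> x2 = y2"
proof -
  have "sat (layer a G p q b) ((x1 @ x) @ x2) ((y1 @ y) @ y2) \<longleftrightarrow>
    sat (juxtapose a a (id_diagram a) G) (x1 @ x) (y1 @ y) \<and> sat (id_diagram b) x2 y2"
    unfolding layer_def using assms
    by (intro sat_juxtapose[OF juxtapose_closed[OF id_diagram_closed G] id_diagram_closed] bools_append)
  also have "\<dots> \<longleftrightarrow> (sat (id_diagram a) x1 y1 \<and> sat G x y) \<and> sat (id_diagram b) x2 y2"
    using sat_juxtapose[OF id_diagram_closed G x(1) y(1)] by simp
  finally show ?thesis using sat_id_diagram x y by simp
qed

text \<open>An inserted block forces its own colours \<open>e\<close> to agree and is invisible to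
  the rest of the diagram. In this form \<open>insert_top\<close> is compared with stacking.\<close>

lemma sat_insert_top:
  assumes D: "D \<in> partitions k (a + b)" and y: "y1 \<in> bools a" "e \<in> bools r" "y2 \<in> bools b"
  shows "sat (insert_top a r D) x (y1 @ e @ y2) \<longleftrightarrow> (\<forall>i<r. \<forall>j<r. e ! i = e ! j) \<and> sat D x (y1 @ y2)"
proof -
  let ?y = "y1 @ e @ y2" and ?s = "shift_top a r"
  have len: "length y1 = a" "length e = r" using y by (simp_all add: bools_def)
  have old: "lab x ?y (?s v) = lab x (y1 @ y2) v" if "v \<in> vertices k (a + b)" for v
  proof (cases v)
    case (Top j)
    with that have j: "1 \<le> j" "j \<le> a + b" by auto
    show ?thesis
    proof (cases "j \<le> a")
      case True
      then show ?thesis using Top j len by (auto simp: nth_append)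
    next
      case False
      then obtain m where "j = Suc (a + m)" using less_iff_Suc_add by (metis not_le)
      then show ?thesis using Top len by (auto simp: nth_append)
    qed
  qed auto
  have new: "lab x ?y (Top (Suc (a + i))) = e ! i" if "i < r" for i
    using that len by (simp add: nth_append)
  have "{Suc a..a + r} = (\<lambda>i. Suc (a + i)) ` {..<r}"
  proof
    show "{Suc a..a + r} \<subseteq> (\<lambda>i. Suc (a + i)) ` {..<r}"
    proof
      fix j assume "j \<in> {Suc a..a + r}"
      then have "j = Suc (a + (j - Suc a))" "j - Suc a \<in> {..<r}" by auto
      then show "j \<in> (\<lambda>i. Suc (a + i)) ` {..<r}" by (rule image_eqI)
    qed
  qed auto
  then have N: "Top ` {Suc a..a + r} = (\<lambda>i. Top (Suc (a + i))) ` {..<r}" by (simp add: image_image)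
  have "(\<forall>u\<in>Top ` {Suc a..a + r}. \<forall>v\<in>Top ` {Suc a..a + r}. lab x ?y u = lab x ?y v) \<longleftrightarrow>
    (\<forall>i<r. \<forall>j<r. e ! i = e ! j)"
    unfolding N ball_simps lessThan_iff[symmetric] Ball_def[symmetric]
    using new by (intro ball_cong HOL.refl) auto
  moreover have "(\<forall>B\<in>(`) ?s ` D. \<forall>u\<in>B. \<forall>v\<in>B. lab x ?y u = lab x ?y v) \<longleftrightarrow> sat D x (y1 @ y2)"
  proof -
    have "lab x ?y (?s v) = lab x (y1 @ y2) v" if "B \<in> D" "v \<in> B" for B v
      using old partitions_vertices[OF D that] by blast
    then show ?thesis unfolding sat_def by (simp cong: ball_cong)
  qed
  moreover have "sat (insert_top a r D) x ?y \<longleftrightarrow>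
      (\<forall>B\<in>(`) ?s ` D. \<forall>u\<in>B. \<forall>v\<in>B. lab x ?y u = lab x ?y v) \<and>
      (\<forall>u\<in>Top ` {Suc a..a + r}. \<forall>v\<in>Top ` {Suc a..a + r}. lab x ?y u = lab x ?y v)"
    unfolding sat_def insert_top_def ball_Un by (simp only: ball_simps simp_thms)
  ultimately show ?thesis by (simp only: conj_commute)
qed

lemma sat_creator_diagram:
  "e \<in> bools (width c) \<Longrightarrow> sat (creator_diagram c) [] e \<longleftrightarrow> (\<forall>i<width c. \<forall>j<width c. e ! i = e ! j)"
proof (cases c)
  case True
  assume "e \<in> bools (width c)"
  then obtain p q where e: "e = [p, q]" using True by (auto simp: bools_def length_Suc_conv numeral_2_eq_2)
  have "(\<forall>i<2. \<forall>j<2. [p, q] ! i = [p, q] ! j) \<longleftrightarrow> p = q"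
    by (auto simp: less_Suc_eq numeral_2_eq_2)
  then show ?thesis using True e sat_generator(4) by simp
qed (use sat_generator(1) in auto)

text \<open>An identity strand copies its colour, so the only middle row that contributes is
  \<open>y1 @ y2\<close> and the sum collapses. What remains is a matrix entry without a power of 2,
  so no closed component arises.\<close>

lemma stack_creator:
  assumes D: "D \<in> partitions k (a + b)"
  shows "stack_diagram k (a + b) (a + width c + b) (layer a (creator_diagram c) 0 (width c) b) D =
      insert_top a (width c) D \<and>
    stack_loops k (a + b) (a + width c + b) (layer a (creator_diagram c) 0 (width c) b) D = 0"
proof (rule stack_eqI_conj)
  show "layer a (creator_diagram c) 0 (width c) b \<in> partitions (a + b) (a + width c + b)"
    using layer_closed[OF creator_diagram_closed, of a c b] by simp
  show "insert_top a (width c) D \<in> partitions k (a + width c + b)"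
    using insert_top_closed[OF D, of a "width c"] by (simp add: add_ac)
  fix x y assume x: "x \<in> bools k" and "y \<in> bools (a + width c + b)"
  then obtain y1 e y2 where y: "y = y1 @ e @ y2" "y1 \<in> bools a" "e \<in> bools (width c)" "y2 \<in> bools b"
    unfolding add.assoc by (elim bools_addE) blast
  have "(\<Sum>z\<in>bools (a + b). dmat (layer a (creator_diagram c) 0 (width c) b) z y * dmat D x z) =
    (\<Sum>z\<in>bools (a + b). of_bool (z = y1 @ y2) * (of_bool (sat (creator_diagram c) [] e) * dmat D x z))"
  proof (intro sum.cong HOL.refl)
    fix z assume "z \<in> bools (a + b)"
    then obtain z1 z2 where z: "z = z1 @ z2" "z1 \<in> bools a" "z2 \<in> bools b" by (elim bools_addE)
    have len: "length z1 = length y1" using z y by (simp add: bools_def)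
    have "sat (layer a (creator_diagram c) 0 (width c) b) (z1 @ [] @ z2) (y1 @ e @ y2) \<longleftrightarrow>
        z1 = y1 \<and> sat (creator_diagram c) [] e \<and> z2 = y2"
      using y z by (intro sat_layer creator_diagram_closed) (auto simp: bools_def)
    then show "dmat (layer a (creator_diagram c) 0 (width c) b) z y * dmat D x z =
        of_bool (z = y1 @ y2) * (of_bool (sat (creator_diagram c) [] e) * dmat D x z)"
      unfolding z(1) y(1) dmat_def using len by auto
  qed
  also have "\<dots> = of_bool (sat (creator_diagram c) [] e) * dmat D x (y1 @ y2)"
    using y by (intro sum_bools_delta) auto
  also have "\<dots> = dmat (insert_top a (width c) D) x y"
    unfolding y(1) dmat_def sat_insert_top[OF D y(2,3,4)] sat_creator_diagram[OF y(3)]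
    by (rule of_bool_conj[symmetric])
  finally show "(\<Sum>z\<in>bools (a + b). dmat (layer a (creator_diagram c) 0 (width c) b) z y * dmat D x z) =
    2 ^ 0 * dmat (insert_top a (width c) D) x y" by simp
qed (fact D)

lemma flip_diagram_juxtapose:
  "flip_diagram (juxtapose k l D D') = juxtapose l k (flip_diagram D) (flip_diagram D')"
proof -
  have "flip_vertex (shift_vertex k l v) = shift_vertex l k (flip_vertex v)" for v by (cases v) auto
  then show ?thesis by (simp add: flip_diagram_def juxtapose_def image_Un image_image)
qed

lemma flip_layer: "flip_diagram (layer a G p q b) = layer a (flip_diagram G) q p b"
  by (simp add: layer_def flip_diagram_juxtapose)

lemma stack_annihilator:
  assumes D: "D \<in> partitions (a + b) l"
  shows "stack_diagram (a + width c + b) (a + b) l D (layer a (flip_diagram (creator_diagram c)) (width c) 0 b) =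
      insert_bot a (width c) D \<and>
    stack_loops (a + width c + b) (a + b) l D (layer a (flip_diagram (creator_diagram c)) (width c) 0 b) = 0"
  using flip_diagram_stack[OF layer_closed[OF creator_diagram_closed, of a c b, simplified] flip_diagram_closed[OF D]]
    stack_creator[OF flip_diagram_closed[OF D], of c]
  by (simp add: flip_layer insert_bot_def del: if_split)

context par_category
begin

lemma J_lay:
  assumes "J R t g = par_basis R G" "G \<in> partitions (src g) (tgt g)"
  shows "J R t (lay a g b) = par_basis R (layer a G (src g) (tgt g) b)"
  using assms by (simp add: lay_def layer_def par_tensor_basis)

lemma J_generators:
  "J R t (creator c) = par_basis R (creator_diagram c)"
  "J R t (annihilator c) = par_basis R (flip_diagram (creator_diagram c))"
  by (simp_all add: flip_diagram_def)

text \<open>No layer of a normal form closes a component, so no power of \<open>t\<close>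
  appears.\<close>

lemma J_nf: "nf z w w' D \<Longrightarrow> J R t z = par_basis R D"
proof (induction rule: nf.induct)
  case (nf_top z u v w D c)
  note wf = nf_wf[OF nf_top.hyps, of R]
  have D: "D \<in> partitions (length w) (length u + length v)"
    using nf_diagram[OF nf_top.hyps] by (simp add: matchings_def)
  have "J R t (lay (length u) (creator c) (length v)) =
    par_basis R (layer (length u) (creator_diagram c) 0 (width c) (length v))"
    using J_lay[OF J_generators(1), of c] creator_diagram_closed[of c] by (simp del: if_split)
  then show ?case
    using par_comp_basis[OF layer_closed[OF creator_diagram_closed] , of D "length w" "length u" "length v" c]
      stack_creator[OF D, of c] D wf nf_top.IH by (simp del: if_split)
next
  case (nf_bot z w u v D c)
  note wf = nf_wf[OF nf_bot.hyps, of R]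
  have D: "D \<in> partitions (length u + length v) (length w)"
    using nf_diagram[OF nf_bot.hyps] by (simp add: matchings_def)
  have "J R t (lay (length u) (annihilator c) (length v)) =
    par_basis R (layer (length u) (flip_diagram (creator_diagram c)) (width c) 0 (length v))"
    using J_lay[OF J_generators(2), of c] flip_diagram_closed[OF creator_diagram_closed[of c]] by (simp del: if_split)
  then show ?case
    using par_comp_basis[OF D, of "layer (length u) (flip_diagram (creator_diagram c)) (width c) 0 (length v)"
        "length u + width c + length v"] layer_closed[OF flip_diagram_closed[OF creator_diagram_closed[of c]], of "length u" "length v"]
      stack_annihilator[OF D, of c] wf nf_bot.IH by (simp del: if_split)
qed simp

subsection \<open>The module of morphisms\<close>

lemma morph_eq_iff: "wf_term R f \<Longrightarrow> morph R t g = morph R t f \<longleftrightarrow> g \<triangleq> f"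
  unfolding morph_def by (blast intro: meq.refl meq.sym meq.trans)

lemma morph_nonempty: "wf_term R f \<Longrightarrow> morph R t f \<noteq> {}"
  unfolding morph_def using meq.refl[of R f t] by (metis empty_Collect_eq)

abbreviation Hom :: "nat \<Rightarrow> nat \<Rightarrow> ('a, 'a mterm set) module" where
  "Hom \<equiv> Hom_M R t"

lemma Hom_carrier: "carrier (Hom k l) = morph R t ` terms R k l"
  by (simp add: Hom_M_def)

lemma morph_closed [simp]: "f \<in> terms R k l \<Longrightarrow> morph R t f \<in> carrier (Hom k l)"
  by (simp add: Hom_carrier)

lemma Hom_zero: "\<zero>\<^bsub>Hom k l\<^esub> = morph R t (ZeroM k l)"
  by (simp add: Hom_M_def)

lemma terms_closed [simp]:
  "ZeroM k l \<in> terms R k l"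
  "f \<in> terms R k l \<Longrightarrow> g \<in> terms R k l \<Longrightarrow> f \<oplus>\<^sub>m g \<in> terms R k l"
  "a \<in> carrier R \<Longrightarrow> f \<in> terms R k l \<Longrightarrow> a \<odot>\<^sub>m f \<in> terms R k l"
  by (simp_all add: terms_def)

text \<open>The union in \<open>Hom_M\<close> runs over all representatives. It is a single class
  because every member of the family is that class and the index sets are nonempty.\<close>

lemma Hom_add:
  assumes "f \<in> terms R k l" "g \<in> terms R k l"
  shows "morph R t f \<oplus>\<^bsub>Hom k l\<^esub> morph R t g = morph R t (f \<oplus>\<^sub>m g)"
proof -
  have wf: "wf_term R f" "wf_term R g" "src f = src g" "tgt f = tgt g" using assms by (auto simp: terms_def)
  have "morph R t (f' \<oplus>\<^sub>m g') = morph R t (f \<oplus>\<^sub>m g)" if "f' \<in> morph R t f" "g' \<in> morph R t g" for f' g'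
  proof -
    have "f \<triangleq> f'" "g \<triangleq> g'" using that by (simp_all add: morph_def)
    then have "f \<oplus>\<^sub>m g \<triangleq> f' \<oplus>\<^sub>m g'" using wf by (intro meq.cong_add)
    then show ?thesis using wf by (subst morph_eq_iff) (auto intro: meq.sym)
  qed
  then have "(\<Union>f'\<in>morph R t f. \<Union>g'\<in>morph R t g. morph R t (f' \<oplus>\<^sub>m g')) =
      (\<Union>f'\<in>morph R t f. \<Union>g'\<in>morph R t g. morph R t (f \<oplus>\<^sub>m g))"
    by (intro SUP_cong HOL.refl)
  moreover have "morph R t f \<noteq> {}" "morph R t g \<noteq> {}" using morph_nonempty wf by simp_all
  ultimately show ?thesis by (simp add: Hom_M_def)
qed

lemma Hom_smult:
  assumes "f \<in> terms R k l" "a \<in> carrier R"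
  shows "a \<odot>\<^bsub>Hom k l\<^esub> morph R t f = morph R t (a \<odot>\<^sub>m f)"
proof -
  have wf: "wf_term R f" using assms by (auto simp: terms_def)
  have "morph R t (a \<odot>\<^sub>m f') = morph R t (a \<odot>\<^sub>m f)" if "f' \<in> morph R t f" for f'
  proof -
    have "f \<triangleq> f'" using that by (simp add: morph_def)
    then have "a \<odot>\<^sub>m f \<triangleq> a \<odot>\<^sub>m f'" using assms by (intro meq.cong_scale)
    then show ?thesis using wf assms by (subst morph_eq_iff) (auto intro: meq.sym)
  qed
  then have "(\<Union>f'\<in>morph R t f. morph R t (a \<odot>\<^sub>m f')) = (\<Union>f'\<in>morph R t f. morph R t (a \<odot>\<^sub>m f))"
    by (intro SUP_cong HOL.refl)
  moreover have "morph R t f \<noteq> {}" using morph_nonempty wf by simp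
  ultimately show ?thesis by (simp add: Hom_M_def)
qed

lemma morph_eqI: "f \<triangleq> g \<Longrightarrow> morph R t f = morph R t g"
  using equ_wf by (subst morph_eq_iff) auto

lemma abelian_group_Hom: "abelian_group (Hom k l)"
proof (rule abelian_groupI)
  fix X assume "X \<in> carrier (Hom k l)"
  then obtain f where f: "f \<in> terms R k l" "X = morph R t f" by (auto simp: Hom_carrier)
  have "(\<ominus> \<one>) \<odot>\<^sub>m f \<oplus>\<^sub>m f \<triangleq> f \<oplus>\<^sub>m (\<ominus> \<one>) \<odot>\<^sub>m f" using f by (intro meq.add_comm) auto
  also have "\<dots> \<triangleq> ZeroM k l" using f by (intro meq.add_minus)
  finally have "morph R t ((\<ominus> \<one>) \<odot>\<^sub>m f) \<oplus>\<^bsub>Hom k l\<^esub> X = \<zero>\<^bsub>Hom k l\<^esub>"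
    using f by (simp add: Hom_add Hom_zero morph_eqI)
  then show "\<exists>Y\<in>carrier (Hom k l). Y \<oplus>\<^bsub>Hom k l\<^esub> X = \<zero>\<^bsub>Hom k l\<^esub>"
    using f by (intro bexI[of _ "morph R t ((\<ominus> \<one>) \<odot>\<^sub>m f)"]) auto
  have "ZeroM k l \<oplus>\<^sub>m f \<triangleq> f \<oplus>\<^sub>m ZeroM k l" using f by (intro meq.add_comm) auto
  also have "\<dots> \<triangleq> f" using f by (intro meq.add_zero)
  finally show "\<zero>\<^bsub>Hom k l\<^esub> \<oplus>\<^bsub>Hom k l\<^esub> X = X" using f by (simp add: Hom_add Hom_zero morph_eqI)
next
  fix X Y Z assume "X \<in> carrier (Hom k l)" "Y \<in> carrier (Hom k l)" "Z \<in> carrier (Hom k l)"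
  then obtain f g h where "f \<in> terms R k l" "X = morph R t f" "g \<in> terms R k l" "Y = morph R t g"
    "h \<in> terms R k l" "Z = morph R t h" by (auto simp: Hom_carrier)
  then show "X \<oplus>\<^bsub>Hom k l\<^esub> Y \<oplus>\<^bsub>Hom k l\<^esub> Z = X \<oplus>\<^bsub>Hom k l\<^esub> (Y \<oplus>\<^bsub>Hom k l\<^esub> Z)"
    by (simp add: Hom_add morph_eqI[OF meq.add_assoc])
next
  fix X Y assume "X \<in> carrier (Hom k l)" "Y \<in> carrier (Hom k l)"
  then obtain f g where fg: "f \<in> terms R k l" "X = morph R t f" "g \<in> terms R k l" "Y = morph R t g"
    by (auto simp: Hom_carrier)
  then show "X \<oplus>\<^bsub>Hom k l\<^esub> Y = Y \<oplus>\<^bsub>Hom k l\<^esub> X"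
    by (simp add: Hom_add morph_eqI[OF meq.add_comm[OF fg(1,3)]])
  from fg show "X \<oplus>\<^bsub>Hom k l\<^esub> Y \<in> carrier (Hom k l)" by (simp add: Hom_add)
qed (simp add: Hom_zero)

lemma module_Hom: "Module.module R (Hom k l)"
proof (rule moduleI)
  show "abelian_group (Hom k l)" by (rule abelian_group_Hom)
next
  fix a b X Y assume ab: "a \<in> carrier R" "b \<in> carrier R" and "X \<in> carrier (Hom k l)" "Y \<in> carrier (Hom k l)"
  then obtain f g where fg: "f \<in> terms R k l" "X = morph R t f" "g \<in> terms R k l" "Y = morph R t g"
    by (auto simp: Hom_carrier)
  then have wf: "wf_term R f" "wf_term R g" by (simp_all add: terms_def)
  show "(a \<oplus> b) \<odot>\<^bsub>Hom k l\<^esub> X = a \<odot>\<^bsub>Hom k l\<^esub> X \<oplus>\<^bsub>Hom k l\<^esub> b \<odot>\<^bsub>Hom k l\<^esub> X"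
    using ab fg morph_eqI[OF meq.scale_add_left[OF ab wf(1)]] by (simp add: Hom_add Hom_smult)
  show "a \<odot>\<^bsub>Hom k l\<^esub> (X \<oplus>\<^bsub>Hom k l\<^esub> Y) = a \<odot>\<^bsub>Hom k l\<^esub> X \<oplus>\<^bsub>Hom k l\<^esub> a \<odot>\<^bsub>Hom k l\<^esub> Y"
    using ab fg morph_eqI[OF meq.scale_add_right[OF ab(1) fg(1,3)]] by (simp add: Hom_add Hom_smult)
  show "(a \<otimes> b) \<odot>\<^bsub>Hom k l\<^esub> X = a \<odot>\<^bsub>Hom k l\<^esub> (b \<odot>\<^bsub>Hom k l\<^esub> X)"
    using ab fg morph_eqI[OF meq.scale_scale[OF ab wf(1)]] by (simp add: Hom_smult)
  show "a \<odot>\<^bsub>Hom k l\<^esub> X \<in> carrier (Hom k l)" using ab fg by (simp add: Hom_smult)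
next
  fix X assume "X \<in> carrier (Hom k l)"
  then obtain f where f: "f \<in> terms R k l" "X = morph R t f" by (auto simp: Hom_carrier)
  then have "wf_term R f" by (simp add: terms_def)
  then show "\<one> \<odot>\<^bsub>Hom k l\<^esub> X = X" using f morph_eqI[OF meq.scale_one] by (simp add: Hom_smult)
qed (rule cring_axioms)

subsection \<open>The basis\<close>

lemma partitions_dims:
  assumes "D \<in> partitions k l" "D \<in> partitions k' l'"
  shows "k = k' \<and> l = l'"
proof -
  have V: "vertices k l = vertices k' l'"
    using assms unfolding partitions_def by (metis mem_Collect_eq partition_onD1)
  have "Bot i \<in> vertices k l \<longleftrightarrow> Bot i \<in> vertices k' l'" "Top i \<in> vertices k l \<longleftrightarrow> Top i \<in> vertices k' l'" for i
    unfolding V by blast+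
  from this(1)[of "max k k'"] this(2)[of "max l l'"] show ?thesis by (auto simp: max_def split: if_splits)
qed

lemma nf_same_diagram: "nf z w w' D \<Longrightarrow> nf z2 w2 w2' D \<Longrightarrow> z \<triangleq> z2"
  using nf_diagram[of z w w' D] nf_diagram[of z2 w2 w2' D] partitions_dims[of D "length w'" "length w" "length w2'" "length w2"]
    nf_unique[of z w w' D z2 D]
  by (auto simp: matchings_def)

text \<open>The choice does not matter up to equality of morphisms, by
  \<open>nf_same_diagram\<close>.\<close>

definition nf_term :: "diagram \<Rightarrow> 'a mterm" where
  "nf_term D = (SOME z. \<exists>w w'. nf z w w' D)"

lemma nf_term: "D \<in> matchings k l \<Longrightarrow> \<exists>w w'. nf (nf_term D) w w' D \<and> length w = l \<and> length w' = k"
proof -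
  assume D: "D \<in> matchings k l"
  from someI_ex[OF nf_exists[OF D]] obtain w w' where nf: "nf (nf_term D) w w' D" by (auto simp: nf_term_def)
  from nf_diagram[OF nf] D have "k = length w' \<and> l = length w" by (intro partitions_dims) (auto simp: matchings_def)
  with nf show ?thesis by blast
qed

lemma nf_term_closed [simp]: "D \<in> matchings k l \<Longrightarrow> nf_term D \<in> terms R k l"
  using nf_term nf_wf[of "nf_term D" _ _ D R] by (fastforce simp: terms_def)

lemma J_nf_term: "D \<in> matchings k l \<Longrightarrow> J R t (nf_term D) = par_basis R D"
  using nf_term J_nf by blast

lemma finite_matchings [simp]: "finite (matchings k l)"
  by (rule finite_subset[OF _ finite_partitions[of k l]]) (auto simp: matchings_def)

text \<open>A morphism is determined by its image under \<open>J\<close>, which supplies the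
  coefficients. Both sides are linear in \<open>f\<close> and invariant under equality of morphisms,
  so the essential case is a normal form, whose image is a basis vector.\<close>

lemma morph_expansion_span:
  "span k l f \<Longrightarrow> morph R t f =
    (\<Oplus>\<^bsub>Hom k l\<^esub>D\<in>matchings k l. J R t f D \<odot>\<^bsub>Hom k l\<^esub> morph R t (nf_term D))"
proof (induction rule: span.induct)
  case (span_zero k l)
  interpret H: Module.module R "Hom k l" by (rule module_Hom)
  have "(\<Oplus>\<^bsub>Hom k l\<^esub>D\<in>matchings k l. J R t (ZeroM k l) D \<odot>\<^bsub>Hom k l\<^esub> morph R t (nf_term D)) =
      (\<Oplus>\<^bsub>Hom k l\<^esub>D\<in>matchings k l. \<zero>\<^bsub>Hom k l\<^esub>)"
    by (rule H.M.finsum_cong') (auto simp: H.smult_l_null)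
  then show ?case by (simp add: Hom_zero[symmetric])
next
  case (span_nf z w w' D)
  let ?k = "length w'" and ?l = "length w"
  interpret H: Module.module R "Hom ?k ?l" by (rule module_Hom)
  have D: "D \<in> matchings ?k ?l" using nf_diagram[OF span_nf] by blast
  have "(\<Oplus>\<^bsub>Hom ?k ?l\<^esub>E\<in>matchings ?k ?l. J R t z E \<odot>\<^bsub>Hom ?k ?l\<^esub> morph R t (nf_term E)) =
      (\<Oplus>\<^bsub>Hom ?k ?l\<^esub>E\<in>matchings ?k ?l. if D = E then morph R t (nf_term E) else \<zero>\<^bsub>Hom ?k ?l\<^esub>)"
    using J_nf[OF span_nf]
    by (intro H.M.finsum_cong') (auto simp: par_basis_def H.smult_l_null)
  also have "\<dots> = morph R t (nf_term D)"
    by (rule H.M.finsum_singleton[OF D]) auto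
  also have "\<dots> = morph R t z"
  proof -
    obtain w2 w2' where "nf (nf_term D) w2 w2' D" using nf_term[OF D] by blast
    then show ?thesis using nf_same_diagram[OF _ span_nf] by (intro morph_eqI)
  qed
  finally show ?case by simp
next
  case (span_add k l f g)
  interpret H: Module.module R "Hom k l" by (rule module_Hom)
  have wf: "f \<in> terms R k l" "g \<in> terms R k l" using span_add span_wf by (auto simp: terms_def)
  then have J: "J R t f \<in> funs" "J R t g \<in> funs" by (auto simp: terms_def)
  have "(\<Oplus>\<^bsub>Hom k l\<^esub>D\<in>matchings k l. J R t (f \<oplus>\<^sub>m g) D \<odot>\<^bsub>Hom k l\<^esub> morph R t (nf_term D)) =
    (\<Oplus>\<^bsub>Hom k l\<^esub>D\<in>matchings k l. J R t f D \<odot>\<^bsub>Hom k l\<^esub> morph R t (nf_term D) \<oplus>\<^bsub>Hom k l\<^esub>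
      J R t g D \<odot>\<^bsub>Hom k l\<^esub> morph R t (nf_term D))"
    using J by (intro H.M.finsum_cong') (auto simp: H.smult_l_distr)
  also have "\<dots> = morph R t f \<oplus>\<^bsub>Hom k l\<^esub> morph R t g"
    unfolding span_add.IH using J by (intro H.M.finsum_addf) auto
  finally show ?case using Hom_add[OF wf] by simp
next
  case (span_scale c k l f)
  interpret H: Module.module R "Hom k l" by (rule module_Hom)
  have wf: "f \<in> terms R k l" using span_scale span_wf by (auto simp: terms_def)
  then have J: "J R t f \<in> funs" by (auto simp: terms_def)
  have "(\<Oplus>\<^bsub>Hom k l\<^esub>D\<in>matchings k l. J R t (c \<odot>\<^sub>m f) D \<odot>\<^bsub>Hom k l\<^esub> morph R t (nf_term D)) =
    (\<Oplus>\<^bsub>Hom k l\<^esub>D\<in>matchings k l. c \<odot>\<^bsub>Hom k l\<^esub> (J R t f D \<odot>\<^bsub>Hom k l\<^esub> morph R t (nf_term D)))"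
    using J span_scale.hyps by (intro H.M.finsum_cong') (auto simp: H.smult_assoc1)
  also have "\<dots> = c \<odot>\<^bsub>Hom k l\<^esub> morph R t f"
    unfolding span_scale.IH using J span_scale.hyps by (intro H.finsum_smult_ldistr[symmetric]) auto
  finally show ?case using Hom_smult[OF wf span_scale.hyps(1)] by simp
next
  case (span_equ k l f g)
  show ?case using span_equ.IH unfolding morph_eqI[OF span_equ.hyps(2)] J_sound[OF span_equ.hyps(2)] .
qed

lemma morph_expansion:
  "f \<in> terms R k l \<Longrightarrow> morph R t f =
    (\<Oplus>\<^bsub>Hom k l\<^esub>D\<in>matchings k l. J R t f D \<odot>\<^bsub>Hom k l\<^esub> morph R t (nf_term D))"
  by (intro morph_expansion_span span_terms)

text \<open>A representing term has the same image under \<open>J\<close> as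
  \<open>nf_term D\<close>, hence the same expansion. The argument covers the zero ring too, where
  \<open>par_basis\<close> does not distinguish diagrams.\<close>

lemma represents_iff:
  assumes D: "D \<in> matchings k l"
  shows "represents R t k l X D \<longleftrightarrow> X = morph R t (nf_term D)"
proof
  assume "represents R t k l X D"
  then obtain f where "f \<in> terms R k l" "X = morph R t f" "J R t f = par_basis R D"
    by (auto simp: represents_def)
  then show "X = morph R t (nf_term D)"
    using morph_expansion[of f k l] morph_expansion[OF nf_term_closed[OF D]] J_nf_term[OF D] by simp
next
  have "monomial (nf_term D)" using nf_term[OF D] nf_wf by blast
  then show "X = morph R t (nf_term D) \<Longrightarrow> represents R t k l X D"
    using D J_nf_term[OF D] by (auto simp: represents_def)
qed

lemma diagram_morphism_eq: "D \<in> matchings k l \<Longrightarrow> diagram_morphism R t k l D = morph R t (nf_term D)"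
  by (simp add: diagram_morphism_def represents_iff)

text \<open>\<open>J\<close> is defined on terms and not on classes, so a combination of classes is
  lifted to a term from which its coefficients can be read.\<close>

lemma linear_combination:
  assumes "finite A" "A \<subseteq> matchings k l" "c \<in> A \<rightarrow> carrier R"
  shows "\<exists>f\<in>terms R k l. (\<Oplus>\<^bsub>Hom k l\<^esub>D\<in>A. c D \<odot>\<^bsub>Hom k l\<^esub> morph R t (nf_term D)) = morph R t f \<and>
    J R t f = (\<lambda>D. if D \<in> A then c D else \<zero>)"
  using assms
proof (induction A)
  case empty
  interpret H: Module.module R "Hom k l" by (rule module_Hom)
  show ?case by (intro bexI[of _ "ZeroM k l"]) (auto simp: Hom_zero H.M.finsum_empty)
next
  case (insert E A)
  interpret H: Module.module R "Hom k l" by (rule module_Hom)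
  obtain f where f: "f \<in> terms R k l" "J R t f = (\<lambda>D. if D \<in> A then c D else \<zero>)"
    "(\<Oplus>\<^bsub>Hom k l\<^esub>D\<in>A. c D \<odot>\<^bsub>Hom k l\<^esub> morph R t (nf_term D)) = morph R t f"
    using insert by auto
  have E: "E \<in> matchings k l" "c E \<in> carrier R" using insert.prems by auto
  have sub: "D \<in> A \<Longrightarrow> D \<in> matchings k l" for D using insert.prems by blast
  have "(\<Oplus>\<^bsub>Hom k l\<^esub>D\<in>insert E A. c D \<odot>\<^bsub>Hom k l\<^esub> morph R t (nf_term D)) =
    c E \<odot>\<^bsub>Hom k l\<^esub> morph R t (nf_term E) \<oplus>\<^bsub>Hom k l\<^esub> morph R t f"
    unfolding f(3)[symmetric] using insert.hyps insert.prems E sub by (intro H.M.finsum_insert) auto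
  also have "\<dots> = morph R t (c E \<odot>\<^sub>m nf_term E \<oplus>\<^sub>m f)"
    using E f(1) by (simp add: Hom_smult[OF nf_term_closed] Hom_add)
  moreover have "J R t (c E \<odot>\<^sub>m nf_term E \<oplus>\<^sub>m f) = (\<lambda>D. if D \<in> insert E A then c D else \<zero>)"
  proof
    fix D
    have "c D \<in> carrier R" if "D \<in> A" using that insert.prems by auto
    then show "J R t (c E \<odot>\<^sub>m nf_term E \<oplus>\<^sub>m f) D = (if D \<in> insert E A then c D else \<zero>)"
      using E(2) insert.hyps by (cases "D = E"; cases "D \<in> A") (simp_all add: J_nf_term[OF E(1)] f(2) par_basis_def)
  qed
  ultimately show ?case using E f(1) by (intro bexI[of _ "c E \<odot>\<^sub>m nf_term E \<oplus>\<^sub>m f"]) auto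
qed

theorem module_basis_matchings:
  "module_basis R (Hom k l) (matchings k l) (diagram_morphism R t k l)"
  unfolding module_basis_def
proof (intro conjI allI impI ballI)
  interpret H: Module.module R "Hom k l" by (rule module_Hom)
  show "Module.module R (Hom k l)" by (rule module_Hom)
  show "diagram_morphism R t k l \<in> matchings k l \<rightarrow> carrier (Hom k l)"
    by (auto simp: diagram_morphism_eq)
  have eq: "(\<Oplus>\<^bsub>Hom k l\<^esub>D\<in>A. c D \<odot>\<^bsub>Hom k l\<^esub> diagram_morphism R t k l D) =
      (\<Oplus>\<^bsub>Hom k l\<^esub>D\<in>A. c D \<odot>\<^bsub>Hom k l\<^esub> morph R t (nf_term D))"
    if "A \<subseteq> matchings k l" "c \<in> A \<rightarrow> carrier R" for A c
  proof (rule H.M.finsum_cong'[OF HOL.refl])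
    show "(\<lambda>D. c D \<odot>\<^bsub>Hom k l\<^esub> morph R t (nf_term D)) \<in> A \<rightarrow> carrier (Hom k l)"
    proof
      fix D assume "D \<in> A"
      then have "D \<in> matchings k l" "c D \<in> carrier R" using that by auto
      then show "c D \<odot>\<^bsub>Hom k l\<^esub> morph R t (nf_term D) \<in> carrier (Hom k l)" by simp
    qed
    fix D assume "D \<in> A"
    then have "D \<in> matchings k l" using that by blast
    then show "c D \<odot>\<^bsub>Hom k l\<^esub> diagram_morphism R t k l D = c D \<odot>\<^bsub>Hom k l\<^esub> morph R t (nf_term D)"
      by (simp add: diagram_morphism_eq)
  qed
  fix A c i
  assume A: "finite A \<and> A \<subseteq> matchings k l \<and> c \<in> A \<rightarrow> carrier R \<and>
    (\<Oplus>\<^bsub>Hom k l\<^esub>i\<in>A. c i \<odot>\<^bsub>Hom k l\<^esub> diagram_morphism R t k l i) = \<zero>\<^bsub>Hom k l\<^esub>" and i: "i \<in> A"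
  then obtain f where f: "f \<in> terms R k l" "J R t f = (\<lambda>D. if D \<in> A then c D else \<zero>)"
    "\<zero>\<^bsub>Hom k l\<^esub> = morph R t f"
    using linear_combination[of A k l c] eq[of A c] by auto
  \<comment> \<open>A vanishing combination is represented by \<open>f\<close> and by the zero term;
    soundness of \<open>J\<close> compares their coefficients.\<close>
  then have "f \<triangleq> ZeroM k l" using morph_eq_iff[of "ZeroM k l" f] by (simp add: Hom_zero)
  from J_sound[OF this] f(2) i show "c i = \<zero>" by (auto dest: fun_cong[of _ _ i])
next
  interpret H: Module.module R "Hom k l" by (rule module_Hom)
  fix X assume "X \<in> carrier (Hom k l)"
  then obtain f where f: "f \<in> terms R k l" "X = morph R t f" by (auto simp: Hom_carrier)
  have J: "J R t f \<in> funs" using f by (auto simp: terms_def)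
  have "X = (\<Oplus>\<^bsub>Hom k l\<^esub>D\<in>matchings k l. J R t f D \<odot>\<^bsub>Hom k l\<^esub> diagram_morphism R t k l D)"
    unfolding f(2) morph_expansion[OF f(1)]
    using J by (intro H.M.finsum_cong') (auto simp: diagram_morphism_eq)
  then show "\<exists>A c. finite A \<and> A \<subseteq> matchings k l \<and> c \<in> A \<rightarrow> carrier R \<and>
      X = (\<Oplus>\<^bsub>Hom k l\<^esub>i\<in>A. c i \<odot>\<^bsub>Hom k l\<^esub> diagram_morphism R t k l i)"
    using J by (intro exI[of _ "matchings k l"] exI[of _ "J R t f"]) auto
qed

end

section \<open>Planarity\<close>

subsection \<open>Planar diagrams are the non-crossing ones\<close>

text \<open>In polar coordinates the strip around the two rows becomes a half plane, with all vertices on its boundary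
  line in the order of \<^const>\<open>pos\<close>.\<close>

definition unroll :: "real ^ 2 \<Rightarrow> real ^ 2" where
  "unroll z = vector [exp (z $ 1) * cos (pi * z $ 2), exp (z $ 1) * sin (pi * z $ 2)]"

fun boundary_pos :: "vertex \<Rightarrow> real" where
  "boundary_pos (Bot i) = exp (real i)"
| "boundary_pos (Top j) = - exp (real j)"

lemma unroll_simps [simp]:
  "unroll z $ 1 = exp (z $ 1) * cos (pi * z $ 2)" "unroll z $ 2 = exp (z $ 1) * sin (pi * z $ 2)"
  by (simp_all add: unroll_def)

lemma unroll_vertex_pos: "unroll (vertex_pos v) = vector [boundary_pos v, 0]"
  by (cases v) (simp_all add: unroll_def)

text \<open>The norm determines the radius, and the cosine is injective on angles from 0 to
  \<open>pi\<close>. The bounds matter because \<open>unroll\<close> is periodic in the second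
  coordinate.\<close>

lemma unroll_inject:
  assumes "unroll z = unroll w" "0 \<le> z $ 2" "z $ 2 \<le> 1" "0 \<le> w $ 2" "w $ 2 \<le> 1"
  shows "z = w"
proof -
  have norm: "(unroll z $ 1)\<^sup>2 + (unroll z $ 2)\<^sup>2 = (exp (z $ 1))\<^sup>2" for z
  proof -
    have "(unroll z $ 1)\<^sup>2 + (unroll z $ 2)\<^sup>2 = (exp (z $ 1))\<^sup>2 * ((sin (pi * z $ 2))\<^sup>2 + (cos (pi * z $ 2))\<^sup>2)"
      unfolding unroll_simps by (simp only: power_mult_distrib distrib_left add.commute)
    then show ?thesis by simp
  qed
  have "(exp (z $ 1))\<^sup>2 = (exp (w $ 1))\<^sup>2" using norm[of z] norm[of w] assms(1) by simp
  then have 1: "z $ 1 = w $ 1" by simp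
  have "unroll z $ 1 = unroll w $ 1" using assms(1) by simp
  then have "cos (pi * z $ 2) = cos (pi * w $ 2)" using 1 by simp
  then have "pi * z $ 2 = pi * w $ 2"
    by (rule cos_inj_pi[rotated 4]) (use assms(2-5) in \<open>simp_all add: mult_left_le\<close>)
  then have "z $ 2 = w $ 2" by simp
  with 1 show ?thesis by (simp add: vec_eq_iff forall_2)
qed

lemma continuous_on_vector_2:
  "continuous_on S f \<Longrightarrow> continuous_on S g \<Longrightarrow> continuous_on S (\<lambda>s. vector [f s, g s] :: real ^ 2)"
proof -
  assume *: "continuous_on S f" "continuous_on S g"
  have eq: "(\<lambda>s. vector [f s, g s] :: real ^ 2) = (\<lambda>s. \<chi> i. if i = 1 then f s else g s)"
    by (simp add: fun_eq_iff vec_eq_iff forall_2)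
  have "continuous_on S (\<lambda>s. if i = 1 then f s else g s)" for i :: 2
    using * by (cases "i = 1") auto
  then show ?thesis unfolding eq by (rule continuous_on_vec_lambda)
qed

lemma continuous_on_unroll: "continuous_on S unroll"
  unfolding unroll_def by (intro continuous_on_vector_2 continuous_intros)

lemma mem_cbox_2:
  "(z :: real ^ 2) \<in> cbox (vector [a, b]) (vector [c, d]) \<longleftrightarrow> a \<le> z $ 1 \<and> z $ 1 \<le> c \<and> b \<le> z $ 2 \<and> z $ 2 \<le> d"
  by (auto simp: mem_box_cart forall_2)

lemma boundary_pos_less_iff:
  "boundary_pos u < boundary_pos v \<longleftrightarrow> pos u < pos v" if "u \<in> vertices k l" "v \<in> vertices k l"
proof -
  have "- exp x < exp y" "\<not> exp x < - exp y" for x y :: real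
    using exp_gt_zero[of x] exp_gt_zero[of y] by linarith+
  then show ?thesis using that by (cases u; cases v) auto
qed

lemma pos_inject: "u \<in> vertices k l \<Longrightarrow> v \<in> vertices k l \<Longrightarrow> pos u = pos v \<Longrightarrow> u = v"
  by (cases u; cases v) auto

lemma boundary_pos_inject:
  assumes "u \<in> vertices k l" "v \<in> vertices k l" "boundary_pos u = boundary_pos v" shows "u = v"
proof (rule pos_inject[OF assms(1,2)])
  have "\<not> pos u < pos v" "\<not> pos v < pos u"
    unfolding boundary_pos_less_iff[OF assms(1,2), symmetric] boundary_pos_less_iff[OF assms(2,1), symmetric]
    by (simp_all add: assms(3))
  then show "pos u = pos v" by simp
qed

text \<open>The component of \<open>a\<close> is \<open>{a, c}\<close>, so a path from
  \<open>a\<close> to \<open>c\<close> starts with an edge that stays inside this set and is not a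
  loop. Hence every admissible choice of edges draws all pairs.\<close>

lemma edges_for_block:
  assumes E: "edges_for k l D E" and ac: "{a, c} \<in> D" "a \<noteq> c"
  shows "{a, c} \<in> E"
proof -
  let ?V = "vertices k l" and ?r = "{(u, v). {u, v} \<in> E}"
  have edge: "e \<subseteq> ?V" "card e = 2" if "e \<in> E" for e using E that by (auto simp: edges_for_def)
  have D: "D = ?V // (?r\<^sup>* \<inter> ?V \<times> ?V)" using E by (simp add: edges_for_def components_of_rel_def)
  have "sym ?r" by (auto simp: sym_def insert_commute)
  then have sym: "sym (?r\<^sup>*)" by (rule sym_rtrancl)
  obtain x where x: "x \<in> ?V" "{a, c} = (?r\<^sup>* \<inter> ?V \<times> ?V) `` {x}" using ac(1) unfolding D by (rule quotientE)
  then have "(x, a) \<in> ?r\<^sup>*" "(x, c) \<in> ?r\<^sup>*" by blast+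
  then have "(a, c) \<in> ?r\<^sup>*" using sym by (meson symE rtrancl_trans)
  then obtain w where w: "(a, w) \<in> ?r" using ac(2) by (meson converse_rtranclE)
  then have aw: "{a, w} \<in> E" by simp
  then have "w \<in> ?V" using edge(1) by blast
  moreover have "(x, w) \<in> ?r\<^sup>*" using \<open>(x, a) \<in> ?r\<^sup>*\<close> w by (rule rtrancl.rtrancl_into_rtrancl)
  ultimately have "w \<in> {a, c}" using x by blast
  moreover have "w \<noteq> a" using edge(2)[OF aw] by auto
  ultimately show ?thesis using aw by blast
qed

text \<open>Blocks are disjoint, so paths along these edges stay within one pair and the components
  are the given blocks.\<close>

lemma edges_for_pairs:
  assumes P: "D \<in> partitions k l" and card: "\<forall>B\<in>D. card B \<le> 2"
  shows "edges_for k l D {B\<in>D. card B = 2}"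
proof -
  let ?V = "vertices k l" and ?E = "{B\<in>D. card B = 2}"
  let ?r = "{(u, v). {u, v} \<in> ?E}"
  have path: "w = v \<or> {v, w} \<in> ?E" if "(v, w) \<in> ?r\<^sup>*" for v w
    using that
  proof (induction rule: rtrancl_induct)
    case (step y z)
    then have yz: "{y, z} \<in> ?E" by simp
    show ?case
    proof (cases "y = v")
      case False
      with step have "{v, y} \<in> D" by blast
      with yz have "{v, y} = {y, z}" using partitions_disjoint[OF P, of "{v, y}" "{y, z}" y] by auto
      then show ?thesis using False by (auto simp: doubleton_eq_iff)
    qed (use yz in simp)
  qed simp
  have block: "(?r\<^sup>* \<inter> ?V \<times> ?V) `` {v} = B" if B: "B \<in> D" "v \<in> B" for v B
  proof
    show "(?r\<^sup>* \<inter> ?V \<times> ?V) `` {v} \<subseteq> B"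
    proof
      fix w assume "w \<in> (?r\<^sup>* \<inter> ?V \<times> ?V) `` {v}"
      then have "w = v \<or> {v, w} \<in> D" using path by blast
      then show "w \<in> B" using B partitions_disjoint[OF P _ B(1) _ B(2), of "{v, w}"] by blast
    qed
    show "B \<subseteq> (?r\<^sup>* \<inter> ?V \<times> ?V) `` {v}"
    proof
      fix w assume w: "w \<in> B"
      have V: "v \<in> ?V" "w \<in> ?V" using partitions_vertices[OF P B(1)] B w by auto
      have "(v, w) \<in> ?r\<^sup>*"
      proof (cases "v = w")
        case False
        have "finite B" using finite_subset[of B ?V] partitions_vertices[OF P B(1)] by auto
        then have "{v, w} = B" using card B w False by (intro card_seteq) auto
        then have "{v, w} \<in> ?E" using B False by auto
        then show ?thesis by blast
      qed simp
      then show "w \<in> (?r\<^sup>* \<inter> ?V \<times> ?V) `` {v}" using V by blast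
    qed
  qed
  have "components_of_rel ?V ?r = D"
  proof
    show "components_of_rel ?V ?r \<subseteq> D"
    proof
      fix C assume "C \<in> components_of_rel ?V ?r"
      then obtain v where v: "v \<in> ?V" "C = (?r\<^sup>* \<inter> ?V \<times> ?V) `` {v}"
        unfolding components_of_rel_def by (rule quotientE)
      obtain B where "B \<in> D" "v \<in> B" using partitions_block[OF P v(1)] by blast
      then show "C \<in> D" using block v(2) by simp
    qed
    show "D \<subseteq> components_of_rel ?V ?r"
    proof
      fix B assume B: "B \<in> D"
      then obtain v where v: "v \<in> B"
        using P unfolding partitions_def partition_on_def by (metis ex_in_conv mem_Collect_eq)
      then show "B \<in> components_of_rel ?V ?r"
        using block[OF B v] quotientI[of v ?V "?r\<^sup>* \<inter> ?V \<times> ?V"] partitions_vertices[OF P B v]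
        unfolding components_of_rel_def by simp
    qed
  qed
  moreover have "e \<subseteq> ?V" if "e \<in> ?E" for e using that partitions_vertices[OF P] by blast
  ultimately show ?thesis unfolding edges_for_def by blast
qed

text \<open>Edges are undirected, so the drawn arc may run from \<open>c\<close> to
  \<open>a\<close>; it is then reversed, as the interlacing argument needs to know which end is
  which.\<close>

lemma drawn_arc:
  assumes draw: "crossing_free_drawing k l E \<gamma>" and e: "{a, c} \<in> E"
  obtains f where "path f" "path_image f = unroll ` path_image (\<gamma> {a, c})"
    "pathstart f = vector [boundary_pos a, 0]" "pathfinish f = vector [boundary_pos c, 0]"
proof -
  let ?g = "\<gamma> {a, c}"
  have "arc ?g" and ends: "{pathstart ?g, pathfinish ?g} = {vertex_pos a, vertex_pos c}"
    using draw e unfolding crossing_free_drawing_def by auto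
  then have path: "path ?g" by (simp add: arc_imp_path)
  define g where "g = (if pathstart ?g = vertex_pos a then ?g else reversepath ?g)"
  have g: "path g" "path_image g = path_image ?g" "pathstart g = vertex_pos a" "pathfinish g = vertex_pos c"
    using path ends by (auto simp: g_def doubleton_eq_iff)
  have "path (unroll \<circ> g)" using path_continuous_image[OF g(1) continuous_on_unroll] .
  then show thesis
    using that[of "unroll \<circ> g"] g by (simp add: path_image_compose pathstart_compose pathfinish_compose unroll_vertex_pos)
qed

text \<open>After \<open>unroll\<close> the two arcs lie in a box with their four ends interlaced on
  its lower side, so by the Fashoda theorem they meet. Injectivity of \<open>unroll\<close> on the
  strip turns this into a common point of the drawn arcs, which have no common end.\<close>

lemma planar_imp_noncrossing:
  assumes P: "D \<in> partitions k l" and "planar k l D"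
  shows "noncrossing D"
  unfolding noncrossing_def
proof clarify
  fix a b c d assume ac: "{a, c} \<in> D" and bd: "{b, d} \<in> D" and p: "pos a < pos b" "pos b < pos c" "pos c < pos d"
  from assms(2) obtain E \<gamma> where E: "edges_for k l D E" and draw: "crossing_free_drawing k l E \<gamma>"
    unfolding planar_def by blast
  have e: "{a, c} \<in> E" "{b, d} \<in> E" using edges_for_block[OF E] ac bd p by fastforce+
  obtain f where f: "path f" "path_image f = unroll ` path_image (\<gamma> {a, c})"
    "pathstart f = vector [boundary_pos a, 0]" "pathfinish f = vector [boundary_pos c, 0]"
    using drawn_arc[OF draw e(1)] .
  obtain g where g: "path g" "path_image g = unroll ` path_image (\<gamma> {b, d})"
    "pathstart g = vector [boundary_pos b, 0]" "pathfinish g = vector [boundary_pos d, 0]"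
    using drawn_arc[OF draw e(2)] .
  have V: "a \<in> vertices k l" "b \<in> vertices k l" "c \<in> vertices k l" "d \<in> vertices k l"
    using partitions_vertices[OF P ac] partitions_vertices[OF P bd] by auto
  have rect: "path_image (\<gamma> e) \<subseteq> rectangle k l" if "e \<in> E" for e
    using draw that unfolding crossing_free_drawing_def by blast
  \<comment> \<open>No point of the rectangle is mapped to a larger radius, so the image fits into a
    box of this size above the real axis.\<close>
  define M where "M = exp (real (max k l))"
  have box: "unroll ` rectangle k l \<subseteq> cbox (vector [- M, 0]) (vector [M, M])"
  proof
    fix w assume "w \<in> unroll ` rectangle k l"
    then obtain z where z: "w = unroll z" "1 \<le> z $ 1" "z $ 1 \<le> real (max k l)" "0 \<le> z $ 2" "z $ 2 \<le> 1"
      by (auto simp: rectangle_def mem_cbox_2)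
    have M: "exp (z $ 1) \<le> M" "0 \<le> exp (z $ 1)" "0 \<le> M" using z by (auto simp: M_def)
    have sin: "0 \<le> sin (pi * z $ 2)" using z by (intro sin_ge_zero) (simp_all add: mult_left_le)
    moreover have "\<bar>exp (z $ 1) * cos (pi * z $ 2)\<bar> \<le> M * 1" "exp (z $ 1) * sin (pi * z $ 2) \<le> M * 1"
      unfolding abs_mult using M sin by (intro mult_mono; simp)+
    ultimately show "w \<in> cbox (vector [- M, 0]) (vector [M, M])"
      unfolding z(1) mem_cbox_2 unroll_simps using M by (auto simp: abs_le_iff)
  qed
  have "path_image f \<subseteq> cbox (vector [- M, 0]) (vector [M, M])" "path_image g \<subseteq> cbox (vector [- M, 0]) (vector [M, M])"
    unfolding f(2) g(2) using box rect[OF e(1)] rect[OF e(2)] by blast+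
  from fashoda_interlace[OF f(1) g(1) this]
  obtain z where "z \<in> path_image f" "z \<in> path_image g"
    using p V by (auto simp: f(3,4) g(3,4) boundary_pos_less_iff)
  then obtain x y where xy: "x \<in> path_image (\<gamma> {a, c})" "y \<in> path_image (\<gamma> {b, d})" "unroll x = unroll y"
    unfolding f(2) g(2) by auto
  have "x \<in> rectangle k l" "y \<in> rectangle k l" using xy rect e by blast+
  then have "0 \<le> x $ 2" "x $ 2 \<le> 1" "0 \<le> y $ 2" "y $ 2 \<le> 1" unfolding rectangle_def mem_cbox_2 by blast+
  with xy(3) have "x = y" by (rule unroll_inject)
  moreover have "{a, c} \<inter> {b, d} = {}" using p by auto
  moreover from this have "{a, c} \<noteq> {b, d}" by blast
  ultimately show False
    using draw e xy unfolding crossing_free_drawing_def by blast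
qed

text \<open>The preimage under \<^const>\<open>unroll\<close> of the semicircle with diameter from \<open>p\<close> to \<open>q\<close>.\<close>

definition semicircle :: "real \<Rightarrow> real \<Rightarrow> real \<Rightarrow> real ^ 2" where
  "semicircle p q s = (let x = (1 - s) * p + s * q; n = (1 - s) * p\<^sup>2 + s * q\<^sup>2 in
     vector [ln n / 2, arccos (x / sqrt n) / pi])"

text \<open>\<open>n\<close> is the squared distance from the origin to the point of the semicircle
  above \<open>x\<close>; it is linear in \<open>s\<close> since the height has square
  \<open>(x - p) * (q - x)\<close>. The semicircle avoids the origin because neither end is there,
  so the logarithm and the quotient in \<open>semicircle\<close> are meaningful.\<close>

lemma semicircle_bounds:
  fixes p q s :: real
  assumes "p \<noteq> 0" "q \<noteq> 0" "0 \<le> s" "s \<le> 1"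
  defines "x \<equiv> (1 - s) * p + s * q" and "n \<equiv> (1 - s) * p\<^sup>2 + s * q\<^sup>2"
  shows "0 < n" "n - x\<^sup>2 = (x - p) * (q - x)" "x\<^sup>2 \<le> n" "\<bar>x / sqrt n\<bar> \<le> 1"
proof -
  show n: "0 < n"
  proof (cases "s = 0")
    case False
    then show ?thesis unfolding n_def using assms(1-4) by (intro add_nonneg_pos mult_nonneg_nonneg mult_pos_pos) auto
  qed (use assms in \<open>simp add: n_def\<close>)
  have nx: "n - x\<^sup>2 = s * (1 - s) * (q - p)\<^sup>2" unfolding n_def x_def by (simp add: power2_eq_square algebra_simps)
  show "n - x\<^sup>2 = (x - p) * (q - x)" unfolding n_def x_def by (simp add: power2_eq_square algebra_simps)
  have "0 \<le> n - x\<^sup>2" unfolding nx using assms(3,4) by simp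
  then show le: "x\<^sup>2 \<le> n" by simp
  have "\<bar>x\<bar> \<le> sqrt n" using le by (metis real_sqrt_abs real_sqrt_le_iff)
  then show "\<bar>x / sqrt n\<bar> \<le> 1" using n by (simp add: abs_divide)
qed

lemma unroll_semicircle:
  assumes "p \<noteq> 0" "q \<noteq> 0" "0 \<le> s" "s \<le> 1"
  defines "x \<equiv> (1 - s) * p + s * q"
  shows "unroll (semicircle p q s) = vector [x, sqrt ((x - p) * (q - x))]"
proof -
  define n where "n = (1 - s) * p\<^sup>2 + s * q\<^sup>2"
  note b = semicircle_bounds[OF assms(1-4), folded n_def, folded x_def]
  have sc: "semicircle p q s = vector [ln n / 2, arccos (x / sqrt n) / pi]"
    by (simp add: semicircle_def Let_def n_def x_def)
  have "exp (ln n / 2) = sqrt n" using b(1) by (simp add: ln_sqrt[symmetric])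
  moreover have "cos (arccos (x / sqrt n)) = x / sqrt n" using b(4) by (simp add: cos_arccos_abs)
  moreover have "sqrt n * sin (arccos (x / sqrt n)) = sqrt ((x - p) * (q - x))"
  proof -
    have "sin (arccos (x / sqrt n)) = sqrt (1 - (x / sqrt n)\<^sup>2)" using b(4) by (intro sin_arccos_abs)
    also have "sqrt n * sqrt (1 - (x / sqrt n)\<^sup>2) = sqrt (n * (1 - (x / sqrt n)\<^sup>2))" by (simp add: real_sqrt_mult)
    also have "n * (1 - (x / sqrt n)\<^sup>2) = n - x\<^sup>2" using b(1) by (simp add: power_divide field_simps)
    finally show ?thesis using b(2) by simp
  qed
  ultimately show ?thesis using b(1) unfolding sc by (simp add: vec_eq_iff forall_2)
qed

lemma semicircle_strip:
  assumes "p \<noteq> 0" "q \<noteq> 0" "0 \<le> s" "s \<le> 1"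
  shows "0 \<le> semicircle p q s $ 2" "semicircle p q s $ 2 \<le> 1"
proof -
  define y where "y = ((1 - s) * p + s * q) / sqrt ((1 - s) * p\<^sup>2 + s * q\<^sup>2)"
  have "\<bar>y\<bar> \<le> 1" using semicircle_bounds(4)[OF assms] by (simp add: y_def)
  then have "0 \<le> arccos y" "arccos y \<le> pi" by (auto intro: arccos_lbound arccos_ubound)
  moreover have "semicircle p q s $ 2 = arccos y / pi" by (simp add: semicircle_def Let_def y_def)
  ultimately show "0 \<le> semicircle p q s $ 2" "semicircle p q s $ 2 \<le> 1" by simp_all
qed

lemma continuous_on_semicircle:
  assumes "p \<noteq> 0" "q \<noteq> 0"
  shows "continuous_on {0..1} (semicircle p q)"
proof -
  define x where "x = (\<lambda>s. (1 - s) * p + s * q)"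
  define n where "n = (\<lambda>s. (1 - s) * p\<^sup>2 + s * q\<^sup>2)"
  have b: "0 < n s" "\<bar>x s / sqrt (n s)\<bar> \<le> 1" if "s \<in> {0..1}" for s
    unfolding n_def x_def using semicircle_bounds(1,4)[OF assms, of s] that by simp_all
  have b: "n s \<noteq> 0" "- 1 \<le> x s / sqrt (n s)" "x s / sqrt (n s) \<le> 1" if "s \<in> {0..1}" for s
    using b[OF that] by linarith+
  have x: "continuous_on {0..1} x" and n: "continuous_on {0..1} n"
    unfolding x_def n_def by (intro continuous_intros)+
  have "continuous_on {0..1} (\<lambda>s. x s / sqrt (n s))"
    using b(1) by (intro continuous_on_divide continuous_on_real_sqrt x n) simp
  then have "continuous_on {0..1} (\<lambda>s. arccos (x s / sqrt (n s)))"
    using b(2,3) by (intro continuous_on_arccos) blast+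
  moreover have "continuous_on {0..1} (\<lambda>s. ln (n s))"
    using b(1) by (intro continuous_on_ln n) blast
  ultimately have "continuous_on {0..1} (\<lambda>s. vector [ln (n s) / 2, arccos (x s / sqrt (n s)) / pi] :: real ^ 2)"
    by (intro continuous_on_vector_2 continuous_on_divide continuous_on_const) auto
  then show ?thesis by (simp add: semicircle_def[abs_def] Let_def x_def n_def)
qed

lemma arc_semicircle:
  assumes "p \<noteq> 0" "q \<noteq> 0" "p < q"
  shows "arc (semicircle p q)"
  unfolding arc_def path_def
proof
  show "inj_on (semicircle p q) {0..1}"
  proof (rule inj_onI)
    fix s s' assume s: "s \<in> {0..1}" "s' \<in> {0..1}" "semicircle p q s = semicircle p q s'"
    have "unroll (semicircle p q r) $ 1 = (1 - r) * p + r * q" if "r \<in> {0..1}" for r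
      using unroll_semicircle[of p q r] assms that by (simp del: unroll_simps)
    from this[OF s(1)] this[OF s(2)] have "(1 - s) * p + s * q = (1 - s') * p + s' * q"
      unfolding s(3) by (rule HOL.trans[OF HOL.sym])
    then have "(s - s') * (q - p) = 0" by (simp add: algebra_simps)
    then show "s = s'" using assms by simp
  qed
qed (rule continuous_on_semicircle[OF assms(1,2)])

lemma vertex_pos_strip: "0 \<le> vertex_pos v $ 2" "vertex_pos v $ 2 \<le> 1"
  by (cases v; simp)+

lemma boundary_pos_nonzero [simp]: "boundary_pos v \<noteq> 0"
  by (cases v) auto

lemma semicircle_ends:
  "semicircle (boundary_pos u) (boundary_pos v) 0 = vertex_pos u"
  "semicircle (boundary_pos u) (boundary_pos v) 1 = vertex_pos v"
proof -
  have strip: "0 \<le> semicircle (boundary_pos u) (boundary_pos v) s $ 2"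
    "semicircle (boundary_pos u) (boundary_pos v) s $ 2 \<le> 1" if "s \<in> {0..1}" for s
    using semicircle_strip that by simp_all
  have "unroll (semicircle (boundary_pos u) (boundary_pos v) 0) = unroll (vertex_pos u)"
    using unroll_semicircle[of "boundary_pos u" "boundary_pos v" 0] by (simp add: unroll_vertex_pos)
  then show "semicircle (boundary_pos u) (boundary_pos v) 0 = vertex_pos u"
    by (rule unroll_inject) (simp_all add: strip vertex_pos_strip)
  have "unroll (semicircle (boundary_pos u) (boundary_pos v) 1) = unroll (vertex_pos v)"
    using unroll_semicircle[of "boundary_pos u" "boundary_pos v" 1] by (simp add: unroll_vertex_pos)
  then show "semicircle (boundary_pos u) (boundary_pos v) 1 = vertex_pos v"
    by (rule unroll_inject) (simp_all add: strip vertex_pos_strip)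
qed

text \<open>The squared radius is an average of the squared radii of the two ends. After taking
  logarithms an arc therefore never leaves the rectangle on the left or on the right, and the range
  of the angle bounds its height.\<close>

lemma semicircle_rectangle:
  assumes "u \<in> vertices k l" "v \<in> vertices k l" "0 \<le> s" "s \<le> 1"
  shows "semicircle (boundary_pos u) (boundary_pos v) s \<in> rectangle k l"
proof -
  define n where "n = (1 - s) * (boundary_pos u)\<^sup>2 + s * (boundary_pos v)\<^sup>2"
  define M where "M = real (max k l)"
  have sq: "exp 2 \<le> (boundary_pos w)\<^sup>2 \<and> (boundary_pos w)\<^sup>2 \<le> exp (2 * M)" if "w \<in> vertices k l" for w
    using that by (cases w) (auto simp: M_def exp_double[symmetric])
  have "(1 - s) * exp 2 + s * exp 2 \<le> n" "n \<le> (1 - s) * exp (2 * M) + s * exp (2 * M)"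
    unfolding n_def using sq[OF assms(1)] sq[OF assms(2)] assms(3,4) by (intro add_mono mult_left_mono; simp)+
  then have "exp 2 \<le> n" "n \<le> exp (2 * M)" by (simp_all add: algebra_simps)
  moreover have "0 < n" using \<open>exp 2 \<le> n\<close> exp_gt_zero[of "2 :: real"] by linarith
  ultimately have "2 \<le> ln n" "ln n \<le> 2 * M"
    using ln_le_cancel_iff[of n "exp (2 * M)"] by (simp_all add: ln_ge_iff)
  then show ?thesis
    using semicircle_strip[of "boundary_pos u" "boundary_pos v" s] assms(3,4)
    unfolding rectangle_def mem_cbox_2 by (auto simp: semicircle_def Let_def n_def M_def)
qed

text \<open>Both sides are squared heights above \<open>x\<close>: a strictly nested semicircle lies
  strictly lower.\<close>

lemma semicircles_disjoint:
  fixes p q p' q' x :: real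
  assumes "p < p'" "q' < q" "p' \<le> x" "x \<le> q'"
  shows "(x - p') * (q' - x) < (x - p) * (q - x)"
proof -
  have "(x - p') * (q' - x) \<le> (x - p') * (q - x)" using assms by (intro mult_left_mono) auto
  also have "\<dots> < (x - p) * (q - x)" using assms by (intro mult_strict_right_mono) auto
  finally show ?thesis .
qed

lemma noncrossing_imp_planar:
  assumes D: "D \<in> matchings k l"
  shows "planar k l D"
proof -
  have P: "D \<in> partitions k l" and nc: "noncrossing D" and card: "\<forall>B\<in>D. card B \<le> 2"
    using D by (auto simp: matchings_def)
  define E where "E = {B\<in>D. card B = 2}"
  \<comment> \<open>\<open>Min\<close> and \<open>Max\<close> put the ends of an undirected edge in
    order.\<close>
  define \<gamma> where "\<gamma> e = semicircle (Min (boundary_pos ` e)) (Max (boundary_pos ` e))" for e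
  have edge: "\<exists>u v. e = {u, v} \<and> u \<in> vertices k l \<and> v \<in> vertices k l \<and> boundary_pos u < boundary_pos v \<and>
      {u, v} \<in> D \<and> \<gamma> e = semicircle (boundary_pos u) (boundary_pos v)" if "e \<in> E" for e
  proof -
    from that obtain u v where uv: "e = {u, v}" "u \<noteq> v" "e \<in> D" by (auto simp: E_def card_2_iff)
    have V: "u \<in> vertices k l" "v \<in> vertices k l" using partitions_vertices[OF P uv(3)] uv(1) by auto
    then have "boundary_pos u \<noteq> boundary_pos v" using boundary_pos_inject uv(2) by blast
    then consider "boundary_pos u < boundary_pos v" | "boundary_pos v < boundary_pos u" by linarith
    then show ?thesis
    proof cases
      case 1
      then show ?thesis using uv V by (intro exI[of _ u] exI[of _ v]) (auto simp: \<gamma>_def)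
    next
      case 2
      then show ?thesis using uv V by (intro exI[of _ v] exI[of _ u]) (auto simp: \<gamma>_def insert_commute)
    qed
  qed
  have "crossing_free_drawing k l E \<gamma>"
    unfolding crossing_free_drawing_def
  proof (intro conjI ballI impI)
    fix e assume "e \<in> E"
    from edge[OF this] obtain u v where e: "e = {u, v}" and V: "u \<in> vertices k l" "v \<in> vertices k l"
      and less: "boundary_pos u < boundary_pos v" and \<gamma>: "\<gamma> e = semicircle (boundary_pos u) (boundary_pos v)" by blast
    show "arc (\<gamma> e)" unfolding \<gamma> using less by (intro arc_semicircle) auto
    show "path_image (\<gamma> e) \<subseteq> rectangle k l"
      unfolding \<gamma> path_image_def using semicircle_rectangle[OF V] by auto
    show ends: "{pathstart (\<gamma> e), pathfinish (\<gamma> e)} = vertex_pos ` e"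
      unfolding \<gamma> by (simp add: e pathstart_def pathfinish_def semicircle_ends)
    show "path_image (\<gamma> e) \<inter> vertex_pos ` vertices k l = vertex_pos ` e"
    proof
      show "vertex_pos ` e \<subseteq> path_image (\<gamma> e) \<inter> vertex_pos ` vertices k l"
      proof -
        have "vertex_pos ` e \<subseteq> path_image (\<gamma> e)" unfolding ends[symmetric] by (simp add: pathstart_in_path_image pathfinish_in_path_image)
        moreover have "e \<subseteq> vertices k l" using V e by simp
        ultimately show ?thesis by blast
      qed
      show "path_image (\<gamma> e) \<inter> vertex_pos ` vertices k l \<subseteq> vertex_pos ` e"
      proof clarify
        fix w assume "vertex_pos w \<in> path_image (\<gamma> e)" and w: "w \<in> vertices k l"
        then obtain s where s: "0 \<le> s" "s \<le> 1" "vertex_pos w = semicircle (boundary_pos u) (boundary_pos v) s"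
          unfolding \<gamma> path_image_def by auto
        define x where "x = (1 - s) * boundary_pos u + s * boundary_pos v"
        have "vector [boundary_pos w, 0] = (vector [x, sqrt ((x - boundary_pos u) * (boundary_pos v - x))] :: real ^ 2)"
          using unroll_semicircle[of "boundary_pos u" "boundary_pos v" s] s unroll_vertex_pos[of w] by (simp add: x_def)
        then have "boundary_pos w = x" "(x - boundary_pos u) * (boundary_pos v - x) = 0"
          by (auto simp: vec_eq_iff forall_2)
        \<comment> \<open>A vertex lies at height 0, where a semicircle only has its ends.\<close>
        then have "boundary_pos w = boundary_pos u \<or> boundary_pos w = boundary_pos v" by auto
        then have "w \<in> e" using boundary_pos_inject[OF w] V e by blast
        then show "vertex_pos w \<in> vertex_pos ` e" by blast
      qed
    qed
  next
    fix e e' assume ee: "e \<in> E" "e' \<in> E" "e \<noteq> e'"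
    from edge[OF ee(1)] obtain u v where e: "e = {u, v}" "{u, v} \<in> D" and V: "u \<in> vertices k l" "v \<in> vertices k l"
      and less: "boundary_pos u < boundary_pos v" and \<gamma>: "\<gamma> e = semicircle (boundary_pos u) (boundary_pos v)" by blast
    from edge[OF ee(2)] obtain u' v' where e': "e' = {u', v'}" "{u', v'} \<in> D" and V': "u' \<in> vertices k l" "v' \<in> vertices k l"
      and less': "boundary_pos u' < boundary_pos v'" and \<gamma>': "\<gamma> e' = semicircle (boundary_pos u') (boundary_pos v')" by blast
    have ne: "boundary_pos a \<noteq> boundary_pos b" if "a \<in> {u, v}" "b \<in> {u', v'}" for a b
    proof
      assume "boundary_pos a = boundary_pos b"
      then have "a = b" using boundary_pos_inject that V V' by blast
      then have "e = e'" using partitions_disjoint[OF P e(2) e'(2)] that e(1) e'(1) by blast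
      then show False using ee(3) by simp
    qed
    have False if z: "z \<in> path_image (\<gamma> e)" "z \<in> path_image (\<gamma> e')" for z
    proof -
      let ?p = "boundary_pos u" and ?q = "boundary_pos v" and ?p' = "boundary_pos u'" and ?q' = "boundary_pos v'"
      from z obtain s s' where s: "0 \<le> s" "s \<le> 1" "z = semicircle ?p ?q s" and s': "0 \<le> s'" "s' \<le> 1" "z = semicircle ?p' ?q' s'"
        unfolding \<gamma> \<gamma>' path_image_def by auto
      define x where "x = (1 - s) * ?p + s * ?q"
      define x' where "x' = (1 - s') * ?p' + s' * ?q'"
      have "vector [x, sqrt ((x - ?p) * (?q - x))] = (vector [x', sqrt ((x' - ?p') * (?q' - x'))] :: real ^ 2)"
        using unroll_semicircle[of ?p ?q s] unroll_semicircle[of ?p' ?q' s'] s s' by (simp add: x_def x'_def)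
      then have xx: "x = x'" and eq: "(x - ?p) * (?q - x) = (x - ?p') * (?q' - x)"
        by (auto simp: vec_eq_iff forall_2)
      have convex: "a \<le> (1 - r) * a + r * b" "(1 - r) * a + r * b \<le> b" if "a < b" "0 \<le> r" "r \<le> 1" for a b r :: real
      proof -
        have "0 \<le> r * (b - a)" "0 \<le> (1 - r) * (b - a)" using that by auto
        then show "a \<le> (1 - r) * a + r * b" "(1 - r) * a + r * b \<le> b" by (simp_all add: algebra_simps)
      qed
      have x: "?p \<le> x" "x \<le> ?q" "?p' \<le> x" "x \<le> ?q'"
        using convex[OF less s(1,2)] convex[OF less' s'(1,2)] xx by (simp_all add: x_def x'_def)
      have nc1: "\<not> (?p < ?p' \<and> ?p' < ?q \<and> ?q < ?q')"
        using noncrossingD[OF nc e(2) e'(2)] V V' by (auto simp: boundary_pos_less_iff)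
      have nc2: "\<not> (?p' < ?p \<and> ?p < ?q' \<and> ?q' < ?q)"
        using noncrossingD[OF nc e'(2) e(2)] V V' by (auto simp: boundary_pos_less_iff)
      have "?p \<noteq> ?p'" "?p \<noteq> ?q'" "?q \<noteq> ?p'" "?q \<noteq> ?q'" using ne by auto
      \<comment> \<open>Both intervals contain \<open>x\<close>, so they overlap; without a crossing
        one is nested in the other.\<close>
      then consider "?p < ?p'" "?q' < ?q" | "?p' < ?p" "?q < ?q'" using nc1 nc2 x by linarith
      then show False
      proof cases
        case 1
        from semicircles_disjoint[OF this x(3,4)] eq show False by simp
      next
        case 2
        from semicircles_disjoint[OF this x(1,2)] eq show False by simp
      qed
    qed
    then show "path_image (\<gamma> e) \<inter> path_image (\<gamma> e') \<subseteq> vertex_pos ` (e \<inter> e')" by blast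
  qed
  moreover have "edges_for k l D E" unfolding E_def using P card by (rule edges_for_pairs)
  ultimately show ?thesis unfolding planar_def by blast
qed

theorem motzkin_diagrams_eq: "motzkin_diagrams k l = matchings k l"
  using planar_imp_noncrossing noncrossing_imp_planar
  by (auto simp: motzkin_diagrams_def) (auto simp: matchings_def)

theorem theorem7p8:
  fixes R :: "('a, 'b) ring_scheme" and t :: 'a and k l :: nat
  assumes "cring R" and "t \<in> carrier R"
  shows "(\<forall>D \<in> motzkin_diagrams k l. \<exists>X \<in> carrier (Hom_M R t k l). represents R t k l X D) \<and>
    (\<forall>D \<in> motzkin_diagrams k l. \<forall>X Y.
       represents R t k l X D \<longrightarrow> represents R t k l Y D \<longrightarrow> X = Y) \<and>
    module_basis R (Hom_M R t k l) (motzkin_diagrams k l) (diagram_morphism R t k l)"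
proof -
  interpret par_category R t
    using assms by (simp add: par_category_def par_category_axioms_def)
  show ?thesis
    unfolding motzkin_diagrams_eq using module_basis_matchings by (auto simp: represents_iff)
qed

end
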